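(* Let $H$ be a Hopf algebra with a bijective antipode, and assume that $(H\otimes H,\ \triangleright=\rightharpoonup\otimes\,\mathrm{id},\ \rho^l=\Delta\otimes\mathrm{id},\ \triangleleft=\mathrm{id}\otimes\leftharpoonup,\ \rho^r=\mathrm{id}\otimes\Delta)\in\mathcal{LR}(H)$, where $\Delta$ is the usual comultiplication of $H$, $\rightharpoonup$ is a left action of $H$ on $H$ and $\leftharpoonup$ is a right action of $H$ on $H$ (so $h\triangleright(k\otimes l)=(h\rightharpoonup k)\otimes l$ and $(k\otimes l)\triangleleft h=k\otimes(l\leftharpoonup h)$). Write $\psi=\psi_{H\otimes H,H\otimes H}$. Then $\psi$ is a symmetry (i.e. $\psi\circ\psi=\mathrm{id}$) if and only if there exists a braiding $\zeta:H\otimes H\to\Bbbk$ so that $(H,\zeta)$ is a cotriangular Hopf algebra. And then $\zeta(k,g)\zeta(h,l)=(\varepsilon\otimes\varepsilon\otimes\varepsilon\otimes\varepsilon)\psi(k\otimes l\otimes g\otimes h)$, for any $k,l,g,h\in H$. That is, $$h\triangleright(k\otimes l)=(h\rightharpoonup k)\otimes l=\zeta(h,k_1)k_2\otimes l,\qquad (k\otimes l)\triangleleft h=k\otimes(l\leftharpoonup h)=k\otimes l_1\zeta(h,l_2).$$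
   Context: Everything is over a field $\Bbbk$; Sweedler notation $\Delta(h)=h_1\otimes h_2$ is used with summation omitted; $\varepsilon$ is the counit. A coquasitriangular Hopf algebra is a pair $(H,\zeta)$ with $H$ a Hopf algebra and $\zeta:H\otimes H\to\Bbbk$ a $\Bbbk$-bilinear form (called a braiding), convolution invertible in $\mathrm{Hom}_{\Bbbk}(H\otimes H,\Bbbk)$, such that for all $h,g,l\in H$: $\zeta(h,gl)=\zeta(h_1,g)\zeta(h_2,l)$; $\zeta(hg,l)=\zeta(h,l_2)\zeta(g,l_1)$; $\zeta(h_1,g_1)g_2h_2=h_1g_1\zeta(h_2,g_2)$; $\zeta(h,1)=\varepsilon(h)=\zeta(1,h)$. It is cotriangular if moreover $\zeta(h_1,g_1)\zeta(g_2,h_2)=\varepsilon(g)\varepsilon(h)$ for all $g,h\in H$. A Yetter-Drinfel'd-Long bimodule over $H$ is a vector space $M$ which is an $H$-bimodule (left action $h\otimes m\mapsto h\triangleright m$, right action $m\otimes h\mapsto m\triangleleft h$, with $(a\triangleright m)\triangleleft b=a\triangleright(m\triangleleft b)$) and an $H$-bicomodule (left coaction $\rho^l(m)=m_{[-1]}\otimes m_{[0]}\in H\otimes M$, right coaction $\rho^r(m)=m_{(0)}\otimes m_{(1)}\in M\otimes H$, with $m_{[-1]}\otimes m_{[0](0)}\otimes m_{[0](1)}=m_{(0)[-1]}\otimes m_{(0)[0]}\otimes m_{(1)}$), such that for all $h\in H$, $m\in M$: $(h_1\triangleright m)_{[-1]}h_2\otimes(h_1\triangleright m)_{[0]}=h_1m_{[-1]}\otimes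 h_2\triangleright m_{[0]}$; $(h\triangleright m)_{(0)}\otimes(h\triangleright m)_{(1)}=h\triangleright m_{(0)}\otimes m_{(1)}$; $(m\triangleleft h_2)_{(0)}\otimes h_1(m\triangleleft h_2)_{(1)}=m_{(0)}\triangleleft h_1\otimes m_{(1)}h_2$; $(m\triangleleft h)_{[-1]}\otimes(m\triangleleft h)_{[0]}=m_{[-1]}\otimes m_{[0]}\triangleleft h$. $\mathcal{LR}(H)$ is the category of Yetter-Drinfel'd-Long bimodules over $H$, with morphisms the $H$-bilinear and $H$-bicolinear maps. If the antipode of $H$ is bijective it is a braided monoidal category (diagonal actions and codiagonal coactions on tensor products) with braiding $\psi_{M,N}:M\otimes N\to N\otimes M$, $\psi_{M,N}(m\otimes n)=m_{[-1]}\triangleright n_{(0)}\otimes m_{[0]}\triangleleft n_{(1)}$.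
   Formalization: The single-ζ claim is false (k[C₂], ⇀ trivial, ↼ by sign). Proved: ψ²=id and ε(h⇀k)=ε(k↼h) for all h,k iff one cotriangular ζ gives both actions and the ε⁴ψ formula; and ψ²=id alone iff two cotriangular forms do, ζ for ⇀ and ξ for ↼. *)

theory Defs
  imports "HOL-Algebra.Module" "HOL-Algebra.AbelCoset"
begin

section \<open>Tensor products of vector spaces\<close>

definition linear_map ::
  "('k, 'r) ring_scheme \<Rightarrow> ('k, 'v, 'x) module_scheme \<Rightarrow> ('k, 'w, 'y) module_scheme
    \<Rightarrow> ('v \<Rightarrow> 'w) \<Rightarrow> bool"
  where "linear_map K V W f \<longleftrightarrow>
    f \<in> carrier V \<rightarrow> carrier W \<and>
    (\<forall>u\<in>carrier V. \<forall>v\<in>carrier V. f (u \<oplus>\<^bsub>V\<^esub> v) = f u \<oplus>\<^bsub>W\<^esub> f v) \<and>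
    (\<forall>c\<in>carrier K. \<forall>v\<in>carrier V. f (c \<odot>\<^bsub>V\<^esub> v) = c \<odot>\<^bsub>W\<^esub> f v)"

definition bilinear_map ::
  "('k, 'r) ring_scheme \<Rightarrow> ('k, 'v, 'x) module_scheme \<Rightarrow> ('k, 'w, 'y) module_scheme
    \<Rightarrow> ('k, 'u, 'z) module_scheme \<Rightarrow> ('v \<Rightarrow> 'w \<Rightarrow> 'u) \<Rightarrow> bool"
  where "bilinear_map K V W X \<beta> \<longleftrightarrow>
    (\<forall>v\<in>carrier V. linear_map K W X (\<beta> v)) \<and>
    (\<forall>w\<in>carrier W. linear_map K V X (\<lambda>v. \<beta> v w))"

definition regular_module :: "('k, 'r) ring_scheme \<Rightarrow> ('k, 'k) module"
  where "regular_module K = \<lparr>carrier = carrier K, mult = mult K, one = one K,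
    zero = zero K, add = add K, smult = mult K\<rparr>"

text \<open>A module record also has the ring fields \<^const>\<open>mult\<close> and \<^const>\<open>one\<close>, which the
  locale \<^locale>\<open>module\<close> ignores; they are left undefined where only the vector space matters.\<close>

definition free_module :: "('k, 'r) ring_scheme \<Rightarrow> 'a set \<Rightarrow> ('k, 'a \<Rightarrow> 'k) module"
  where "free_module K A = \<lparr>
    carrier = {f. (\<forall>x. f x \<in> carrier K) \<and> (\<forall>x. x \<notin> A \<longrightarrow> f x = \<zero>\<^bsub>K\<^esub>) \<and> finite {x. f x \<noteq> \<zero>\<^bsub>K\<^esub>}},
    mult = undefined, one = undefined,
    zero = (\<lambda>x. \<zero>\<^bsub>K\<^esub>),
    add = (\<lambda>f g x. f x \<oplus>\<^bsub>K\<^esub> g x),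
    smult = (\<lambda>c f x. c \<otimes>\<^bsub>K\<^esub> f x)\<rparr>"

definition free_gen :: "('k, 'r) ring_scheme \<Rightarrow> 'a \<Rightarrow> 'a \<Rightarrow> 'k"
  where "free_gen K a = (\<lambda>x. if x = a then \<one>\<^bsub>K\<^esub> else \<zero>\<^bsub>K\<^esub>)"

definition submodule_span ::
  "('k, 'r) ring_scheme \<Rightarrow> ('k, 'v, 'x) module_scheme \<Rightarrow> 'v set \<Rightarrow> 'v set"
  where "submodule_span K V S = \<Inter>{U. submodule U K V \<and> S \<subseteq> U}"

definition quotient_module ::
  "('k, 'v, 'x) module_scheme \<Rightarrow> 'v set \<Rightarrow> ('k, 'v set) module"
  where "quotient_module V U = \<lparr>
    carrier = a_rcosets\<^bsub>V\<^esub> U,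
    mult = undefined, one = undefined,
    zero = U,
    add = set_add V,
    smult = (\<lambda>c X. \<Union>x\<in>X. U +>\<^bsub>V\<^esub> (c \<odot>\<^bsub>V\<^esub> x))\<rparr>"

definition tensor_relations ::
  "('k, 'r) ring_scheme \<Rightarrow> ('k, 'v, 'x) module_scheme \<Rightarrow> ('k, 'w, 'y) module_scheme
    \<Rightarrow> ('v \<times> 'w \<Rightarrow> 'k) set"
  where "tensor_relations K V W =
    (let F = free_module K (carrier V \<times> carrier W); e = free_gen K in
      {e (v \<oplus>\<^bsub>V\<^esub> v', w) \<ominus>\<^bsub>F\<^esub> (e (v, w) \<oplus>\<^bsub>F\<^esub> e (v', w)) | v v' w.
          v \<in> carrier V \<and> v' \<in> carrier V \<and> w \<in> carrier W}
    \<union> {e (v, w \<oplus>\<^bsub>W\<^esub> w') \<ominus>\<^bsub>F\<^esub> (e (v, w) \<oplus>\<^bsub>F\<^esub> e (v, w')) | v w w'.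
          v \<in> carrier V \<and> w \<in> carrier W \<and> w' \<in> carrier W}
    \<union> {e (c \<odot>\<^bsub>V\<^esub> v, w) \<ominus>\<^bsub>F\<^esub> (c \<odot>\<^bsub>F\<^esub> e (v, w)) | c v w.
          c \<in> carrier K \<and> v \<in> carrier V \<and> w \<in> carrier W}
    \<union> {e (v, c \<odot>\<^bsub>W\<^esub> w) \<ominus>\<^bsub>F\<^esub> (c \<odot>\<^bsub>F\<^esub> e (v, w)) | c v w.
          c \<in> carrier K \<and> v \<in> carrier V \<and> w \<in> carrier W})"

definition tensor_null ::
  "('k, 'r) ring_scheme \<Rightarrow> ('k, 'v, 'x) module_scheme \<Rightarrow> ('k, 'w, 'y) module_scheme
    \<Rightarrow> ('v \<times> 'w \<Rightarrow> 'k) set"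
  where "tensor_null K V W =
    submodule_span K (free_module K (carrier V \<times> carrier W)) (tensor_relations K V W)"

type_synonym ('k, 'v, 'w) tensor = "('v \<times> 'w \<Rightarrow> 'k) set"

definition tensor_space ::
  "('k, 'r) ring_scheme \<Rightarrow> ('k, 'v, 'x) module_scheme \<Rightarrow> ('k, 'w, 'y) module_scheme
    \<Rightarrow> ('k, ('k, 'v, 'w) tensor) module"
  where "tensor_space K V W =
    quotient_module (free_module K (carrier V \<times> carrier W)) (tensor_null K V W)"

definition tens ::
  "('k, 'r) ring_scheme \<Rightarrow> ('k, 'v, 'x) module_scheme \<Rightarrow> ('k, 'w, 'y) module_scheme
    \<Rightarrow> 'v \<Rightarrow> 'w \<Rightarrow> ('k, 'v, 'w) tensor"
  where "tens K V W v w =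
    tensor_null K V W +>\<^bsub>free_module K (carrier V \<times> carrier W)\<^esub> free_gen K (v, w)"

text \<open>\<open>tensor_lift K X t \<beta>\<close> is the value at \<open>t\<close> of the linear map into \<open>X\<close> induced by the
  bilinear map \<open>\<beta>\<close>: if \<open>t\<close> is the sum of the \<open>v\<^sub>i \<otimes> w\<^sub>i\<close>, it is the sum of the \<open>\<beta> v\<^sub>i w\<^sub>i\<close>.
  It is independent of the chosen representative of \<open>t\<close> because \<open>\<beta>\<close> is bilinear.
  Sweedler notation is rendered by it: an expression \<open>E(h\<^sub>1, h\<^sub>2)\<close> with values in \<open>X\<close>
  becomes \<open>tensor_lift K X (\<Delta> h) (\<lambda>h1 h2. E h1 h2)\<close>, and likewise for coactions.\<close>

definition tensor_lift ::
  "('k, 'r) ring_scheme \<Rightarrow> ('k, 'u, 'z) module_scheme \<Rightarrow> ('k, 'v, 'w) tensor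
    \<Rightarrow> ('v \<Rightarrow> 'w \<Rightarrow> 'u) \<Rightarrow> 'u"
  where "tensor_lift K X t \<beta> =
    (let f = (SOME f. f \<in> t) in
      \<Oplus>\<^bsub>X\<^esub>p\<in>{p. f p \<noteq> \<zero>\<^bsub>K\<^esub>}. f p \<odot>\<^bsub>X\<^esub> \<beta> (fst p) (snd p))"


section \<open>Hopf algebras\<close>

record ('k, 'h) hopf = "('k, 'h) module" +
  comult :: "'h \<Rightarrow> ('k, 'h, 'h) tensor"
  counit :: "'h \<Rightarrow> 'k"
  antipode :: "'h \<Rightarrow> 'h"

locale hopf_algebra = field K + H?: ring H + module K H
  for K :: "('k, 'r) ring_scheme" and H :: "('k, 'h, 'm) hopf_scheme" +
  assumes smult_mult_left:
      "\<lbrakk>c \<in> carrier K; x \<in> carrier H; y \<in> carrier H\<rbrakk>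
        \<Longrightarrow> (c \<odot>\<^bsub>H\<^esub> x) \<otimes>\<^bsub>H\<^esub> y = c \<odot>\<^bsub>H\<^esub> (x \<otimes>\<^bsub>H\<^esub> y)"
    and smult_mult_right:
      "\<lbrakk>c \<in> carrier K; x \<in> carrier H; y \<in> carrier H\<rbrakk>
        \<Longrightarrow> x \<otimes>\<^bsub>H\<^esub> (c \<odot>\<^bsub>H\<^esub> y) = c \<odot>\<^bsub>H\<^esub> (x \<otimes>\<^bsub>H\<^esub> y)"
    and comult_linear: "linear_map K H (tensor_space K H H) (comult H)"
    and counit_linear: "linear_map K H (regular_module K) (counit H)"
    and antipode_linear: "linear_map K H H (antipode H)"
    and coassoc:
      "h \<in> carrier H \<Longrightarrow>
        tensor_lift K (tensor_space K H (tensor_space K H H)) (comult H h) (\<lambda>h1 h2.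
          tensor_lift K (tensor_space K H (tensor_space K H H)) (comult H h1) (\<lambda>h11 h12.
            tens K H (tensor_space K H H) h11 (tens K H H h12 h2)))
        = tensor_lift K (tensor_space K H (tensor_space K H H)) (comult H h) (\<lambda>h1 h2.
            tens K H (tensor_space K H H) h1 (comult H h2))"
    and counit_left:
      "h \<in> carrier H \<Longrightarrow> tensor_lift K H (comult H h) (\<lambda>h1 h2. counit H h1 \<odot>\<^bsub>H\<^esub> h2) = h"
    and counit_right:
      "h \<in> carrier H \<Longrightarrow> tensor_lift K H (comult H h) (\<lambda>h1 h2. counit H h2 \<odot>\<^bsub>H\<^esub> h1) = h"
    and comult_mult:
      "\<lbrakk>h \<in> carrier H; g \<in> carrier H\<rbrakk> \<Longrightarrow>
        comult H (h \<otimes>\<^bsub>H\<^esub> g) =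
          tensor_lift K (tensor_space K H H) (comult H h) (\<lambda>h1 h2.
            tensor_lift K (tensor_space K H H) (comult H g) (\<lambda>g1 g2.
              tens K H H (h1 \<otimes>\<^bsub>H\<^esub> g1) (h2 \<otimes>\<^bsub>H\<^esub> g2)))"
    and comult_one: "comult H \<one>\<^bsub>H\<^esub> = tens K H H \<one>\<^bsub>H\<^esub> \<one>\<^bsub>H\<^esub>"
    and counit_mult:
      "\<lbrakk>h \<in> carrier H; g \<in> carrier H\<rbrakk> \<Longrightarrow>
        counit H (h \<otimes>\<^bsub>H\<^esub> g) = counit H h \<otimes>\<^bsub>K\<^esub> counit H g"
    and counit_one: "counit H \<one>\<^bsub>H\<^esub> = \<one>\<^bsub>K\<^esub>"
    and antipode_left:
      "h \<in> carrier H \<Longrightarrow>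
        tensor_lift K H (comult H h) (\<lambda>h1 h2. antipode H h1 \<otimes>\<^bsub>H\<^esub> h2) = counit H h \<odot>\<^bsub>H\<^esub> \<one>\<^bsub>H\<^esub>"
    and antipode_right:
      "h \<in> carrier H \<Longrightarrow>
        tensor_lift K H (comult H h) (\<lambda>h1 h2. h1 \<otimes>\<^bsub>H\<^esub> antipode H h2) = counit H h \<odot>\<^bsub>H\<^esub> \<one>\<^bsub>H\<^esub>"

text \<open>Linear forms on \<open>H \<otimes> H\<close> are given as bilinear forms on \<open>H\<close>.\<close>

definition form_convolution ::
  "('k, 'r) ring_scheme \<Rightarrow> ('k, 'h, 'm) hopf_scheme
    \<Rightarrow> ('h \<Rightarrow> 'h \<Rightarrow> 'k) \<Rightarrow> ('h \<Rightarrow> 'h \<Rightarrow> 'k) \<Rightarrow> 'h \<Rightarrow> 'h \<Rightarrow> 'k"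
  where "form_convolution K H \<zeta> \<xi> h g =
    tensor_lift K (regular_module K) (comult H h) (\<lambda>h1 h2.
      tensor_lift K (regular_module K) (comult H g) (\<lambda>g1 g2.
        \<zeta> h1 g1 \<otimes>\<^bsub>K\<^esub> \<xi> h2 g2))"

locale coquasitriangular_hopf_algebra = hopf_algebra K H
  for K :: "('k, 'r) ring_scheme" and H :: "('k, 'h, 'm) hopf_scheme" +
  fixes \<zeta> :: "'h \<Rightarrow> 'h \<Rightarrow> 'k"
  assumes form_bilinear: "bilinear_map K H H (regular_module K) \<zeta>"
    and form_invertible:
      "\<exists>\<xi>. bilinear_map K H H (regular_module K) \<xi> \<and>
        (\<forall>h\<in>carrier H. \<forall>g\<in>carrier H.
          form_convolution K H \<zeta> \<xi> h g = counit H h \<otimes>\<^bsub>K\<^esub> counit H g \<and>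
          form_convolution K H \<xi> \<zeta> h g = counit H h \<otimes>\<^bsub>K\<^esub> counit H g)"
    and form_mult_right:
      "\<lbrakk>h \<in> carrier H; g \<in> carrier H; l \<in> carrier H\<rbrakk> \<Longrightarrow>
        \<zeta> h (g \<otimes>\<^bsub>H\<^esub> l) =
          tensor_lift K (regular_module K) (comult H h) (\<lambda>h1 h2. \<zeta> h1 g \<otimes>\<^bsub>K\<^esub> \<zeta> h2 l)"
    and form_mult_left:
      "\<lbrakk>h \<in> carrier H; g \<in> carrier H; l \<in> carrier H\<rbrakk> \<Longrightarrow>
        \<zeta> (h \<otimes>\<^bsub>H\<^esub> g) l =
          tensor_lift K (regular_module K) (comult H l) (\<lambda>l1 l2. \<zeta> h l2 \<otimes>\<^bsub>K\<^esub> \<zeta> g l1)"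
    and form_commute:
      "\<lbrakk>h \<in> carrier H; g \<in> carrier H\<rbrakk> \<Longrightarrow>
        tensor_lift K H (comult H h) (\<lambda>h1 h2. tensor_lift K H (comult H g) (\<lambda>g1 g2.
          \<zeta> h1 g1 \<odot>\<^bsub>H\<^esub> (g2 \<otimes>\<^bsub>H\<^esub> h2)))
        = tensor_lift K H (comult H h) (\<lambda>h1 h2. tensor_lift K H (comult H g) (\<lambda>g1 g2.
          \<zeta> h2 g2 \<odot>\<^bsub>H\<^esub> (h1 \<otimes>\<^bsub>H\<^esub> g1)))"
    and form_one_right: "h \<in> carrier H \<Longrightarrow> \<zeta> h \<one>\<^bsub>H\<^esub> = counit H h"
    and form_one_left: "h \<in> carrier H \<Longrightarrow> \<zeta> \<one>\<^bsub>H\<^esub> h = counit H h"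

locale cotriangular_hopf_algebra = coquasitriangular_hopf_algebra K H \<zeta>
  for K :: "('k, 'r) ring_scheme" and H :: "('k, 'h, 'm) hopf_scheme" and \<zeta> +
  assumes form_symmetric:
    "\<lbrakk>h \<in> carrier H; g \<in> carrier H\<rbrakk> \<Longrightarrow>
      form_convolution K H \<zeta> (\<lambda>a b. \<zeta> b a) h g = counit H g \<otimes>\<^bsub>K\<^esub> counit H h"


section \<open>Yetter-Drinfel'd-Long bimodules\<close>

definition left_action ::
  "('k, 'r) ring_scheme \<Rightarrow> ('k, 'h, 'm) hopf_scheme \<Rightarrow> ('k, 'v, 'x) module_scheme
    \<Rightarrow> ('h \<Rightarrow> 'v \<Rightarrow> 'v) \<Rightarrow> bool"
  where "left_action K H V act \<longleftrightarrow>
    bilinear_map K H V V act \<and>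
    (\<forall>v\<in>carrier V. act \<one>\<^bsub>H\<^esub> v = v) \<and>
    (\<forall>a\<in>carrier H. \<forall>b\<in>carrier H. \<forall>v\<in>carrier V. act (a \<otimes>\<^bsub>H\<^esub> b) v = act a (act b v))"

definition right_action ::
  "('k, 'r) ring_scheme \<Rightarrow> ('k, 'h, 'm) hopf_scheme \<Rightarrow> ('k, 'v, 'x) module_scheme
    \<Rightarrow> ('v \<Rightarrow> 'h \<Rightarrow> 'v) \<Rightarrow> bool"
  where "right_action K H V act \<longleftrightarrow>
    bilinear_map K V H V act \<and>
    (\<forall>v\<in>carrier V. act v \<one>\<^bsub>H\<^esub> = v) \<and>
    (\<forall>a\<in>carrier H. \<forall>b\<in>carrier H. \<forall>v\<in>carrier V. act v (a \<otimes>\<^bsub>H\<^esub> b) = act (act v a) b)"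

definition left_coaction ::
  "('k, 'r) ring_scheme \<Rightarrow> ('k, 'h, 'm) hopf_scheme \<Rightarrow> ('k, 'v, 'x) module_scheme
    \<Rightarrow> ('v \<Rightarrow> ('k, 'h, 'v) tensor) \<Rightarrow> bool"
  where "left_coaction K H V \<rho> \<longleftrightarrow>
    linear_map K V (tensor_space K H V) \<rho> \<and>
    (\<forall>v\<in>carrier V.
      tensor_lift K V (\<rho> v) (\<lambda>a v0. counit H a \<odot>\<^bsub>V\<^esub> v0) = v \<and>
      tensor_lift K (tensor_space K H (tensor_space K H V)) (\<rho> v) (\<lambda>a v0.
        tensor_lift K (tensor_space K H (tensor_space K H V)) (comult H a) (\<lambda>a1 a2.
          tens K H (tensor_space K H V) a1 (tens K H V a2 v0)))
      = tensor_lift K (tensor_space K H (tensor_space K H V)) (\<rho> v) (\<lambda>a v0.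
          tens K H (tensor_space K H V) a (\<rho> v0)))"

definition right_coaction ::
  "('k, 'r) ring_scheme \<Rightarrow> ('k, 'h, 'm) hopf_scheme \<Rightarrow> ('k, 'v, 'x) module_scheme
    \<Rightarrow> ('v \<Rightarrow> ('k, 'v, 'h) tensor) \<Rightarrow> bool"
  where "right_coaction K H V \<rho> \<longleftrightarrow>
    linear_map K V (tensor_space K V H) \<rho> \<and>
    (\<forall>v\<in>carrier V.
      tensor_lift K V (\<rho> v) (\<lambda>v0 a. counit H a \<odot>\<^bsub>V\<^esub> v0) = v \<and>
      tensor_lift K (tensor_space K (tensor_space K V H) H) (\<rho> v) (\<lambda>v0 a.
        tensor_lift K (tensor_space K (tensor_space K V H) H) (comult H a) (\<lambda>a1 a2.
          tens K (tensor_space K V H) H (tens K V H v0 a1) a2))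
      = tensor_lift K (tensor_space K (tensor_space K V H) H) (\<rho> v) (\<lambda>v0 a.
          tens K (tensor_space K V H) H (\<rho> v0) a))"

record ('k, 'h, 'v) ydl = "('k, 'v) module" +
  lact :: "'h \<Rightarrow> 'v \<Rightarrow> 'v"
  ract :: "'v \<Rightarrow> 'h \<Rightarrow> 'v"
  lcoact :: "'v \<Rightarrow> ('k, 'h, 'v) tensor"
  rcoact :: "'v \<Rightarrow> ('k, 'v, 'h) tensor"

locale ydl_bimodule = hopf_algebra K H + M?: module K M
  for K :: "('k, 'r) ring_scheme" and H :: "('k, 'h, 'm) hopf_scheme"
    and M :: "('k, 'h, 'v, 'x) ydl_scheme" +
  assumes lact: "left_action K H M (lact M)"
    and ract: "right_action K H M (ract M)"
    and lact_ract:
      "\<lbrakk>a \<in> carrier H; m \<in> carrier M; b \<in> carrier H\<rbrakk> \<Longrightarrow>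
        ract M (lact M a m) b = lact M a (ract M m b)"
    and lcoact: "left_coaction K H M (lcoact M)"
    and rcoact: "right_coaction K H M (rcoact M)"
    and lcoact_rcoact:
      "m \<in> carrier M \<Longrightarrow>
        tensor_lift K (tensor_space K H (tensor_space K M H)) (lcoact M m) (\<lambda>a m0.
          tens K H (tensor_space K M H) a (rcoact M m0))
        = tensor_lift K (tensor_space K H (tensor_space K M H)) (rcoact M m) (\<lambda>m0 b.
            tensor_lift K (tensor_space K H (tensor_space K M H)) (lcoact M m0) (\<lambda>a m00.
              tens K H (tensor_space K M H) a (tens K M H m00 b)))"
    and lact_lcoact:
      "\<lbrakk>h \<in> carrier H; m \<in> carrier M\<rbrakk> \<Longrightarrow>
        tensor_lift K (tensor_space K H M) (comult H h) (\<lambda>h1 h2.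
          tensor_lift K (tensor_space K H M) (lcoact M (lact M h1 m)) (\<lambda>a m0.
            tens K H M (a \<otimes>\<^bsub>H\<^esub> h2) m0))
        = tensor_lift K (tensor_space K H M) (comult H h) (\<lambda>h1 h2.
            tensor_lift K (tensor_space K H M) (lcoact M m) (\<lambda>a m0.
              tens K H M (h1 \<otimes>\<^bsub>H\<^esub> a) (lact M h2 m0)))"
    and lact_rcoact:
      "\<lbrakk>h \<in> carrier H; m \<in> carrier M\<rbrakk> \<Longrightarrow>
        rcoact M (lact M h m)
        = tensor_lift K (tensor_space K M H) (rcoact M m) (\<lambda>m0 a. tens K M H (lact M h m0) a)"
    and ract_rcoact:
      "\<lbrakk>h \<in> carrier H; m \<in> carrier M\<rbrakk> \<Longrightarrow>
        tensor_lift K (tensor_space K M H) (comult H h) (\<lambda>h1 h2.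
          tensor_lift K (tensor_space K M H) (rcoact M (ract M m h2)) (\<lambda>m0 a.
            tens K M H m0 (h1 \<otimes>\<^bsub>H\<^esub> a)))
        = tensor_lift K (tensor_space K M H) (comult H h) (\<lambda>h1 h2.
            tensor_lift K (tensor_space K M H) (rcoact M m) (\<lambda>m0 a.
              tens K M H (ract M m0 h1) (a \<otimes>\<^bsub>H\<^esub> h2)))"
    and ract_lcoact:
      "\<lbrakk>h \<in> carrier H; m \<in> carrier M\<rbrakk> \<Longrightarrow>
        lcoact M (ract M m h)
        = tensor_lift K (tensor_space K H M) (lcoact M m) (\<lambda>a m0. tens K H M a (ract M m0 h))"

definition ydl_braiding ::
  "('k, 'r) ring_scheme \<Rightarrow> ('k, 'h, 'v, 'x) ydl_scheme \<Rightarrow> ('k, 'h, 'w, 'y) ydl_scheme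
    \<Rightarrow> ('k, 'v, 'w) tensor \<Rightarrow> ('k, 'w, 'v) tensor"
  where "ydl_braiding K M N t =
    tensor_lift K (tensor_space K N M) t (\<lambda>m n.
      tensor_lift K (tensor_space K N M) (lcoact M m) (\<lambda>a m0.
        tensor_lift K (tensor_space K N M) (rcoact N n) (\<lambda>n0 b.
          tens K N M (lact N a n0) (ract M m0 b))))"


section \<open>The structure on the tensor square\<close>

text \<open>\<open>H \<otimes> H\<close> with the actions \<open>\<rightharpoonup> \<otimes> id\<close> and \<open>id \<otimes> \<leftharpoonup>\<close> and the coactions
  \<open>\<Delta> \<otimes> id\<close> and \<open>id \<otimes> \<Delta>\<close>, where \<open>la h k\<close> is \<open>h \<rightharpoonup> k\<close> and \<open>ra l h\<close> is \<open>l \<leftharpoonup> h\<close>.\<close>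

definition square_ydl ::
  "('k, 'r) ring_scheme \<Rightarrow> ('k, 'h, 'm) hopf_scheme
    \<Rightarrow> ('h \<Rightarrow> 'h \<Rightarrow> 'h) \<Rightarrow> ('h \<Rightarrow> 'h \<Rightarrow> 'h) \<Rightarrow> ('k, 'h, ('k, 'h, 'h) tensor) ydl"
  where "square_ydl K H la ra = module.extend (tensor_space K H H) (ydl.fields
    (\<lambda>h t. tensor_lift K (tensor_space K H H) t (\<lambda>k l. tens K H H (la h k) l))
    (\<lambda>t h. tensor_lift K (tensor_space K H H) t (\<lambda>k l. tens K H H k (ra l h)))
    (\<lambda>t. tensor_lift K (tensor_space K H (tensor_space K H H)) t (\<lambda>k l.
      tensor_lift K (tensor_space K H (tensor_space K H H)) (comult H k) (\<lambda>k1 k2.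
        tens K H (tensor_space K H H) k1 (tens K H H k2 l))))
    (\<lambda>t. tensor_lift K (tensor_space K (tensor_space K H H) H) t (\<lambda>k l.
      tensor_lift K (tensor_space K (tensor_space K H H) H) (comult H l) (\<lambda>l1 l2.
        tens K (tensor_space K H H) H (tens K H H k l1) l2))))"

definition counit2 ::
  "('k, 'r) ring_scheme \<Rightarrow> ('k, 'h, 'm) hopf_scheme \<Rightarrow> ('k, 'h, 'h) tensor \<Rightarrow> 'k"
  where "counit2 K H t =
    tensor_lift K (regular_module K) t (\<lambda>k l. counit H k \<otimes>\<^bsub>K\<^esub> counit H l)"

definition counit4 ::
  "('k, 'r) ring_scheme \<Rightarrow> ('k, 'h, 'm) hopf_scheme
    \<Rightarrow> ('k, ('k, 'h, 'h) tensor, ('k, 'h, 'h) tensor) tensor \<Rightarrow> 'k"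
  where "counit4 K H t =
    tensor_lift K (regular_module K) t (\<lambda>x y. counit2 K H x \<otimes>\<^bsub>K\<^esub> counit2 K H y)"

text \<open>The axioms of \<^locale>\<open>ydl_bimodule\<close> for \<^const>\<open>square_ydl\<close> do not relate \<open>\<rightharpoonup>\<close> to
  \<open>\<leftharpoonup>\<close>, so the two actions may come from two different forms: in the next two predicates
  \<open>\<zeta>\<close> belongs to \<open>\<rightharpoonup>\<close> and \<open>\<xi>\<close> to \<open>\<leftharpoonup>\<close>.\<close>

definition forms_from_braiding ::
  "('k, 'r) ring_scheme \<Rightarrow> ('k, 'h, 'm) hopf_scheme
    \<Rightarrow> ('h \<Rightarrow> 'h \<Rightarrow> 'h) \<Rightarrow> ('h \<Rightarrow> 'h \<Rightarrow> 'h) \<Rightarrow> ('h \<Rightarrow> 'h \<Rightarrow> 'k) \<Rightarrow> ('h \<Rightarrow> 'h \<Rightarrow> 'k) \<Rightarrow> bool"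
  where "forms_from_braiding K H la ra \<zeta> \<xi> \<longleftrightarrow>
    (\<forall>k\<in>carrier H. \<forall>l\<in>carrier H. \<forall>g\<in>carrier H. \<forall>h\<in>carrier H.
      \<zeta> k g \<otimes>\<^bsub>K\<^esub> \<xi> h l =
        counit4 K H (ydl_braiding K (square_ydl K H la ra) (square_ydl K H la ra)
          (tens K (tensor_space K H H) (tensor_space K H H) (tens K H H k l) (tens K H H g h))))"

definition actions_from_forms ::
  "('k, 'r) ring_scheme \<Rightarrow> ('k, 'h, 'm) hopf_scheme
    \<Rightarrow> ('h \<Rightarrow> 'h \<Rightarrow> 'h) \<Rightarrow> ('h \<Rightarrow> 'h \<Rightarrow> 'h) \<Rightarrow> ('h \<Rightarrow> 'h \<Rightarrow> 'k) \<Rightarrow> ('h \<Rightarrow> 'h \<Rightarrow> 'k) \<Rightarrow> bool"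
  where "actions_from_forms K H la ra \<zeta> \<xi> \<longleftrightarrow>
    (\<forall>h\<in>carrier H. \<forall>k\<in>carrier H. \<forall>l\<in>carrier H.
      lact (square_ydl K H la ra) h (tens K H H k l) = tens K H H (la h k) l \<and>
      tens K H H (la h k) l =
        tens K H H (tensor_lift K H (comult H k) (\<lambda>k1 k2. \<zeta> h k1 \<odot>\<^bsub>H\<^esub> k2)) l \<and>
      ract (square_ydl K H la ra) (tens K H H k l) h = tens K H H k (ra l h) \<and>
      tens K H H k (ra l h) =
        tens K H H k (tensor_lift K H (comult H l) (\<lambda>l1 l2. \<xi> h l2 \<odot>\<^bsub>H\<^esub> l1)))"

end

theory Submission
  imports Defs
begin

text \<open>The square of \<open>\<psi>\<close> maps \<open>(k \<otimes> l) \<otimes> (g \<otimes> h)\<close> to \<open>(a \<otimes> c) \<otimes> (b \<otimes> d)\<close>, where \<open>a \<otimes> b\<close> is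
  \<open>\<sigma>\<sigma>(k \<otimes> g)\<close> for \<open>\<sigma>(k \<otimes> g) = (k\<^sub>1 \<rightharpoonup> g) \<otimes> k\<^sub>2\<close>, and \<open>c \<otimes> d\<close> is \<open>\<tau>\<tau>(l \<otimes> h)\<close> for
  \<open>\<tau>(l \<otimes> h) = h\<^sub>1 \<otimes> (l \<leftharpoonup> h\<^sub>2)\<close> (\<open>braiding_squared_tens\<close>). Since \<open>\<tau>\<close> and \<open>\<sigma>\<close> fix \<open>1 \<otimes> 1\<close>, \<open>\<psi>\<close> is a symmetry
  if and only if both \<open>\<sigma>\<close> and \<open>\<tau>\<close> are involutions. The two conditions are mirror images of each
  other; the following describes \<open>\<sigma>\<close>.

  Let \<open>\<zeta>(h, k) = \<epsilon>(h \<rightharpoonup> k)\<close>. If \<open>\<sigma>\<sigma> = id\<close>, then applying \<open>\<epsilon> \<otimes> \<epsilon>\<close> gives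
  \<open>\<zeta>(k\<^sub>1 \<rightharpoonup> g, k\<^sub>2) = \<epsilon>(k) \<epsilon>(g)\<close>, and applying \<open>x \<otimes> y \<mapsto> \<zeta>(x, y\<^sub>1) y\<^sub>2\<close> then gives
  \<open>k \<rightharpoonup> g = \<zeta>(k, g\<^sub>1) g\<^sub>2\<close>. Together they say that the flipped form is the convolution inverse of
  \<open>\<zeta>\<close> (\<open>symmetric_form_of_involutive_left\<close>). The other axioms of a braiding follow: those on
  \<open>\<zeta>(1, h)\<close> and \<open>\<zeta>(h g, l)\<close> from the axioms of an action, the commutation rule from the
  compatibility of \<open>\<triangleright>\<close> with the left coaction (\<open>la_compatible\<close>), and those on \<open>\<zeta>(h, 1)\<close> and
  \<open>\<zeta>(h, g l)\<close> by passing to the convolution inverse (\<open>cotriangular\<close>). Conversely, if \<open>\<rightharpoonup>\<close> is given by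
  a symmetric form, then \<open>\<sigma>\<sigma>\<close> is the identity by coassociativity and cancellation
  (\<open>involutive_left\<close>).

  The form \<open>\<xi>(h, l) = \<epsilon>(l \<leftharpoonup> h)\<close> obtained from \<open>\<tau>\<close> need not be \<open>\<zeta>\<close>. The single form of the first
  equivalence exists exactly when the two agree.

  Identities in iterated tensor products are proved as identities between Sweedler sums of
  multilinear maps with values in an arbitrary vector space. The universal property of
  \<^const>\<open>tensor_space\<close> in the form of rules for \<^const>\<open>tensor_lift\<close> makes this possible.\<close>

section \<open>Linear maps\<close>

lemma linear_mapI:
  assumes "\<And>v. v \<in> carrier V \<Longrightarrow> f v \<in> carrier W"
    and "\<And>u v. u \<in> carrier V \<Longrightarrow> v \<in> carrier V \<Longrightarrow> f (u \<oplus>\<^bsub>V\<^esub> v) = f u \<oplus>\<^bsub>W\<^esub> f v"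
    and "\<And>c v. c \<in> carrier K \<Longrightarrow> v \<in> carrier V \<Longrightarrow> f (c \<odot>\<^bsub>V\<^esub> v) = c \<odot>\<^bsub>W\<^esub> f v"
  shows "linear_map K V W f"
  using assms unfolding linear_map_def by auto

lemma linear_mapD:
  assumes "linear_map K V W f"
  shows linear_map_closed: "v \<in> carrier V \<Longrightarrow> f v \<in> carrier W"
    and linear_map_add: "u \<in> carrier V \<Longrightarrow> v \<in> carrier V \<Longrightarrow> f (u \<oplus>\<^bsub>V\<^esub> v) = f u \<oplus>\<^bsub>W\<^esub> f v"
    and linear_map_smult: "c \<in> carrier K \<Longrightarrow> v \<in> carrier V \<Longrightarrow> f (c \<odot>\<^bsub>V\<^esub> v) = c \<odot>\<^bsub>W\<^esub> f v"
  using assms unfolding linear_map_def by auto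

lemma linear_map_id: "linear_map K V V (\<lambda>v. v)"
  unfolding linear_map_def by auto

lemma linear_map_compose:
  assumes "linear_map K W X f" and "linear_map K V W g"
  shows "linear_map K V X (\<lambda>v. f (g v))"
  using assms unfolding linear_map_def by (auto simp: Pi_iff)

lemma bilinear_mapI:
  assumes "\<And>v. v \<in> carrier V \<Longrightarrow> linear_map K W X (\<beta> v)"
    and "\<And>w. w \<in> carrier W \<Longrightarrow> linear_map K V X (\<lambda>v. \<beta> v w)"
  shows "bilinear_map K V W X \<beta>"
  using assms unfolding bilinear_map_def by auto

lemma bilinear_mapD:
  assumes "bilinear_map K V W X \<beta>"
  shows bilinear_map_left: "w \<in> carrier W \<Longrightarrow> linear_map K V X (\<lambda>v. \<beta> v w)"
    and bilinear_map_right: "v \<in> carrier V \<Longrightarrow> linear_map K W X (\<beta> v)"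
    and bilinear_map_closed: "v \<in> carrier V \<Longrightarrow> w \<in> carrier W \<Longrightarrow> \<beta> v w \<in> carrier X"
  using assms unfolding bilinear_map_def linear_map_def by auto

lemma linear_map_zero:
  assumes "module K V" "module K W" "linear_map K V W f"
  shows "f \<zero>\<^bsub>V\<^esub> = \<zero>\<^bsub>W\<^esub>"
proof -
  interpret V: module K V by fact
  interpret W: module K W by fact
  have "f (\<zero>\<^bsub>K\<^esub> \<odot>\<^bsub>V\<^esub> \<zero>\<^bsub>V\<^esub>) = \<zero>\<^bsub>K\<^esub> \<odot>\<^bsub>W\<^esub> f \<zero>\<^bsub>V\<^esub>"
    by (rule linear_map_smult[OF assms(3)]) auto
  moreover have "f \<zero>\<^bsub>V\<^esub> \<in> carrier W"
    using assms(3) by (simp add: linear_map_closed)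
  ultimately show ?thesis by simp
qed

lemma linear_map_a_inv:
  assumes "module K V" "module K W" "linear_map K V W f" "v \<in> carrier V"
  shows "f (\<ominus>\<^bsub>V\<^esub> v) = \<ominus>\<^bsub>W\<^esub> f v"
proof -
  interpret V: module K V by fact
  interpret W: module K W by fact
  have fc: "f v \<in> carrier W" "f (\<ominus>\<^bsub>V\<^esub> v) \<in> carrier W"
    using assms(3,4) by (simp_all add: linear_map_closed)
  have "f (\<ominus>\<^bsub>V\<^esub> v) \<oplus>\<^bsub>W\<^esub> f v = f (\<ominus>\<^bsub>V\<^esub> v \<oplus>\<^bsub>V\<^esub> v)"
    using assms(3,4) by (simp add: linear_map_add)
  also have "\<dots> = \<zero>\<^bsub>W\<^esub>"
    using assms by (simp add: V.l_neg linear_map_zero)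
  finally show ?thesis
    using fc W.minus_equality by auto
qed

lemma linear_map_finsum:
  assumes "module K V" "module K W" "linear_map K V W f"
    and "g \<in> A \<rightarrow> carrier V"
  shows "f (\<Oplus>\<^bsub>V\<^esub>i\<in>A. g i) = (\<Oplus>\<^bsub>W\<^esub>i\<in>A. f (g i))"
proof -
  interpret V: module K V by fact
  interpret W: module K W by fact
  have z: "f \<zero>\<^bsub>V\<^esub> = \<zero>\<^bsub>W\<^esub>" by (rule linear_map_zero[OF assms(1-3)])
  show ?thesis
    using assms(4)
  proof (induction A rule: infinite_finite_induct)
    case (insert x F)
    then have "g \<in> F \<rightarrow> carrier V" "g x \<in> carrier V" by auto
    moreover have "(\<lambda>i. f (g i)) \<in> F \<rightarrow> carrier W" "f (g x) \<in> carrier W"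
      using calculation by (auto intro: linear_map_closed[OF assms(3)])
    ultimately show ?case
      using insert by (simp add: linear_map_add[OF assms(3)])
  qed (simp_all add: z)
qed

lemma (in abelian_monoid) finsum_swap:
  assumes "finite A" "finite B" "\<And>i j. i \<in> A \<Longrightarrow> j \<in> B \<Longrightarrow> f i j \<in> carrier G"
  shows "(\<Oplus>i\<in>A. \<Oplus>j\<in>B. f i j) = (\<Oplus>j\<in>B. \<Oplus>i\<in>A. f i j)"
  using assms(1,3)
proof (induction A)
  case empty
  then show ?case by simp
next
  case (insert x F)
  have 1: "(\<lambda>i. \<Oplus>j\<in>B. f i j) \<in> F \<rightarrow> carrier G" "(\<Oplus>j\<in>B. f x j) \<in> carrier G"
    using insert by (auto intro!: finsum_closed)
  have "(\<Oplus>i\<in>insert x F. \<Oplus>j\<in>B. f i j) = (\<Oplus>j\<in>B. f x j) \<oplus> (\<Oplus>j\<in>B. \<Oplus>i\<in>F. f i j)"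
    using insert 1 by simp
  also have "\<dots> = (\<Oplus>j\<in>B. f x j \<oplus> (\<Oplus>i\<in>F. f i j))"
    by (subst finsum_addf) (use insert in \<open>auto intro!: finsum_closed\<close>)
  also have "\<dots> = (\<Oplus>j\<in>B. \<Oplus>i\<in>insert x F. f i j)"
    by (intro finsum_cong') (use insert in \<open>auto intro!: finsum_closed simp: Pi_iff\<close>)
  finally show ?case .
qed

section \<open>Free modules, spans and quotients\<close>

lemma regular_module_simps [simp]:
  "carrier (regular_module K) = carrier K"
  "\<zero>\<^bsub>regular_module K\<^esub> = \<zero>\<^bsub>K\<^esub>"
  "x \<oplus>\<^bsub>regular_module K\<^esub> y = x \<oplus>\<^bsub>K\<^esub> y"
  "c \<odot>\<^bsub>regular_module K\<^esub> x = c \<otimes>\<^bsub>K\<^esub> x"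
  by (simp_all add: regular_module_def)

lemma (in cring) regular_module_module: "module R (regular_module R)"
proof (rule moduleI)
  show "abelian_group (regular_module R)"
    by (rule abelian_groupI) (auto simp: a_assoc intro: a_comm l_neg a_inv_closed)
qed (auto simp: is_cring l_distr r_distr m_assoc)

lemma free_module_simps [simp]:
  "f \<in> carrier (free_module K A) \<longleftrightarrow>
    (\<forall>x. f x \<in> carrier K) \<and> (\<forall>x. x \<notin> A \<longrightarrow> f x = \<zero>\<^bsub>K\<^esub>) \<and> finite {x. f x \<noteq> \<zero>\<^bsub>K\<^esub>}"
  "\<zero>\<^bsub>free_module K A\<^esub> = (\<lambda>x. \<zero>\<^bsub>K\<^esub>)"
  "f \<oplus>\<^bsub>free_module K A\<^esub> g = (\<lambda>x. f x \<oplus>\<^bsub>K\<^esub> g x)"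
  "c \<odot>\<^bsub>free_module K A\<^esub> f = (\<lambda>x. c \<otimes>\<^bsub>K\<^esub> f x)"
  by (simp_all add: free_module_def)

lemma (in cring) free_module_module: "module R (free_module R A)"
proof (rule moduleI)
  have add: "finite {x. f x \<oplus> g x \<noteq> \<zero>}"
    if "finite {x. f x \<noteq> \<zero>}" "finite {x. g x \<noteq> \<zero>}" for f g :: "'c \<Rightarrow> 'a"
    by (rule finite_subset[of _ "{x. f x \<noteq> \<zero>} \<union> {x. g x \<noteq> \<zero>}"]) (use that in auto)
  show "abelian_group (free_module R A)"
  proof (rule abelian_groupI)
    fix f assume f: "f \<in> carrier (free_module R A)"
    have "{x. \<ominus> f x \<noteq> \<zero>} \<subseteq> {x. f x \<noteq> \<zero>}" by auto
    with f have "(\<lambda>x. \<ominus> f x) \<in> carrier (free_module R A)"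
      by (auto intro: finite_subset)
    with f show "\<exists>g\<in>carrier (free_module R A). g \<oplus>\<^bsub>free_module R A\<^esub> f = \<zero>\<^bsub>free_module R A\<^esub>"
      by (intro bexI[of _ "\<lambda>x. \<ominus> f x"]) (auto simp: l_neg fun_eq_iff)
  qed (auto simp: a_assoc add intro: a_comm)
  fix a f assume "a \<in> carrier R" "f \<in> carrier (free_module R A)"
  moreover from this have "{x. a \<otimes> f x \<noteq> \<zero>} \<subseteq> {x. f x \<noteq> \<zero>}" by auto
  ultimately show "a \<odot>\<^bsub>free_module R A\<^esub> f \<in> carrier (free_module R A)"
    by (auto intro: finite_subset)
qed (auto simp: is_cring l_distr r_distr m_assoc)

lemma (in cring) free_gen_closed:
  "a \<in> A \<Longrightarrow> free_gen R a \<in> carrier (free_module R A)"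
  by (auto simp: free_gen_def)

lemma (in cring) linear_map_free_ext:
  assumes "module R X" "linear_map R (free_module R A) X \<phi>" "linear_map R (free_module R A) X \<phi>'"
    and gen: "\<And>a. a \<in> A \<Longrightarrow> \<phi> (free_gen R a) = \<phi>' (free_gen R a)"
    and "f \<in> carrier (free_module R A)"
  shows "\<phi> f = \<phi>' f"
proof -
  have "finite {x. f x \<noteq> \<zero>}" using assms(5) by simp
  then show ?thesis
    using assms(5)
  proof (induction "{x. f x \<noteq> \<zero>}" arbitrary: f rule: finite_induct)
    case empty
    then have "f = \<zero>\<^bsub>free_module R A\<^esub>" by auto
    then show ?case
      using linear_map_zero[OF free_module_module assms(1)] assms(2,3) by metis
  next
    case (insert a S)
    define g where "g = f(a := \<zero>)"
    have S: "S = {x. g x \<noteq> \<zero>}" using insert by (auto simp: g_def)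
    have fa: "f a \<in> carrier R" and aA: "a \<in> A"
      using insert by auto
    have g: "g \<in> carrier (free_module R A)"
      using insert.prems insert.hyps(1) S by (auto simp: g_def)
    have e: "free_gen R a \<in> carrier (free_module R A)"
      by (rule free_gen_closed[OF aA])
    have f: "f = (f a \<odot>\<^bsub>free_module R A\<^esub> free_gen R a) \<oplus>\<^bsub>free_module R A\<^esub> g"
      using insert.prems by (auto simp: g_def free_gen_def fun_eq_iff)
    interpret F: module R "free_module R A" by (rule free_module_module)
    have *: "\<chi> f = (f a \<odot>\<^bsub>X\<^esub> \<chi> (free_gen R a)) \<oplus>\<^bsub>X\<^esub> \<chi> g"
      if "linear_map R (free_module R A) X \<chi>" for \<chi>
      by (subst f) (simp only: linear_map_add[OF that] linear_map_smult[OF that] F.smult_closed e fa g)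
    show ?case
      using *[OF assms(2)] *[OF assms(3)] insert.hyps(3)[OF S g] gen[OF aA] by simp
  qed
qed

lemma submodule_submodule_span:
  assumes "module K V" "S \<subseteq> carrier V"
  shows "submodule (submodule_span K V S) K V"
proof -
  interpret V: module K V by fact
  have c: "carrier V \<in> {U. submodule U K V \<and> S \<subseteq> U}"
    using assms(2) V.carrier_is_submodule by simp
  show ?thesis
  proof (rule V.submoduleI)
    show "submodule_span K V S \<subseteq> carrier V"
      using c unfolding submodule_span_def by blast
    show "\<zero>\<^bsub>V\<^esub> \<in> submodule_span K V S"
      unfolding submodule_span_def
      using subgroup.one_closed[OF submodule.axioms(1)] by auto
  qed (auto simp: submodule_span_def intro: V.submoduleE(3-5))
qed

lemma submodule_span_superset: "S \<subseteq> submodule_span K V S"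
  unfolding submodule_span_def by blast

lemma submodule_span_least: "submodule U K V \<Longrightarrow> S \<subseteq> U \<Longrightarrow> submodule_span K V S \<subseteq> U"
  unfolding submodule_span_def by blast

lemma submodule_kernel:
  assumes "module K V" "module K W" "linear_map K V W f"
  shows "submodule {v \<in> carrier V. f v = \<zero>\<^bsub>W\<^esub>} K V"
proof -
  interpret V: module K V by fact
  interpret W: module K W by fact
  show ?thesis
    by (rule V.submoduleI)
      (auto simp: linear_map_zero[OF assms] linear_map_a_inv[OF assms]
        linear_map_add[OF assms(3)] linear_map_smult[OF assms(3)])
qed

text \<open>The quotient of a module by a submodule; \<open>v \<mapsto> U + v\<close> is the projection.\<close>

locale quotient_by_submodule = V?: module K V for K V +
  fixes U
  assumes sub: "submodule U K V"
begin

lemma abelian_subgroup: "abelian_subgroup U V"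
  by (rule abelian_subgroupI3)
    (auto intro!: additive_subgroup.intro submodule.axioms(1)[OF sub] abelian_group_axioms)

interpretation U: abelian_subgroup U V by (rule abelian_subgroup)

lemma coset_self: "v \<in> carrier V \<Longrightarrow> v \<in> U +>\<^bsub>V\<^esub> v"
  by (rule U.a_rcos_self)

lemma coset_closed: "v \<in> carrier V \<Longrightarrow> U +>\<^bsub>V\<^esub> v \<in> carrier (quotient_module V U)"
  by (simp add: quotient_module_def a_rcosetsI U.a_subset)

lemma coset_cases:
  assumes "X \<in> carrier (quotient_module V U)"
  obtains v where "v \<in> carrier V" "X = U +>\<^bsub>V\<^esub> v"
  using assms unfolding quotient_module_def A_RCOSETS_def' by auto

lemma coset_add:
  "u \<in> carrier V \<Longrightarrow> v \<in> carrier V \<Longrightarrow>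
    (U +>\<^bsub>V\<^esub> u) \<oplus>\<^bsub>quotient_module V U\<^esub> (U +>\<^bsub>V\<^esub> v) = U +>\<^bsub>V\<^esub> (u \<oplus>\<^bsub>V\<^esub> v)"
  by (simp add: quotient_module_def U.a_rcos_sum)

lemma coset_eq_iff:
  assumes "u \<in> carrier V" "v \<in> carrier V"
  shows "U +>\<^bsub>V\<^esub> u = U +>\<^bsub>V\<^esub> v \<longleftrightarrow> u \<ominus>\<^bsub>V\<^esub> v \<in> U"
proof
  assume "U +>\<^bsub>V\<^esub> u = U +>\<^bsub>V\<^esub> v"
  then have "u \<in> U +>\<^bsub>V\<^esub> v" using coset_self[OF assms(1)] by simp
  then show "u \<ominus>\<^bsub>V\<^esub> v \<in> U" using assms U.a_rcos_module by (simp add: a_minus_def)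
next
  assume "u \<ominus>\<^bsub>V\<^esub> v \<in> U"
  then have "u \<in> U +>\<^bsub>V\<^esub> v" using assms U.a_rcos_module by (simp add: a_minus_def)
  then show "U +>\<^bsub>V\<^esub> u = U +>\<^bsub>V\<^esub> v" using U.a_repr_independence' assms by metis
qed

lemma coset_memD:
  assumes "v \<in> carrier V" "u \<in> U +>\<^bsub>V\<^esub> v"
  shows "u \<in> carrier V" "U +>\<^bsub>V\<^esub> u = U +>\<^bsub>V\<^esub> v"
  using assms U.a_elemrcos_carrier U.a_repr_independence' by auto

lemma coset_smult:
  assumes c: "c \<in> carrier K" and v: "v \<in> carrier V"
  shows "c \<odot>\<^bsub>quotient_module V U\<^esub> (U +>\<^bsub>V\<^esub> v) = U +>\<^bsub>V\<^esub> (c \<odot>\<^bsub>V\<^esub> v)"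
proof -
  have "U +>\<^bsub>V\<^esub> (c \<odot>\<^bsub>V\<^esub> u) = U +>\<^bsub>V\<^esub> (c \<odot>\<^bsub>V\<^esub> v)" if u: "u \<in> U +>\<^bsub>V\<^esub> v" for u
  proof -
    have uc: "u \<in> carrier V" and eq: "U +>\<^bsub>V\<^esub> u = U +>\<^bsub>V\<^esub> v" using coset_memD[OF v u] by auto
    have "u \<ominus>\<^bsub>V\<^esub> v \<in> U" using eq coset_eq_iff[OF uc v] by simp
    then have "c \<odot>\<^bsub>V\<^esub> (u \<ominus>\<^bsub>V\<^esub> v) \<in> U" using c submodule.smult_closed[OF sub] by simp
    moreover have "c \<odot>\<^bsub>V\<^esub> (u \<ominus>\<^bsub>V\<^esub> v) = c \<odot>\<^bsub>V\<^esub> u \<ominus>\<^bsub>V\<^esub> c \<odot>\<^bsub>V\<^esub> v"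
      using c uc v by (simp add: a_minus_def smult_r_distr smult_r_minus)
    ultimately show ?thesis using coset_eq_iff c uc v by simp
  qed
  moreover have "U +>\<^bsub>V\<^esub> v \<noteq> {}" using coset_self[OF v] by auto
  ultimately have "(\<Union>u\<in>U +>\<^bsub>V\<^esub> v. U +>\<^bsub>V\<^esub> (c \<odot>\<^bsub>V\<^esub> u)) = U +>\<^bsub>V\<^esub> (c \<odot>\<^bsub>V\<^esub> v)"
    by (intro SUP_eq_const)
  then show ?thesis by (simp add: quotient_module_def)
qed

lemma quotient_module_module: "module K (quotient_module V U)"
proof (rule moduleI)
  have z: "\<zero>\<^bsub>quotient_module V U\<^esub> = U +>\<^bsub>V\<^esub> \<zero>\<^bsub>V\<^esub>"
    by (simp add: quotient_module_def U.a_subset)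
  show "abelian_group (quotient_module V U)"
  proof (rule abelian_groupI)
    fix X assume "X \<in> carrier (quotient_module V U)"
    then obtain v where v: "v \<in> carrier V" "X = U +>\<^bsub>V\<^esub> v" by (rule coset_cases)
    then show "\<exists>Y\<in>carrier (quotient_module V U).
        Y \<oplus>\<^bsub>quotient_module V U\<^esub> X = \<zero>\<^bsub>quotient_module V U\<^esub>"
      by (intro bexI[of _ "U +>\<^bsub>V\<^esub> (\<ominus>\<^bsub>V\<^esub> v)"]) (auto simp: coset_add coset_closed z M.l_neg)
  next
    fix X Y assume "X \<in> carrier (quotient_module V U)" "Y \<in> carrier (quotient_module V U)"
    then show "X \<oplus>\<^bsub>quotient_module V U\<^esub> Y \<in> carrier (quotient_module V U)"
      by (elim coset_cases) (simp add: coset_add coset_closed)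
  next
    fix X Y assume "X \<in> carrier (quotient_module V U)" "Y \<in> carrier (quotient_module V U)"
    then show "X \<oplus>\<^bsub>quotient_module V U\<^esub> Y = Y \<oplus>\<^bsub>quotient_module V U\<^esub> X"
      by (elim coset_cases) (simp add: coset_add M.a_comm)
  next
    fix X Y Z assume "X \<in> carrier (quotient_module V U)" "Y \<in> carrier (quotient_module V U)"
      "Z \<in> carrier (quotient_module V U)"
    then show "X \<oplus>\<^bsub>quotient_module V U\<^esub> Y \<oplus>\<^bsub>quotient_module V U\<^esub> Z
        = X \<oplus>\<^bsub>quotient_module V U\<^esub> (Y \<oplus>\<^bsub>quotient_module V U\<^esub> Z)"
      by (elim coset_cases) (simp add: coset_add M.a_assoc)
  next
    fix X assume "X \<in> carrier (quotient_module V U)"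
    then show "\<zero>\<^bsub>quotient_module V U\<^esub> \<oplus>\<^bsub>quotient_module V U\<^esub> X = X"
      by (elim coset_cases) (simp add: z coset_add)
  qed (simp add: z coset_closed)
next
  fix a b X assume "a \<in> carrier K" "b \<in> carrier K" "X \<in> carrier (quotient_module V U)"
  then show "(a \<oplus>\<^bsub>K\<^esub> b) \<odot>\<^bsub>quotient_module V U\<^esub> X
      = a \<odot>\<^bsub>quotient_module V U\<^esub> X \<oplus>\<^bsub>quotient_module V U\<^esub> b \<odot>\<^bsub>quotient_module V U\<^esub> X"
    and "(a \<otimes>\<^bsub>K\<^esub> b) \<odot>\<^bsub>quotient_module V U\<^esub> X
      = a \<odot>\<^bsub>quotient_module V U\<^esub> (b \<odot>\<^bsub>quotient_module V U\<^esub> X)"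
    by (elim coset_cases; simp add: coset_smult coset_add smult_l_distr smult_assoc1)+
next
  fix a X Y assume "a \<in> carrier K" "X \<in> carrier (quotient_module V U)" "Y \<in> carrier (quotient_module V U)"
  then show "a \<odot>\<^bsub>quotient_module V U\<^esub> (X \<oplus>\<^bsub>quotient_module V U\<^esub> Y)
      = a \<odot>\<^bsub>quotient_module V U\<^esub> X \<oplus>\<^bsub>quotient_module V U\<^esub> a \<odot>\<^bsub>quotient_module V U\<^esub> Y"
    by (elim coset_cases) (simp add: coset_smult coset_add smult_r_distr)
next
  fix a X assume "a \<in> carrier K" "X \<in> carrier (quotient_module V U)"
  then show "a \<odot>\<^bsub>quotient_module V U\<^esub> X \<in> carrier (quotient_module V U)"
    by (elim coset_cases) (simp add: coset_smult coset_closed)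
next
  fix X assume "X \<in> carrier (quotient_module V U)"
  then show "\<one>\<^bsub>K\<^esub> \<odot>\<^bsub>quotient_module V U\<^esub> X = X"
    by (elim coset_cases) (simp add: coset_smult)
qed (rule R.is_cring)

lemma coset_linear: "linear_map K V (quotient_module V U) (\<lambda>v. U +>\<^bsub>V\<^esub> v)"
  by (rule linear_mapI) (auto simp: coset_add coset_closed coset_smult)

end

section \<open>The universal property of the tensor product\<close>

lemma tensor_relations_closed:
  assumes "module K V" "module K W"
  shows "tensor_relations K V W \<subseteq> carrier (free_module K (carrier V \<times> carrier W))"
proof -
  interpret V: module K V by fact
  interpret W: module K W by fact
  interpret F: module K "free_module K (carrier V \<times> carrier W)"
    by (rule V.R.free_module_module)
  have e: "free_gen K (v, w) \<in> carrier (free_module K (carrier V \<times> carrier W))"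
    if "v \<in> carrier V" "w \<in> carrier W" for v w
    using that by (intro V.R.free_gen_closed) auto
  show ?thesis
    unfolding tensor_relations_def Let_def
    by (auto simp only: Un_iff mem_Collect_eq subset_iff
        intro!: F.minus_closed F.a_closed F.smult_closed e V.a_closed W.a_closed V.smult_closed W.smult_closed)
qed

lemma tensor_relationsI:
  fixes K :: "('k, 'r) ring_scheme" and V :: "('k, 'v, 'x) module_scheme"
    and W :: "('k, 'w, 'y) module_scheme"
  defines "F \<equiv> free_module K (carrier V \<times> carrier W)"
  shows "v \<in> carrier V \<Longrightarrow> v' \<in> carrier V \<Longrightarrow> w \<in> carrier W \<Longrightarrow>
      free_gen K (v \<oplus>\<^bsub>V\<^esub> v', w) \<ominus>\<^bsub>F\<^esub> (free_gen K (v, w) \<oplus>\<^bsub>F\<^esub> free_gen K (v', w)) \<in> tensor_relations K V W"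
    and "v \<in> carrier V \<Longrightarrow> w \<in> carrier W \<Longrightarrow> w' \<in> carrier W \<Longrightarrow>
      free_gen K (v, w \<oplus>\<^bsub>W\<^esub> w') \<ominus>\<^bsub>F\<^esub> (free_gen K (v, w) \<oplus>\<^bsub>F\<^esub> free_gen K (v, w')) \<in> tensor_relations K V W"
    and "c \<in> carrier K \<Longrightarrow> v \<in> carrier V \<Longrightarrow> w \<in> carrier W \<Longrightarrow>
      free_gen K (c \<odot>\<^bsub>V\<^esub> v, w) \<ominus>\<^bsub>F\<^esub> (c \<odot>\<^bsub>F\<^esub> free_gen K (v, w)) \<in> tensor_relations K V W"
    and "c \<in> carrier K \<Longrightarrow> v \<in> carrier V \<Longrightarrow> w \<in> carrier W \<Longrightarrow>
      free_gen K (v, c \<odot>\<^bsub>W\<^esub> w) \<ominus>\<^bsub>F\<^esub> (c \<odot>\<^bsub>F\<^esub> free_gen K (v, w)) \<in> tensor_relations K V W"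
  unfolding tensor_relations_def Let_def F_def[symmetric] by blast+

lemma quotient_by_tensor_null:
  assumes "module K V" "module K W"
  shows "quotient_by_submodule K (free_module K (carrier V \<times> carrier W)) (tensor_null K V W)"
proof -
  interpret V: module K V by fact
  have F: "module K (free_module K (carrier V \<times> carrier W))"
    by (rule V.R.free_module_module)
  show ?thesis
    unfolding tensor_null_def
    by (intro quotient_by_submodule.intro quotient_by_submodule_axioms.intro F
        submodule_submodule_span tensor_relations_closed assms)
qed

lemma tensor_space_module [simp]:
  assumes "module K V" "module K W"
  shows "module K (tensor_space K V W)"
  unfolding tensor_space_def
  by (rule quotient_by_submodule.quotient_module_module[OF quotient_by_tensor_null[OF assms]])

lemma tens_bilinear:
  assumes "module K V" "module K W"
  shows "bilinear_map K V W (tensor_space K V W) (tens K V W)"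
proof -
  interpret V: module K V by fact
  interpret W: module K W by fact
  let ?F = "free_module K (carrier V \<times> carrier W)"
  interpret F: module K ?F by (rule V.R.free_module_module)
  interpret Q: quotient_by_submodule K ?F "tensor_null K V W"
    by (rule quotient_by_tensor_null[OF assms])
  have e: "free_gen K (v, w) \<in> carrier ?F" if "v \<in> carrier V" "w \<in> carrier W" for v w
    using that by (intro V.R.free_gen_closed) auto
  have N: "tensor_relations K V W \<subseteq> tensor_null K V W"
    unfolding tensor_null_def by (rule submodule_span_superset)
  have eq: "tensor_null K V W +>\<^bsub>?F\<^esub> x = tensor_null K V W +>\<^bsub>?F\<^esub> y"
    if "x \<ominus>\<^bsub>?F\<^esub> y \<in> tensor_relations K V W" "x \<in> carrier ?F" "y \<in> carrier ?F" for x y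
    using Q.coset_eq_iff[OF that(2,3)] that(1) N by blast
  have add_left: "tens K V W (v \<oplus>\<^bsub>V\<^esub> v') w
      = tens K V W v w \<oplus>\<^bsub>tensor_space K V W\<^esub> tens K V W v' w"
    if "v \<in> carrier V" "v' \<in> carrier V" "w \<in> carrier W" for v v' w
    unfolding tens_def tensor_space_def Q.coset_add[OF e[OF that(1,3)] e[OF that(2,3)]]
    by (rule eq; use that in \<open>intro tensor_relationsI e F.a_closed V.a_closed; simp\<close>)
  have add_right: "tens K V W v (w \<oplus>\<^bsub>W\<^esub> w')
      = tens K V W v w \<oplus>\<^bsub>tensor_space K V W\<^esub> tens K V W v w'"
    if "v \<in> carrier V" "w \<in> carrier W" "w' \<in> carrier W" for v w w'
    unfolding tens_def tensor_space_def Q.coset_add[OF e[OF that(1,2)] e[OF that(1,3)]]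
    by (rule eq; use that in \<open>intro tensor_relationsI e F.a_closed W.a_closed; simp\<close>)
  have smult_left: "tens K V W (c \<odot>\<^bsub>V\<^esub> v) w = c \<odot>\<^bsub>tensor_space K V W\<^esub> tens K V W v w"
    if "c \<in> carrier K" "v \<in> carrier V" "w \<in> carrier W" for c v w
    unfolding tens_def tensor_space_def Q.coset_smult[OF that(1) e[OF that(2,3)]]
    by (rule eq; use that in \<open>intro tensor_relationsI e F.smult_closed V.smult_closed; simp\<close>)
  have smult_right: "tens K V W v (c \<odot>\<^bsub>W\<^esub> w) = c \<odot>\<^bsub>tensor_space K V W\<^esub> tens K V W v w"
    if "c \<in> carrier K" "v \<in> carrier V" "w \<in> carrier W" for c v w
    unfolding tens_def tensor_space_def Q.coset_smult[OF that(1) e[OF that(2,3)]]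
    by (rule eq; use that in \<open>intro tensor_relationsI e F.smult_closed W.smult_closed; simp\<close>)
  have closed: "tens K V W v w \<in> carrier (tensor_space K V W)"
    if "v \<in> carrier V" "w \<in> carrier W" for v w
    unfolding tens_def tensor_space_def by (rule Q.coset_closed[OF e[OF that]])
  show ?thesis
    by (intro bilinear_mapI linear_mapI add_left add_right smult_left smult_right closed)
qed

lemmas tens_closed [simp, intro] = bilinear_map_closed[OF tens_bilinear]

text \<open>The value at \<open>f\<close> of the linear map from the free module on \<open>carrier V \<times> carrier W\<close> that
  extends \<open>\<beta>\<close>.\<close>

definition free_eval ::
  "('k, 'r) ring_scheme \<Rightarrow> ('k, 'u, 'z) module_scheme \<Rightarrow> ('v \<Rightarrow> 'w \<Rightarrow> 'u) \<Rightarrow> ('v \<times> 'w \<Rightarrow> 'k) \<Rightarrow> 'u"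
  where "free_eval K X \<beta> f =
    (\<Oplus>\<^bsub>X\<^esub>p\<in>{p. f p \<noteq> \<zero>\<^bsub>K\<^esub>}. f p \<odot>\<^bsub>X\<^esub> \<beta> (fst p) (snd p))"

lemma tensor_lift_eq_free_eval: "tensor_lift K X t \<beta> = free_eval K X \<beta> (SOME f. f \<in> t)"
  by (simp add: tensor_lift_def free_eval_def Let_def)

lemma free_eval_superset:
  assumes "module K X"
    and "\<And>v w. v \<in> carrier V \<Longrightarrow> w \<in> carrier W \<Longrightarrow> \<beta> v w \<in> carrier X"
    and "f \<in> carrier (free_module K (carrier V \<times> carrier W))"
    and "finite S" "S \<subseteq> carrier V \<times> carrier W" "{p. f p \<noteq> \<zero>\<^bsub>K\<^esub>} \<subseteq> S"
  shows "free_eval K X \<beta> f = (\<Oplus>\<^bsub>X\<^esub>p\<in>S. f p \<odot>\<^bsub>X\<^esub> \<beta> (fst p) (snd p))"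
proof -
  interpret X: module K X by fact
  show ?thesis
    unfolding free_eval_def
    by (intro X.add.finprod_mono_neutral_cong_left) (use assms in auto)
qed

lemma free_eval_linear:
  assumes X: "module K X"
    and \<beta>: "\<And>v w. v \<in> carrier V \<Longrightarrow> w \<in> carrier W \<Longrightarrow> \<beta> v w \<in> carrier X"
  shows "linear_map K (free_module K (carrier V \<times> carrier W)) X (free_eval K X \<beta>)"
proof -
  let ?F = "free_module K (carrier V \<times> carrier W)"
  let ?supp = "\<lambda>f. {p. f p \<noteq> \<zero>\<^bsub>K\<^esub>}"
  interpret X: module K X by fact
  interpret F: module K ?F by (rule X.R.free_module_module)
  have eval: "free_eval K X \<beta> f = (\<Oplus>\<^bsub>X\<^esub>p\<in>S. f p \<odot>\<^bsub>X\<^esub> \<beta> (fst p) (snd p))"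
    if "f \<in> carrier ?F" "finite S" "S \<subseteq> carrier V \<times> carrier W" "?supp f \<subseteq> S" for f S
    by (rule free_eval_superset[OF X _ that]) (rule \<beta>)
  have supp: "?supp f \<subseteq> carrier V \<times> carrier W" "finite (?supp f)" if "f \<in> carrier ?F" for f
    using that by auto
  have term_closed: "f p \<odot>\<^bsub>X\<^esub> \<beta> (fst p) (snd p) \<in> carrier X"
    if "f \<in> carrier ?F" "p \<in> carrier V \<times> carrier W" for f p
    using that \<beta> by auto
  show ?thesis
  proof (rule linear_mapI)
    fix f assume f: "f \<in> carrier ?F"
    show "free_eval K X \<beta> f \<in> carrier X"
      unfolding free_eval_def by (rule X.finsum_closed) (use f supp(1)[OF f] term_closed in auto)
  next
    fix f g assume f: "f \<in> carrier ?F" and g: "g \<in> carrier ?F"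
    define S where "S = ?supp f \<union> ?supp g"
    have S: "finite S" "S \<subseteq> carrier V \<times> carrier W" "?supp f \<subseteq> S" "?supp g \<subseteq> S"
      "?supp (f \<oplus>\<^bsub>?F\<^esub> g) \<subseteq> S"
      using supp[OF f] supp[OF g] by (auto simp: S_def)
    have fg: "f \<oplus>\<^bsub>?F\<^esub> g \<in> carrier ?F" by (rule F.a_closed[OF f g])
    have fgc: "f p \<in> carrier K" "g p \<in> carrier K" for p using f g unfolding free_module_simps by blast+
    have "free_eval K X \<beta> (f \<oplus>\<^bsub>?F\<^esub> g)
        = (\<Oplus>\<^bsub>X\<^esub>p\<in>S. (f p \<odot>\<^bsub>X\<^esub> \<beta> (fst p) (snd p)) \<oplus>\<^bsub>X\<^esub> (g p \<odot>\<^bsub>X\<^esub> \<beta> (fst p) (snd p)))"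
      unfolding eval[OF fg S(1,2,5)]
      by (rule X.finsum_cong') (use fgc S(2) \<beta> in \<open>auto simp: X.smult_l_distr\<close>)
    also have "\<dots> = free_eval K X \<beta> f \<oplus>\<^bsub>X\<^esub> free_eval K X \<beta> g"
      unfolding eval[OF f S(1,2,3)] eval[OF g S(1,2,4)]
      by (rule X.finsum_addf) (use fgc S(2) \<beta> in auto)
    finally show "free_eval K X \<beta> (f \<oplus>\<^bsub>?F\<^esub> g) = free_eval K X \<beta> f \<oplus>\<^bsub>X\<^esub> free_eval K X \<beta> g" .
  next
    fix c f assume c: "c \<in> carrier K" and f: "f \<in> carrier ?F"
    have cf: "c \<odot>\<^bsub>?F\<^esub> f \<in> carrier ?F" by (rule F.smult_closed[OF c f])
    have sub: "?supp (c \<odot>\<^bsub>?F\<^esub> f) \<subseteq> ?supp f" using c by auto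
    have fc: "f p \<in> carrier K" for p using f unfolding free_module_simps by blast
    have "free_eval K X \<beta> (c \<odot>\<^bsub>?F\<^esub> f)
        = (\<Oplus>\<^bsub>X\<^esub>p\<in>?supp f. c \<odot>\<^bsub>X\<^esub> (f p \<odot>\<^bsub>X\<^esub> \<beta> (fst p) (snd p)))"
      unfolding eval[OF cf supp(2,1)[OF f] sub]
      by (rule X.finsum_cong') (use c fc supp(1)[OF f] \<beta> in \<open>auto simp: X.smult_assoc1\<close>)
    also have "\<dots> = c \<odot>\<^bsub>X\<^esub> free_eval K X \<beta> f"
      unfolding free_eval_def
      by (rule X.finsum_smult_ldistr[symmetric])
        (use c fc supp[OF f] \<beta> in auto)
    finally show "free_eval K X \<beta> (c \<odot>\<^bsub>?F\<^esub> f) = c \<odot>\<^bsub>X\<^esub> free_eval K X \<beta> f" .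
  qed
qed

lemma free_eval_gen:
  assumes X: "module K X" and "v \<in> carrier V" "w \<in> carrier W" "\<beta> v w \<in> carrier X"
  shows "free_eval K X \<beta> (free_gen K (v, w)) = \<beta> v w"
proof -
  interpret X: module K X by fact
  have "\<beta> v w = \<zero>\<^bsub>X\<^esub>" if "\<one>\<^bsub>K\<^esub> = \<zero>\<^bsub>K\<^esub>"
    using X.smult_one[OF assms(4)] X.smult_l_null[OF assms(4)] that by simp
  then have "free_eval K X \<beta> (free_gen K (v, w))
      = (\<Oplus>\<^bsub>X\<^esub>p\<in>{(v, w)}. free_gen K (v, w) p \<odot>\<^bsub>X\<^esub> \<beta> (fst p) (snd p))"
    unfolding free_eval_def
    by (intro X.add.finprod_mono_neutral_cong_left)
      (use assms \<open>\<one>\<^bsub>K\<^esub> = \<zero>\<^bsub>K\<^esub> \<Longrightarrow> \<beta> v w = \<zero>\<^bsub>X\<^esub>\<close> in \<open>auto simp: free_gen_def\<close>)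
  also have "\<dots> = \<beta> v w"
    using assms by (simp add: free_gen_def)
  finally show ?thesis .
qed

text \<open>\<^const>\<open>tensor_lift\<close> evaluates a tensor through a representative picked by \<open>SOME\<close>. It
  lies in the free module and represents the given tensor.\<close>

lemma tensor_representative:
  assumes "module K V" "module K W" "t \<in> carrier (tensor_space K V W)"
  shows "(SOME f. f \<in> t) \<in> carrier (free_module K (carrier V \<times> carrier W))"
    and "t = tensor_null K V W +>\<^bsub>free_module K (carrier V \<times> carrier W)\<^esub> (SOME f. f \<in> t)"
proof -
  let ?F = "free_module K (carrier V \<times> carrier W)"
  interpret Q: quotient_by_submodule K ?F "tensor_null K V W"
    by (rule quotient_by_tensor_null[OF assms(1,2)])
  obtain f where f: "f \<in> carrier ?F" "t = tensor_null K V W +>\<^bsub>?F\<^esub> f"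
    using assms(3) unfolding tensor_space_def by (rule Q.coset_cases)
  then have "(SOME f. f \<in> t) \<in> t" using Q.coset_self by (metis someI)
  then show "(SOME f. f \<in> t) \<in> carrier ?F"
    and "t = tensor_null K V W +>\<^bsub>?F\<^esub> (SOME f. f \<in> t)"
    using Q.coset_memD[OF f(1)] f(2) by blast+
qed

text \<open>A linear map on \<open>V \<otimes> W\<close> is determined by its values on the \<open>v \<otimes> w\<close>; the right-hand side
  also says that every tensor is a sum of such elements.\<close>

lemma linear_map_eq_tensor_lift:
  assumes VW: "module K V" "module K W" and X: "module K X"
    and \<phi>: "linear_map K (tensor_space K V W) X \<phi>"
    and t: "t \<in> carrier (tensor_space K V W)"
  shows "\<phi> t = tensor_lift K X t (\<lambda>v w. \<phi> (tens K V W v w))"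
proof -
  let ?F = "free_module K (carrier V \<times> carrier W)"
  let ?\<pi> = "\<lambda>f. tensor_null K V W +>\<^bsub>?F\<^esub> f"
  let ?\<beta> = "\<lambda>v w. \<phi> (tens K V W v w)"
  interpret X: module K X by fact
  interpret Q: quotient_by_submodule K ?F "tensor_null K V W"
    by (rule quotient_by_tensor_null[OF VW])
  have \<beta>: "?\<beta> v w \<in> carrier X" if "v \<in> carrier V" "w \<in> carrier W" for v w
    by (intro linear_map_closed[OF \<phi>] tens_closed VW that)
  have lin: "linear_map K ?F X (\<lambda>f. \<phi> (?\<pi> f))"
    by (rule linear_map_compose[OF \<phi>]) (unfold tensor_space_def, rule Q.coset_linear)
  define f where "f = (SOME f. f \<in> t)"
  have f: "f \<in> carrier ?F" "t = ?\<pi> f"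
    using tensor_representative[OF VW t] unfolding f_def by blast+
  have "\<phi> (?\<pi> f) = free_eval K X ?\<beta> f"
  proof (rule X.R.linear_map_free_ext[OF X lin free_eval_linear[OF X] _ f(1)])
    fix p assume "p \<in> carrier V \<times> carrier W"
    then obtain v w where p: "p = (v, w)" "v \<in> carrier V" "w \<in> carrier W" by auto
    show "\<phi> (?\<pi> (free_gen K p)) = free_eval K X ?\<beta> (free_gen K p)"
      unfolding p(1) free_eval_gen[where \<beta> = ?\<beta>, OF X p(2,3) \<beta>[OF p(2,3)]]
      by (simp add: tens_def)
  qed (rule \<beta>)
  with f show ?thesis
    unfolding tensor_lift_eq_free_eval f_def by simp
qed

text \<open>For bilinear \<open>\<beta>\<close> the choice of the representative does not matter, because the linear
  extension of \<open>\<beta>\<close> vanishes on the relations.\<close>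

lemma tensor_lift_coset:
  assumes VW: "module K V" "module K W" and X: "module K X"
    and \<beta>: "bilinear_map K V W X \<beta>"
    and f: "f \<in> carrier (free_module K (carrier V \<times> carrier W))"
  shows "tensor_lift K X (tensor_null K V W +>\<^bsub>free_module K (carrier V \<times> carrier W)\<^esub> f) \<beta>
    = free_eval K X \<beta> f"
proof -
  let ?F = "free_module K (carrier V \<times> carrier W)"
  let ?\<pi> = "\<lambda>f. tensor_null K V W +>\<^bsub>?F\<^esub> f"
  interpret V: module K V by fact
  interpret W: module K W by fact
  interpret X: module K X by fact
  interpret F: module K ?F by (rule V.R.free_module_module)
  interpret Q: quotient_by_submodule K ?F "tensor_null K V W"
    by (rule quotient_by_tensor_null[OF VW])
  have \<beta>c: "\<beta> v w \<in> carrier X" if "v \<in> carrier V" "w \<in> carrier W" for v w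
    using bilinear_map_closed[OF \<beta> that] .
  have ev: "linear_map K ?F X (free_eval K X \<beta>)"
    by (rule free_eval_linear[OF X \<beta>c])
  have e: "free_gen K (v, w) \<in> carrier ?F" if "v \<in> carrier V" "w \<in> carrier W" for v w
    using that by (intro V.R.free_gen_closed) auto
  have ev_e: "free_eval K X \<beta> (free_gen K (v, w)) = \<beta> v w"
    if "v \<in> carrier V" "w \<in> carrier W" for v w
    by (rule free_eval_gen[where \<beta> = \<beta>, OF X that \<beta>c[OF that]])
  have ev_diff: "free_eval K X \<beta> (x \<ominus>\<^bsub>?F\<^esub> y) = free_eval K X \<beta> x \<ominus>\<^bsub>X\<^esub> free_eval K X \<beta> y"
    if "x \<in> carrier ?F" "y \<in> carrier ?F" for x y
    using that by (simp only: a_minus_def linear_map_add[OF ev] F.a_inv_closed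
        linear_map_a_inv[OF F.module_axioms X ev])
  have self: "x \<ominus>\<^bsub>X\<^esub> x = \<zero>\<^bsub>X\<^esub>" if "x \<in> carrier X" for x
    using that by (simp add: a_minus_def X.r_neg)
  note \<beta>_simps = linear_map_add[OF bilinear_map_left[OF \<beta>]] linear_map_add[OF bilinear_map_right[OF \<beta>]]
    linear_map_smult[OF bilinear_map_left[OF \<beta>]] linear_map_smult[OF bilinear_map_right[OF \<beta>]]
  have "tensor_relations K V W \<subseteq> {x \<in> carrier ?F. free_eval K X \<beta> x = \<zero>\<^bsub>X\<^esub>}"
  proof
    fix x assume x: "x \<in> tensor_relations K V W"
    then have "free_eval K X \<beta> x = \<zero>\<^bsub>X\<^esub>"
      unfolding tensor_relations_def Let_def
      by (elim UnE; clarsimp simp only: mem_Collect_eq ev_diff e F.a_closed F.smult_closed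
          linear_map_add[OF ev] linear_map_smult[OF ev] ev_e V.a_closed W.a_closed
          V.smult_closed W.smult_closed \<beta>_simps self \<beta>c X.a_closed X.smult_closed)
    then show "x \<in> {x \<in> carrier ?F. free_eval K X \<beta> x = \<zero>\<^bsub>X\<^esub>}"
      using x tensor_relations_closed[OF VW] by blast
  qed
  then have null: "tensor_null K V W \<subseteq> {x \<in> carrier ?F. free_eval K X \<beta> x = \<zero>\<^bsub>X\<^esub>}"
    unfolding tensor_null_def
    by (intro submodule_span_least submodule_kernel F.module_axioms X ev)
  have t: "?\<pi> f \<in> carrier (tensor_space K V W)"
    unfolding tensor_space_def by (rule Q.coset_closed[OF f])
  define g where "g = (SOME g. g \<in> ?\<pi> f)"
  have g: "g \<in> carrier ?F" "?\<pi> f = ?\<pi> g"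
    using tensor_representative[OF VW t] unfolding g_def by blast+
  have "g \<ominus>\<^bsub>?F\<^esub> f \<in> tensor_null K V W"
    using Q.coset_eq_iff[OF g(1) f] g(2) by simp
  then have "free_eval K X \<beta> g \<ominus>\<^bsub>X\<^esub> free_eval K X \<beta> f = \<zero>\<^bsub>X\<^esub>"
    using null ev_diff[OF g(1) f] by auto
  moreover have "free_eval K X \<beta> g \<in> carrier X" "free_eval K X \<beta> f \<in> carrier X"
    using linear_map_closed[OF ev] f g(1) by blast+
  ultimately have "free_eval K X \<beta> g = free_eval K X \<beta> f"
    by (metis X.minus_equality X.minus_minus X.a_inv_closed a_minus_def)
  then show ?thesis
    unfolding tensor_lift_eq_free_eval g_def .
qed

lemma tensor_lift_tens:
  assumes VW: "module K V" "module K W" and X: "module K X"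
    and \<beta>: "bilinear_map K V W X \<beta>" and vw: "v \<in> carrier V" "w \<in> carrier W"
  shows "tensor_lift K X (tens K V W v w) \<beta> = \<beta> v w"
proof -
  interpret X: module K X by fact
  have e: "free_gen K (v, w) \<in> carrier (free_module K (carrier V \<times> carrier W))"
    using vw by (intro X.R.free_gen_closed) auto
  show ?thesis
    unfolding tens_def tensor_lift_coset[OF VW X \<beta> e]
    by (rule free_eval_gen[where \<beta> = \<beta>, OF X vw bilinear_map_closed[OF \<beta> vw]])
qed

lemma tensor_lift_linear:
  assumes VW: "module K V" "module K W" and X: "module K X" and \<beta>: "bilinear_map K V W X \<beta>"
  shows "linear_map K (tensor_space K V W) X (\<lambda>t. tensor_lift K X t \<beta>)"
proof -
  let ?F = "free_module K (carrier V \<times> carrier W)"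
  interpret X: module K X by fact
  interpret F: module K ?F by (rule X.R.free_module_module)
  interpret Q: quotient_by_submodule K ?F "tensor_null K V W"
    by (rule quotient_by_tensor_null[OF VW])
  note ev = free_eval_linear[OF X bilinear_map_closed[OF \<beta>]]
  note lift = tensor_lift_coset[OF VW X \<beta>]
  show ?thesis
    unfolding tensor_space_def
  proof (rule linear_mapI)
    fix s t assume "s \<in> carrier (quotient_module ?F (tensor_null K V W))"
      "t \<in> carrier (quotient_module ?F (tensor_null K V W))"
    then show "tensor_lift K X (s \<oplus>\<^bsub>quotient_module ?F (tensor_null K V W)\<^esub> t) \<beta>
        = tensor_lift K X s \<beta> \<oplus>\<^bsub>X\<^esub> tensor_lift K X t \<beta>"
      by (elim Q.coset_cases) (simp only: Q.coset_add F.a_closed lift linear_map_add[OF ev])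
  next
    fix c t assume "c \<in> carrier K" "t \<in> carrier (quotient_module ?F (tensor_null K V W))"
    then show "tensor_lift K X (c \<odot>\<^bsub>quotient_module ?F (tensor_null K V W)\<^esub> t) \<beta>
        = c \<odot>\<^bsub>X\<^esub> tensor_lift K X t \<beta>"
      by (elim Q.coset_cases) (simp only: Q.coset_smult F.smult_closed lift linear_map_smult[OF ev])
  next
    fix t assume "t \<in> carrier (quotient_module ?F (tensor_null K V W))"
    then show "tensor_lift K X t \<beta> \<in> carrier X"
      by (elim Q.coset_cases) (simp only: lift linear_map_closed[OF ev])
  qed
qed

text \<open>The following rules do not need a bilinear \<open>\<beta>\<close>, because \<^const>\<open>tensor_lift\<close> is a finite
  sum over one fixed representative of its argument, with coefficients that depend neither on
  \<open>\<beta>\<close> nor on the module of values. Two such modules occur in one statement so that a linear map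
  between them can be moved across the sum.\<close>

lemma tensor_lift_sums:
  assumes VW: "module K V" "module K W" and t: "t \<in> carrier (tensor_space K V W)"
  shows "\<exists>S c. finite S \<and> S \<subseteq> carrier V \<times> carrier W \<and> (\<forall>p. c p \<in> carrier K) \<and>
    (\<forall>\<beta>. tensor_lift K X t \<beta> = (\<Oplus>\<^bsub>X\<^esub>p\<in>S. c p \<odot>\<^bsub>X\<^esub> \<beta> (fst p) (snd p))) \<and>
    (\<forall>\<beta>. tensor_lift K Y t \<beta> = (\<Oplus>\<^bsub>Y\<^esub>p\<in>S. c p \<odot>\<^bsub>Y\<^esub> \<beta> (fst p) (snd p)))"
proof -
  define f where "f = (SOME f. f \<in> t)"
  have f: "f \<in> carrier (free_module K (carrier V \<times> carrier W))"
    using tensor_representative[OF VW t] unfolding f_def by blast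
  then show ?thesis
    by (intro exI[of _ "{p. f p \<noteq> \<zero>\<^bsub>K\<^esub>}"] exI[of _ f])
      (auto simp: tensor_lift_def Let_def f_def)
qed

lemma tensor_lift_cong:
  assumes VW: "module K V" "module K W" and X: "module K X"
    and t: "t \<in> carrier (tensor_space K V W)"
    and eq: "\<And>v w. v \<in> carrier V \<Longrightarrow> w \<in> carrier W \<Longrightarrow> \<beta> v w = \<gamma> v w"
    and closed: "\<And>v w. v \<in> carrier V \<Longrightarrow> w \<in> carrier W \<Longrightarrow> \<gamma> v w \<in> carrier X"
  shows "tensor_lift K X t \<beta> = tensor_lift K X t \<gamma>"
proof -
  interpret X: module K X by fact
  obtain S c where S: "finite S" "S \<subseteq> carrier V \<times> carrier W" "\<forall>p. c p \<in> carrier K"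
    and lift: "\<forall>\<beta>. tensor_lift K X t \<beta> = (\<Oplus>\<^bsub>X\<^esub>p\<in>S. c p \<odot>\<^bsub>X\<^esub> \<beta> (fst p) (snd p))"
    using tensor_lift_sums[OF VW t, of X X] by blast
  show ?thesis
    unfolding lift[rule_format]
    by (rule X.finsum_cong') (use S eq closed in auto)
qed

lemma tensor_lift_closed:
  assumes VW: "module K V" "module K W" and X: "module K X"
    and t: "t \<in> carrier (tensor_space K V W)"
    and closed: "\<And>v w. v \<in> carrier V \<Longrightarrow> w \<in> carrier W \<Longrightarrow> \<beta> v w \<in> carrier X"
  shows "tensor_lift K X t \<beta> \<in> carrier X"
proof -
  interpret X: module K X by fact
  obtain S c where S: "finite S" "S \<subseteq> carrier V \<times> carrier W" "\<forall>p. c p \<in> carrier K"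
    and lift: "\<forall>\<beta>. tensor_lift K X t \<beta> = (\<Oplus>\<^bsub>X\<^esub>p\<in>S. c p \<odot>\<^bsub>X\<^esub> \<beta> (fst p) (snd p))"
    using tensor_lift_sums[OF VW t, of X X] by blast
  show ?thesis
    unfolding lift[rule_format]
    by (rule X.finsum_closed) (use S closed in auto)
qed

lemma linear_map_tensor_lift:
  assumes VW: "module K V" "module K W" and XY: "module K X" "module K Y"
    and t: "t \<in> carrier (tensor_space K V W)"
    and \<phi>: "linear_map K X Y \<phi>"
    and closed: "\<And>v w. v \<in> carrier V \<Longrightarrow> w \<in> carrier W \<Longrightarrow> \<beta> v w \<in> carrier X"
  shows "\<phi> (tensor_lift K X t \<beta>) = tensor_lift K Y t (\<lambda>v w. \<phi> (\<beta> v w))"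
proof -
  interpret X: module K X by fact
  interpret Y: module K Y by fact
  obtain S c where S: "finite S" "S \<subseteq> carrier V \<times> carrier W" "\<forall>p. c p \<in> carrier K"
    and lift: "\<forall>\<beta>. tensor_lift K X t \<beta> = (\<Oplus>\<^bsub>X\<^esub>p\<in>S. c p \<odot>\<^bsub>X\<^esub> \<beta> (fst p) (snd p))"
    "\<forall>\<beta>. tensor_lift K Y t \<beta> = (\<Oplus>\<^bsub>Y\<^esub>p\<in>S. c p \<odot>\<^bsub>Y\<^esub> \<beta> (fst p) (snd p))"
    using tensor_lift_sums[OF VW t, of X Y] by blast
  have "\<phi> (tensor_lift K X t \<beta>) = (\<Oplus>\<^bsub>Y\<^esub>p\<in>S. \<phi> (c p \<odot>\<^bsub>X\<^esub> \<beta> (fst p) (snd p)))"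
    unfolding lift(1)[rule_format]
    by (rule linear_map_finsum[OF XY \<phi>]) (use S closed in auto)
  also have "\<dots> = tensor_lift K Y t (\<lambda>v w. \<phi> (\<beta> v w))"
    unfolding lift(2)[rule_format]
    by (rule Y.finsum_cong')
      (use S closed in \<open>auto simp: linear_map_smult[OF \<phi>] intro!: Y.smult_closed linear_map_closed[OF \<phi>]\<close>)
  finally show ?thesis .
qed

lemma linear_map_lift_integrand:
  assumes VW: "module K V" "module K W" and X: "module K X"
    and t: "t \<in> carrier (tensor_space K V W)"
    and lin: "\<And>v w. v \<in> carrier V \<Longrightarrow> w \<in> carrier W \<Longrightarrow> linear_map K U X (\<lambda>u. E u v w)"
  shows "linear_map K U X (\<lambda>u. tensor_lift K X t (E u))"
proof -
  interpret X: module K X by fact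
  obtain S c where S: "finite S" "S \<subseteq> carrier V \<times> carrier W" "\<forall>p. c p \<in> carrier K"
    and lift: "\<forall>\<beta>. tensor_lift K X t \<beta> = (\<Oplus>\<^bsub>X\<^esub>p\<in>S. c p \<odot>\<^bsub>X\<^esub> \<beta> (fst p) (snd p))"
    using tensor_lift_sums[OF VW t, of X X] by blast
  have E: "E u (fst p) (snd p) \<in> carrier X" if "u \<in> carrier U" "p \<in> S" for u p
    using that S(2) by (intro linear_map_closed[OF lin]) (auto simp: mem_Times_iff)
  show ?thesis
  proof (rule linear_mapI)
    fix u assume "u \<in> carrier U"
    then show "tensor_lift K X t (E u) \<in> carrier X"
      by (intro tensor_lift_closed[OF VW X t] linear_map_closed[OF lin])
  next
    fix u u' assume u: "u \<in> carrier U" "u' \<in> carrier U"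
    have "E (u \<oplus>\<^bsub>U\<^esub> u') (fst p) (snd p) = E u (fst p) (snd p) \<oplus>\<^bsub>X\<^esub> E u' (fst p) (snd p)"
      if "p \<in> S" for p
      using that S(2) u by (intro linear_map_add[OF lin]) (auto simp: mem_Times_iff)
    then have "tensor_lift K X t (E (u \<oplus>\<^bsub>U\<^esub> u'))
      = (\<Oplus>\<^bsub>X\<^esub>p\<in>S. c p \<odot>\<^bsub>X\<^esub> E u (fst p) (snd p) \<oplus>\<^bsub>X\<^esub> c p \<odot>\<^bsub>X\<^esub> E u' (fst p) (snd p))"
      unfolding lift[rule_format]
      by (intro X.finsum_cong') (use S E u in \<open>auto simp: X.smult_r_distr\<close>)
    also have "\<dots> = tensor_lift K X t (E u) \<oplus>\<^bsub>X\<^esub> tensor_lift K X t (E u')"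
      unfolding lift[rule_format]
      by (rule X.finsum_addf) (use S E u in auto)
    finally show "tensor_lift K X t (E (u \<oplus>\<^bsub>U\<^esub> u'))
        = tensor_lift K X t (E u) \<oplus>\<^bsub>X\<^esub> tensor_lift K X t (E u')" .
  next
    fix a u assume a: "a \<in> carrier K" and u: "u \<in> carrier U"
    have "E (a \<odot>\<^bsub>U\<^esub> u) (fst p) (snd p) = a \<odot>\<^bsub>X\<^esub> E u (fst p) (snd p)"
      if "p \<in> S" for p
      using that S(2) u a by (intro linear_map_smult[OF lin]) (auto simp: mem_Times_iff)
    then have "tensor_lift K X t (E (a \<odot>\<^bsub>U\<^esub> u))
      = (\<Oplus>\<^bsub>X\<^esub>p\<in>S. a \<odot>\<^bsub>X\<^esub> (c p \<odot>\<^bsub>X\<^esub> E u (fst p) (snd p)))"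
      unfolding lift[rule_format]
      by (intro X.finsum_cong')
        (use S E u a in \<open>auto simp: X.smult_assoc1[symmetric] X.R.m_comm\<close>)
    also have "\<dots> = a \<odot>\<^bsub>X\<^esub> tensor_lift K X t (E u)"
      unfolding lift[rule_format]
      by (rule X.finsum_smult_ldistr[symmetric]) (use S E u a in auto)
    finally show "tensor_lift K X t (E (a \<odot>\<^bsub>U\<^esub> u)) = a \<odot>\<^bsub>X\<^esub> tensor_lift K X t (E u)" .
  qed
qed

lemma tensor_lift_swap:
  assumes VW: "module K V" "module K W" and VW': "module K V'" "module K W'" and X: "module K X"
    and s: "s \<in> carrier (tensor_space K V W)" and t: "t \<in> carrier (tensor_space K V' W')"
    and closed: "\<And>a b c d. a \<in> carrier V \<Longrightarrow> b \<in> carrier W \<Longrightarrow> c \<in> carrier V' \<Longrightarrow> d \<in> carrier W'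
      \<Longrightarrow> E a b c d \<in> carrier X"
  shows "tensor_lift K X s (\<lambda>a b. tensor_lift K X t (\<lambda>c d. E a b c d))
    = tensor_lift K X t (\<lambda>c d. tensor_lift K X s (\<lambda>a b. E a b c d))"
proof -
  interpret X: module K X by fact
  obtain S x where S: "finite S" "S \<subseteq> carrier V \<times> carrier W" "\<forall>p. x p \<in> carrier K"
    and lift: "\<forall>\<beta>. tensor_lift K X s \<beta> = (\<Oplus>\<^bsub>X\<^esub>p\<in>S. x p \<odot>\<^bsub>X\<^esub> \<beta> (fst p) (snd p))"
    using tensor_lift_sums[OF VW s, of X X] by blast
  obtain T y where T: "finite T" "T \<subseteq> carrier V' \<times> carrier W'" "\<forall>p. y p \<in> carrier K"
    and lift': "\<forall>\<beta>. tensor_lift K X t \<beta> = (\<Oplus>\<^bsub>X\<^esub>q\<in>T. y q \<odot>\<^bsub>X\<^esub> \<beta> (fst q) (snd q))"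
    using tensor_lift_sums[OF VW' t, of X X] by blast
  let ?E = "\<lambda>p q. E (fst p) (snd p) (fst q) (snd q)"
  have E: "?E p q \<in> carrier X" if "p \<in> S" "q \<in> T" for p q
    using that S(2) T(2) by (intro closed) (auto simp: mem_Times_iff)
  have "tensor_lift K X s (\<lambda>a b. tensor_lift K X t (\<lambda>c d. E a b c d))
      = (\<Oplus>\<^bsub>X\<^esub>p\<in>S. \<Oplus>\<^bsub>X\<^esub>q\<in>T. x p \<odot>\<^bsub>X\<^esub> (y q \<odot>\<^bsub>X\<^esub> ?E p q))"
    unfolding lift[rule_format] lift'[rule_format]
    by (intro X.finsum_cong' X.finsum_smult_ldistr) (use S T E in \<open>auto intro!: X.finsum_closed\<close>)
  also have "\<dots> = (\<Oplus>\<^bsub>X\<^esub>q\<in>T. \<Oplus>\<^bsub>X\<^esub>p\<in>S. x p \<odot>\<^bsub>X\<^esub> (y q \<odot>\<^bsub>X\<^esub> ?E p q))"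
    by (rule X.finsum_swap) (use S T E in auto)
  also have "\<dots> = (\<Oplus>\<^bsub>X\<^esub>q\<in>T. \<Oplus>\<^bsub>X\<^esub>p\<in>S. y q \<odot>\<^bsub>X\<^esub> (x p \<odot>\<^bsub>X\<^esub> ?E p q))"
    by (intro X.finsum_cong')
      (use S T E in \<open>auto intro!: X.finsum_closed simp: X.smult_assoc1[symmetric] X.R.m_comm\<close>)
  also have "\<dots> = tensor_lift K X t (\<lambda>c d. tensor_lift K X s (\<lambda>a b. E a b c d))"
    unfolding lift[rule_format] lift'[rule_format]
    by (intro X.finsum_cong' X.finsum_smult_ldistr[symmetric])
      (use S T E in \<open>auto intro!: X.finsum_closed\<close>)
  finally show ?thesis .
qed

lemma tensor_ext:
  assumes VW: "module K V" "module K W" and X: "module K X"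
    and \<phi>: "linear_map K (tensor_space K V W) X \<phi>" "linear_map K (tensor_space K V W) X \<phi>'"
    and eq: "\<And>v w. v \<in> carrier V \<Longrightarrow> w \<in> carrier W \<Longrightarrow> \<phi> (tens K V W v w) = \<phi>' (tens K V W v w)"
    and t: "t \<in> carrier (tensor_space K V W)"
  shows "\<phi> t = \<phi>' t"
  unfolding linear_map_eq_tensor_lift[OF VW X \<phi>(1) t] linear_map_eq_tensor_lift[OF VW X \<phi>(2) t]
  by (intro tensor_lift_cong[OF VW X t] eq linear_map_closed[OF \<phi>(2)] tens_closed VW)

section \<open>Sweedler calculus\<close>

lemma bilinear_map_compose_left:
  assumes "bilinear_map K V W X B" "w \<in> carrier W" "linear_map K U V E"
  shows "linear_map K U X (\<lambda>u. B (E u) w)"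
  using linear_map_compose[OF bilinear_map_left[OF assms(1,2)] assms(3)] .

lemma bilinear_map_compose_right:
  assumes "bilinear_map K V W X B" "v \<in> carrier V" "linear_map K U W E"
  shows "linear_map K U X (\<lambda>u. B v (E u))"
  using linear_map_compose[OF bilinear_map_right[OF assms(1,2)] assms(3)] .

lemma smult_bilinear:
  assumes "module K X"
  shows "bilinear_map K (regular_module K) X X (smult X)"
proof -
  interpret X: module K X by fact
  show ?thesis
    by (intro bilinear_mapI linear_mapI)
      (auto simp: X.smult_l_distr X.smult_r_distr X.smult_assoc1[symmetric] X.R.m_comm)
qed

context hopf_algebra
begin

text \<open>\<open>KK\<close> is the base field as a vector space over itself, and \<open>sw X h (\<lambda>a b. E a b)\<close> is the
  Sweedler sum \<open>E(h\<^sub>1, h\<^sub>2)\<close> with values in \<open>X\<close>.\<close>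

abbreviation KK where "KK \<equiv> regular_module K"
abbreviation HH where "HH \<equiv> tensor_space K H H"
abbreviation sw where "sw X h E \<equiv> tensor_lift K X (comult H h) E"

lemma module_H [simp]: "module K H" ..

lemma module_KK [simp]: "module K KK" by (rule regular_module_module)

lemma comult_closed [simp, intro]: "h \<in> carrier H \<Longrightarrow> comult H h \<in> carrier HH"
  by (rule linear_map_closed[OF comult_linear])

lemma counit_closed [simp, intro]: "h \<in> carrier H \<Longrightarrow> counit H h \<in> carrier K"
  using linear_map_closed[OF counit_linear] by simp

lemma mult_bilinear: "bilinear_map K H H H (\<otimes>\<^bsub>H\<^esub>)"
  by (intro bilinear_mapI linear_mapI)
    (auto simp: H.l_distr H.r_distr smult_mult_left smult_mult_right)

lemma scalar_ac:
  "x \<in> carrier K \<Longrightarrow> y \<in> carrier K \<Longrightarrow> z \<in> carrier K \<Longrightarrow>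
    (x \<otimes>\<^bsub>K\<^esub> y) \<otimes>\<^bsub>K\<^esub> z = x \<otimes>\<^bsub>K\<^esub> (y \<otimes>\<^bsub>K\<^esub> z)"
  "x \<in> carrier K \<Longrightarrow> y \<in> carrier K \<Longrightarrow> x \<otimes>\<^bsub>K\<^esub> y = y \<otimes>\<^bsub>K\<^esub> x"
  "x \<in> carrier K \<Longrightarrow> y \<in> carrier K \<Longrightarrow> z \<in> carrier K \<Longrightarrow>
    x \<otimes>\<^bsub>K\<^esub> (y \<otimes>\<^bsub>K\<^esub> z) = y \<otimes>\<^bsub>K\<^esub> (x \<otimes>\<^bsub>K\<^esub> z)"
  by (simp_all add: cring.cring_simprules[OF is_cring])

lemma scalar_mult_bilinear: "bilinear_map K KK KK KK (\<otimes>\<^bsub>K\<^esub>)"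
  by (intro bilinear_mapI linear_mapI) (auto simp: cring.cring_simprules[OF is_cring])

lemma sw_closed [intro]:
  assumes "h \<in> carrier H" "module K X"
    and "\<And>a b. a \<in> carrier H \<Longrightarrow> b \<in> carrier H \<Longrightarrow> E a b \<in> carrier X"
  shows "sw X h E \<in> carrier X"
  by (rule tensor_lift_closed[of _ H H]) (use assms in auto)

lemma sw_scalar_closed [intro]:
  assumes "h \<in> carrier H"
    and "\<And>a b. a \<in> carrier H \<Longrightarrow> b \<in> carrier H \<Longrightarrow> E a b \<in> carrier K"
  shows "sw KK h E \<in> carrier K"
  using sw_closed[of h KK E] assms by simp

lemma sw_cong:
  assumes "h \<in> carrier H" "module K X"
    and "\<And>a b. a \<in> carrier H \<Longrightarrow> b \<in> carrier H \<Longrightarrow> E a b = F a b"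
    and "\<And>a b. a \<in> carrier H \<Longrightarrow> b \<in> carrier H \<Longrightarrow> F a b \<in> carrier X"
  shows "sw X h E = sw X h F"
  by (rule tensor_lift_cong[of _ H H]) (use assms in auto)

lemma sw_swap:
  assumes "h \<in> carrier H" "g \<in> carrier H" "module K X"
    and "\<And>a b c d. a \<in> carrier H \<Longrightarrow> b \<in> carrier H \<Longrightarrow> c \<in> carrier H \<Longrightarrow> d \<in> carrier H
      \<Longrightarrow> E a b c d \<in> carrier X"
  shows "sw X h (\<lambda>a b. sw X g (\<lambda>c d. E a b c d)) = sw X g (\<lambda>c d. sw X h (\<lambda>a b. E a b c d))"
  by (rule tensor_lift_swap[of _ H H H H]) (use assms in auto)

lemma linear_map_sw:
  assumes "h \<in> carrier H" "module K X" "module K Y" "linear_map K X Y \<phi>"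
    and "\<And>a b. a \<in> carrier H \<Longrightarrow> b \<in> carrier H \<Longrightarrow> E a b \<in> carrier X"
  shows "\<phi> (sw X h E) = sw Y h (\<lambda>a b. \<phi> (E a b))"
  by (rule linear_map_tensor_lift[of _ H H]) (use assms in auto)

text \<open>A linear map moves across two nested Sweedler sums, the inner one over an element that
  depends on the outer one.\<close>

lemma linear_map_sw2:
  assumes h: "h \<in> carrier H" and X: "module K X" and Y: "module K Y" and \<phi>: "linear_map K X Y \<phi>"
    and f: "\<And>a b. a \<in> carrier H \<Longrightarrow> b \<in> carrier H \<Longrightarrow> f a b \<in> carrier H"
    and E: "\<And>a b c d. a \<in> carrier H \<Longrightarrow> b \<in> carrier H \<Longrightarrow> c \<in> carrier H \<Longrightarrow> d \<in> carrier H
      \<Longrightarrow> E a b c d \<in> carrier X"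
  shows "\<phi> (sw X h (\<lambda>a b. sw X (f a b) (\<lambda>c d. E a b c d)))
    = sw Y h (\<lambda>a b. sw Y (f a b) (\<lambda>c d. \<phi> (E a b c d)))"
proof -
  have "\<phi> (sw X h (\<lambda>a b. sw X (f a b) (\<lambda>c d. E a b c d)))
      = sw Y h (\<lambda>a b. \<phi> (sw X (f a b) (\<lambda>c d. E a b c d)))"
    by (rule linear_map_sw[OF h X Y \<phi>]) (use X f E in \<open>auto intro!: sw_closed\<close>)
  also have "\<dots> = sw Y h (\<lambda>a b. sw Y (f a b) (\<lambda>c d. \<phi> (E a b c d)))"
    by (intro sw_cong linear_map_sw[OF _ X Y \<phi>])
      (use h X Y f E in \<open>auto intro!: sw_closed linear_map_closed[OF \<phi>]\<close>)
  finally show ?thesis .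
qed

lemma sw_linear_arg:
  assumes "module K X" "\<And>a. a \<in> carrier H \<Longrightarrow> linear_map K H X (\<beta> a)"
    "\<And>b. b \<in> carrier H \<Longrightarrow> linear_map K H X (\<lambda>a. \<beta> a b)" "linear_map K U H E"
  shows "linear_map K U X (\<lambda>u. sw X (E u) \<beta>)"
proof -
  have "bilinear_map K H H X \<beta>" by (rule bilinear_mapI) (use assms in auto)
  from linear_map_compose[OF tensor_lift_linear[OF module_H module_H assms(1) this] comult_linear]
  show ?thesis by (rule linear_map_compose) (rule assms(4))
qed

lemma sw_linear_integrand:
  assumes "h \<in> carrier H" "module K X"
    "\<And>a b. a \<in> carrier H \<Longrightarrow> b \<in> carrier H \<Longrightarrow> linear_map K U X (\<lambda>u. E u a b)"
  shows "linear_map K U X (\<lambda>u. sw X h (E u))"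
  by (rule linear_map_lift_integrand[of _ H H]) (use assms in auto)

lemma counit_compose: "linear_map K U H E \<Longrightarrow> linear_map K U KK (\<lambda>u. counit H (E u))"
  by (rule linear_map_compose[OF counit_linear])

text \<open>Rules that follow the shape of an expression and show that it is linear in one variable.
  In each rule the variable occurs in one argument of the outermost operation only.\<close>

lemmas lin = linear_map_id counit_compose sw_linear_integrand sw_linear_arg
  bilinear_map_compose_left[OF mult_bilinear] bilinear_map_compose_right[OF mult_bilinear]
  bilinear_map_compose_left[OF scalar_mult_bilinear, simplified]
  bilinear_map_compose_right[OF scalar_mult_bilinear, simplified]
  bilinear_map_compose_left[OF smult_bilinear]
  bilinear_map_compose_right[OF smult_bilinear, simplified]
  bilinear_map_compose_left[OF tens_bilinear] bilinear_map_compose_right[OF tens_bilinear]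

lemma sw_counit_left:
  assumes "h \<in> carrier H" "module K X" "linear_map K H X \<phi>"
  shows "sw X h (\<lambda>a b. counit H a \<odot>\<^bsub>X\<^esub> \<phi> b) = \<phi> h"
proof -
  interpret X: module K X by fact
  have "\<phi> h = \<phi> (sw H h (\<lambda>a b. counit H a \<odot>\<^bsub>H\<^esub> b))"
    using counit_left[OF assms(1)] by simp
  also have "\<dots> = sw X h (\<lambda>a b. \<phi> (counit H a \<odot>\<^bsub>H\<^esub> b))"
    by (rule linear_map_sw) (use assms in auto)
  also have "\<dots> = sw X h (\<lambda>a b. counit H a \<odot>\<^bsub>X\<^esub> \<phi> b)"
    by (rule sw_cong)
      (use assms in \<open>auto simp: linear_map_smult[OF assms(3)] intro: linear_map_closed[OF assms(3)]\<close>)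
  finally show ?thesis ..
qed

lemma sw_counit_right:
  assumes "h \<in> carrier H" "module K X" "linear_map K H X \<phi>"
  shows "sw X h (\<lambda>a b. counit H b \<odot>\<^bsub>X\<^esub> \<phi> a) = \<phi> h"
proof -
  interpret X: module K X by fact
  have "\<phi> h = \<phi> (sw H h (\<lambda>a b. counit H b \<odot>\<^bsub>H\<^esub> a))"
    using counit_right[OF assms(1)] by simp
  also have "\<dots> = sw X h (\<lambda>a b. \<phi> (counit H b \<odot>\<^bsub>H\<^esub> a))"
    by (rule linear_map_sw) (use assms in auto)
  also have "\<dots> = sw X h (\<lambda>a b. counit H b \<odot>\<^bsub>X\<^esub> \<phi> a)"
    by (rule sw_cong)
      (use assms in \<open>auto simp: linear_map_smult[OF assms(3)] intro: linear_map_closed[OF assms(3)]\<close>)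
  finally show ?thesis ..
qed

lemma sw_mult:
  assumes "h \<in> carrier H" "g \<in> carrier H" "module K X" "bilinear_map K H H X \<beta>"
  shows "sw X (h \<otimes>\<^bsub>H\<^esub> g) \<beta>
    = sw X h (\<lambda>h1 h2. sw X g (\<lambda>g1 g2. \<beta> (h1 \<otimes>\<^bsub>H\<^esub> g1) (h2 \<otimes>\<^bsub>H\<^esub> g2)))"
proof -
  let ?\<phi> = "\<lambda>t. tensor_lift K X t \<beta>"
  note \<phi> = tensor_lift_linear[OF module_H module_H assms(3,4)]
  have "sw X (h \<otimes>\<^bsub>H\<^esub> g) \<beta>
      = ?\<phi> (sw HH h (\<lambda>h1 h2. sw HH g (\<lambda>g1 g2. tens K H H (h1 \<otimes>\<^bsub>H\<^esub> g1) (h2 \<otimes>\<^bsub>H\<^esub> g2))))"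
    using comult_mult[OF assms(1,2)] by simp
  also have "\<dots> = sw X h (\<lambda>h1 h2. sw X g (\<lambda>g1 g2. ?\<phi> (tens K H H (h1 \<otimes>\<^bsub>H\<^esub> g1) (h2 \<otimes>\<^bsub>H\<^esub> g2))))"
    by (rule linear_map_sw2[OF _ _ _ \<phi>]) (use assms in auto)
  also have "\<dots> = sw X h (\<lambda>h1 h2. sw X g (\<lambda>g1 g2. \<beta> (h1 \<otimes>\<^bsub>H\<^esub> g1) (h2 \<otimes>\<^bsub>H\<^esub> g2)))"
    by (intro sw_cong tensor_lift_tens[OF _ _ assms(3,4)])
      (use assms in \<open>auto intro!: sw_closed bilinear_map_closed[OF assms(4)]\<close>)
  finally show ?thesis .
qed

lemma sw_one:
  assumes "module K X" "bilinear_map K H H X \<beta>"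
  shows "sw X \<one>\<^bsub>H\<^esub> \<beta> = \<beta> \<one>\<^bsub>H\<^esub> \<one>\<^bsub>H\<^esub>"
  using assms by (simp add: comult_one tensor_lift_tens)

text \<open>Coassociativity for an arbitrary trilinear integrand: \<open>T(h\<^sub>1\<^sub>1, h\<^sub>1\<^sub>2, h\<^sub>2) = T(h\<^sub>1, h\<^sub>2\<^sub>1, h\<^sub>2\<^sub>2)\<close>.\<close>

lemma sw_coassoc:
  assumes h: "h \<in> carrier H" and X: "module K X"
    and T: "\<And>b c. b \<in> carrier H \<Longrightarrow> c \<in> carrier H \<Longrightarrow> linear_map K H X (\<lambda>a. T a b c)"
      "\<And>a c. a \<in> carrier H \<Longrightarrow> c \<in> carrier H \<Longrightarrow> linear_map K H X (\<lambda>b. T a b c)"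
      "\<And>a b. a \<in> carrier H \<Longrightarrow> b \<in> carrier H \<Longrightarrow> linear_map K H X (\<lambda>c. T a b c)"
  shows "sw X h (\<lambda>x c. sw X x (\<lambda>a b. T a b c)) = sw X h (\<lambda>a y. sw X y (\<lambda>b c. T a b c))"
proof -
  let ?HHH = "tensor_space K H HH"
  define \<phi> where "\<phi> = (\<lambda>t. tensor_lift K X t (\<lambda>a s. tensor_lift K X s (T a)))"
  have Tc [simp]: "T a b c \<in> carrier X" if "a \<in> carrier H" "b \<in> carrier H" "c \<in> carrier H" for a b c
    using linear_map_closed[OF T(1)[OF that(2,3)] that(1)] .
  have T_bil: "bilinear_map K H H X (T a)" if "a \<in> carrier H" for a
    by (rule bilinear_mapI) (use T that in auto)
  have inner: "bilinear_map K H HH X (\<lambda>a s. tensor_lift K X s (T a))"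
    by (rule bilinear_mapI, rule tensor_lift_linear)
      (use X T T_bil in \<open>auto intro: linear_map_lift_integrand[of _ H H]\<close>)
  have \<phi>: "linear_map K ?HHH X \<phi>"
    unfolding \<phi>_def by (rule tensor_lift_linear) (use X inner in auto)
  have \<phi>_tens: "\<phi> (tens K H HH a s) = tensor_lift K X s (T a)" if "a \<in> carrier H" "s \<in> carrier HH" for a s
    unfolding \<phi>_def by (rule tensor_lift_tens) (use X inner that in auto)
  have "sw X h (\<lambda>x c. sw X x (\<lambda>a b. T a b c))
      = sw X h (\<lambda>x c. \<phi> (sw ?HHH x (\<lambda>a b. tens K H HH a (tens K H H b c))))"
  proof (rule sw_cong[OF h X])
    fix x c assume xc: "x \<in> carrier H" "c \<in> carrier H"
    have "\<phi> (sw ?HHH x (\<lambda>a b. tens K H HH a (tens K H H b c)))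
        = sw X x (\<lambda>a b. \<phi> (tens K H HH a (tens K H H b c)))"
      by (rule linear_map_sw[OF _ _ _ \<phi>]) (use X xc in auto)
    also have "\<dots> = sw X x (\<lambda>a b. T a b c)"
      by (rule sw_cong) (use X xc T_bil in \<open>auto simp: \<phi>_tens tensor_lift_tens\<close>)
    finally show "sw X x (\<lambda>a b. T a b c) = \<phi> (sw ?HHH x (\<lambda>a b. tens K H HH a (tens K H H b c)))" ..
  qed (auto intro!: linear_map_closed[OF \<phi>])
  also have "\<dots> = \<phi> (sw ?HHH h (\<lambda>x c. sw ?HHH x (\<lambda>a b. tens K H HH a (tens K H H b c))))"
    by (rule linear_map_sw[OF _ _ _ \<phi>, symmetric]) (use h X in auto)
  also have "\<dots> = \<phi> (sw ?HHH h (\<lambda>a y. tens K H HH a (comult H y)))"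
    using coassoc[OF h] by simp
  also have "\<dots> = sw X h (\<lambda>a y. \<phi> (tens K H HH a (comult H y)))"
    by (rule linear_map_sw[OF _ _ _ \<phi>]) (use h X in auto)
  also have "\<dots> = sw X h (\<lambda>a y. sw X y (\<lambda>b c. T a b c))"
    by (rule sw_cong) (use h X in \<open>auto simp: \<phi>_tens\<close>)
  finally show ?thesis .
qed

text \<open>Coassociativity of the coalgebra \<open>H \<otimes> H\<close>, whose coproduct sends \<open>h \<otimes> g\<close> to
  \<open>(h\<^sub>1 \<otimes> g\<^sub>1) \<otimes> (h\<^sub>2 \<otimes> g\<^sub>2)\<close>.\<close>

lemma sw_coassoc2:
  assumes h: "h \<in> carrier H" and g: "g \<in> carrier H" and X: "module K X"
    and T: "\<And>a b c d e f. a \<in> carrier H \<Longrightarrow> b \<in> carrier H \<Longrightarrow> c \<in> carrier H \<Longrightarrow> d \<in> carrier H \<Longrightarrow>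
       e \<in> carrier H \<Longrightarrow> f \<in> carrier H \<Longrightarrow>
        linear_map K H X (\<lambda>x. T x b c d e f) \<and> linear_map K H X (\<lambda>x. T a x c d e f) \<and>
        linear_map K H X (\<lambda>x. T a b x d e f) \<and> linear_map K H X (\<lambda>x. T a b c x e f) \<and>
        linear_map K H X (\<lambda>x. T a b c d x f) \<and> linear_map K H X (\<lambda>x. T a b c d e x)"
  shows "sw X h (\<lambda>x c. sw X g (\<lambda>y f. sw X x (\<lambda>a b. sw X y (\<lambda>d e. T a b c d e f))))
    = sw X h (\<lambda>a x. sw X g (\<lambda>d y. sw X x (\<lambda>b c. sw X y (\<lambda>e f. T a b c d e f))))"
proof -
  have T_lin: "linear_map K H X (\<lambda>x. T x b c d e f)" "linear_map K H X (\<lambda>x. T a x c d e f)"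
    "linear_map K H X (\<lambda>x. T a b x d e f)" "linear_map K H X (\<lambda>x. T a b c x e f)"
    "linear_map K H X (\<lambda>x. T a b c d x f)" "linear_map K H X (\<lambda>x. T a b c d e x)"
    if "a \<in> carrier H" "b \<in> carrier H" "c \<in> carrier H" "d \<in> carrier H" "e \<in> carrier H" "f \<in> carrier H"
    for a b c d e f
    using T[OF that] by auto
  have Tc [simp]: "T a b c d e f \<in> carrier X"
    if "a \<in> carrier H" "b \<in> carrier H" "c \<in> carrier H" "d \<in> carrier H" "e \<in> carrier H" "f \<in> carrier H"
    for a b c d e f
    using linear_map_closed[OF T_lin(1)[OF that] that(1)] .
  have "sw X h (\<lambda>x c. sw X g (\<lambda>y f. sw X x (\<lambda>a b. sw X y (\<lambda>d e. T a b c d e f))))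
      = sw X h (\<lambda>x c. sw X x (\<lambda>a b. sw X g (\<lambda>y f. sw X y (\<lambda>d e. T a b c d e f))))"
    by (intro sw_cong sw_swap) (use h g X in \<open>auto intro!: sw_closed\<close>)
  also have "\<dots> = sw X h (\<lambda>x c. sw X x (\<lambda>a b. sw X g (\<lambda>d y. sw X y (\<lambda>e f. T a b c d e f))))"
    by (intro sw_cong sw_coassoc) (use h g X in \<open>auto intro!: sw_closed intro: T_lin\<close>)
  also have "\<dots> = sw X h (\<lambda>a x. sw X x (\<lambda>b c. sw X g (\<lambda>d y. sw X y (\<lambda>e f. T a b c d e f))))"
    by (intro sw_coassoc) (use h g X in \<open>auto intro!: lin intro: T_lin\<close>)
  also have "\<dots> = sw X h (\<lambda>a x. sw X g (\<lambda>d y. sw X x (\<lambda>b c. sw X y (\<lambda>e f. T a b c d e f))))"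
    by (intro sw_cong sw_swap) (use h g X in \<open>auto intro!: sw_closed\<close>)
  finally show ?thesis .
qed

lemma sw_scalar_right:
  assumes "h \<in> carrier H" "module K X" "x \<in> carrier X"
    and "\<And>a b. a \<in> carrier H \<Longrightarrow> b \<in> carrier H \<Longrightarrow> E a b \<in> carrier K"
    and "\<And>a b. a \<in> carrier H \<Longrightarrow> b \<in> carrier H \<Longrightarrow> F a b = E a b \<odot>\<^bsub>X\<^esub> x"
  shows "sw X h F = sw KK h E \<odot>\<^bsub>X\<^esub> x"
proof -
  interpret X: module K X by fact
  have "sw X h F = sw X h (\<lambda>a b. E a b \<odot>\<^bsub>X\<^esub> x)"
    by (rule sw_cong) (use assms in auto)
  also have "\<dots> = sw KK h E \<odot>\<^bsub>X\<^esub> x"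
    by (rule linear_map_sw[symmetric]) (use assms in \<open>auto intro!: lin\<close>)
  finally show ?thesis .
qed

lemma sw_scalar_left:
  assumes "h \<in> carrier H" "module K X" "c \<in> carrier K"
    and "\<And>a b. a \<in> carrier H \<Longrightarrow> b \<in> carrier H \<Longrightarrow> E a b \<in> carrier X"
    and "\<And>a b. a \<in> carrier H \<Longrightarrow> b \<in> carrier H \<Longrightarrow> F a b = c \<odot>\<^bsub>X\<^esub> E a b"
  shows "sw X h F = c \<odot>\<^bsub>X\<^esub> sw X h E"
proof -
  interpret X: module K X by fact
  have "sw X h F = sw X h (\<lambda>a b. c \<odot>\<^bsub>X\<^esub> E a b)"
    by (rule sw_cong) (use assms in auto)
  also have "\<dots> = c \<odot>\<^bsub>X\<^esub> sw X h E"
    by (rule linear_map_sw[symmetric]) (use assms in \<open>auto intro!: lin\<close>)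
  finally show ?thesis .
qed

text \<open>The counit laws of the coalgebra \<open>H \<otimes> H\<close>.\<close>

lemma sw_counit2_left:
  assumes "h \<in> carrier H" "g \<in> carrier H" "module K X" "bilinear_map K H H X T"
  shows "sw X h (\<lambda>h1 h2. sw X g (\<lambda>g1 g2. (counit H h1 \<otimes>\<^bsub>K\<^esub> counit H g1) \<odot>\<^bsub>X\<^esub> T h2 g2)) = T h g"
proof -
  interpret X: module K X by fact
  note T = bilinear_map_closed[OF assms(4)]
  have "sw X h (\<lambda>h1 h2. sw X g (\<lambda>g1 g2. (counit H h1 \<otimes>\<^bsub>K\<^esub> counit H g1) \<odot>\<^bsub>X\<^esub> T h2 g2))
      = sw X h (\<lambda>h1 h2. counit H h1 \<odot>\<^bsub>X\<^esub> sw X g (\<lambda>g1 g2. counit H g1 \<odot>\<^bsub>X\<^esub> T h2 g2))"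
    by (intro sw_cong sw_scalar_left)
      (use assms(1-3) in \<open>auto intro!: sw_closed X.smult_closed T simp: X.smult_assoc1 T\<close>)
  also have "\<dots> = sw X h (\<lambda>h1 h2. counit H h1 \<odot>\<^bsub>X\<^esub> T h2 g)"
    by (intro sw_cong arg_cong2[where f = "smult X"] sw_counit_left)
      (use assms in \<open>auto intro: T bilinear_map_right[OF assms(4)]\<close>)
  also have "\<dots> = T h g"
    by (rule sw_counit_left) (use assms in \<open>auto intro: bilinear_map_left[OF assms(4)]\<close>)
  finally show ?thesis .
qed

lemma sw_counit2_right:
  assumes "h \<in> carrier H" "g \<in> carrier H" "module K X" "bilinear_map K H H X T"
  shows "sw X h (\<lambda>h1 h2. sw X g (\<lambda>g1 g2. (counit H h2 \<otimes>\<^bsub>K\<^esub> counit H g2) \<odot>\<^bsub>X\<^esub> T h1 g1)) = T h g"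
proof -
  interpret X: module K X by fact
  note T = bilinear_map_closed[OF assms(4)]
  have "sw X h (\<lambda>h1 h2. sw X g (\<lambda>g1 g2. (counit H h2 \<otimes>\<^bsub>K\<^esub> counit H g2) \<odot>\<^bsub>X\<^esub> T h1 g1))
      = sw X h (\<lambda>h1 h2. counit H h2 \<odot>\<^bsub>X\<^esub> sw X g (\<lambda>g1 g2. counit H g2 \<odot>\<^bsub>X\<^esub> T h1 g1))"
    by (intro sw_cong sw_scalar_left)
      (use assms(1-3) in \<open>auto intro!: sw_closed X.smult_closed T simp: X.smult_assoc1 T\<close>)
  also have "\<dots> = sw X h (\<lambda>h1 h2. counit H h2 \<odot>\<^bsub>X\<^esub> T h1 g)"
    by (intro sw_cong arg_cong2[where f = "smult X"] sw_counit_right)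
      (use assms in \<open>auto intro: T bilinear_map_right[OF assms(4)]\<close>)
  also have "\<dots> = T h g"
    by (rule sw_counit_right) (use assms in \<open>auto intro: bilinear_map_left[OF assms(4)]\<close>)
  finally show ?thesis .
qed

end

section \<open>Symmetric forms\<close>

text \<open>A linear form on \<open>H \<otimes> H\<close>, given as a bilinear form on \<open>H\<close>.\<close>

locale hopf_form = hopf_algebra K H
  for K :: "('k, 'r) ring_scheme" and H :: "('k, 'h, 'm) hopf_scheme" +
  fixes \<zeta> :: "'h \<Rightarrow> 'h \<Rightarrow> 'k"
  assumes form_bilinear': "bilinear_map K H H (regular_module K) \<zeta>"
begin

lemma form_closed [simp, intro]: "a \<in> carrier H \<Longrightarrow> b \<in> carrier H \<Longrightarrow> \<zeta> a b \<in> carrier K"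
  using bilinear_map_closed[OF form_bilinear'] by simp

lemmas form_lin = bilinear_map_compose_left[OF form_bilinear'] bilinear_map_compose_right[OF form_bilinear']

end

text \<open>The flipped form \<open>h \<otimes> g \<mapsto> \<zeta>(g, h)\<close> is a right convolution inverse of \<open>\<zeta>\<close>. Exchanging \<open>h\<close> and
  \<open>g\<close> shows that it is a left inverse as well.\<close>

locale symmetric_form = hopf_form +
  assumes symmetric: "\<lbrakk>h \<in> carrier H; g \<in> carrier H\<rbrakk> \<Longrightarrow>
    sw KK h (\<lambda>h1 h2. sw KK g (\<lambda>g1 g2. \<zeta> h1 g1 \<otimes>\<^bsub>K\<^esub> \<zeta> g2 h2)) = counit H h \<otimes>\<^bsub>K\<^esub> counit H g"
begin

text \<open>Linear forms on \<open>H \<otimes> H\<close> act by convolution from the left and from the right on the bilinear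
  maps \<open>T\<close> out of \<open>H \<times> H\<close>. Acting with the flipped form and then with \<open>\<zeta>\<close> changes nothing.\<close>

lemma form_cancel_left:
  assumes "h \<in> carrier H" "g \<in> carrier H" and X: "module K X" and T: "bilinear_map K H H X T"
  shows "sw X h (\<lambda>h1 h2. sw X g (\<lambda>g1 g2. \<zeta> h1 g1 \<odot>\<^bsub>X\<^esub>
      sw X h2 (\<lambda>a b. sw X g2 (\<lambda>c d. \<zeta> c a \<odot>\<^bsub>X\<^esub> T b d)))) = T h g"
proof -
  interpret X: module K X by fact
  note Tc = bilinear_map_closed[OF T]
  note T_lin = bilinear_map_compose_left[OF T] bilinear_map_compose_right[OF T]
  have "sw X h (\<lambda>h1 h2. sw X g (\<lambda>g1 g2. \<zeta> h1 g1 \<odot>\<^bsub>X\<^esub>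
      sw X h2 (\<lambda>a b. sw X g2 (\<lambda>c d. \<zeta> c a \<odot>\<^bsub>X\<^esub> T b d))))
    = sw X h (\<lambda>h1 h2. sw X g (\<lambda>g1 g2. 
      sw X h2 (\<lambda>a b. sw X g2 (\<lambda>c d. \<zeta> h1 g1 \<odot>\<^bsub>X\<^esub> (\<zeta> c a \<odot>\<^bsub>X\<^esub> T b d)))))"
    by (intro sw_cong sw_scalar_left[symmetric] sw_scalar_left) (use assms(1-3) in \<open>auto intro!: sw_closed sw_scalar_closed X.smult_closed Tc\<close>)
  also have "\<dots> = sw X h (\<lambda>x c. sw X g (\<lambda>y f.
      sw X x (\<lambda>a b. sw X y (\<lambda>d e. \<zeta> a d \<odot>\<^bsub>X\<^esub> (\<zeta> e b \<odot>\<^bsub>X\<^esub> T c f)))))"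
    by (rule sw_coassoc2[symmetric]) (use assms(1-3) in \<open>auto intro!: lin form_lin T_lin Tc\<close>)
  also have "\<dots> = sw X h (\<lambda>x c. sw X g (\<lambda>y f. (counit H x \<otimes>\<^bsub>K\<^esub> counit H y) \<odot>\<^bsub>X\<^esub> T c f))"
  proof (intro sw_cong)
    fix x c y f assume xy: "x \<in> carrier H" "c \<in> carrier H" "y \<in> carrier H" "f \<in> carrier H"
    show "sw X x (\<lambda>a b. sw X y (\<lambda>d e. \<zeta> a d \<odot>\<^bsub>X\<^esub> (\<zeta> e b \<odot>\<^bsub>X\<^esub> T c f)))
        = (counit H x \<otimes>\<^bsub>K\<^esub> counit H y) \<odot>\<^bsub>X\<^esub> T c f"
      unfolding symmetric[OF xy(1,3), symmetric]
      by (intro sw_scalar_right) (use xy X in \<open>auto intro!: sw_closed sw_scalar_closed Tc simp: X.smult_assoc1 Tc\<close>)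
  qed (use assms(1-3) in \<open>auto intro!: sw_closed sw_scalar_closed X.smult_closed Tc\<close>)
  also have "\<dots> = T h g"
    by (rule sw_counit2_left) (use assms in auto)
  finally show ?thesis .
qed

lemma form_cancel_right:
  assumes "h \<in> carrier H" "g \<in> carrier H" and X: "module K X" and T: "bilinear_map K H H X T"
  shows "sw X h (\<lambda>h1 h2. sw X g (\<lambda>g1 g2. \<zeta> h2 g2 \<odot>\<^bsub>X\<^esub>
      sw X h1 (\<lambda>a b. sw X g1 (\<lambda>c d. \<zeta> d b \<odot>\<^bsub>X\<^esub> T a c)))) = T h g"
proof -
  interpret X: module K X by fact
  note Tc = bilinear_map_closed[OF T]
  note T_lin = bilinear_map_compose_left[OF T] bilinear_map_compose_right[OF T]
  have "sw X h (\<lambda>h1 h2. sw X g (\<lambda>g1 g2. \<zeta> h2 g2 \<odot>\<^bsub>X\<^esub>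
      sw X h1 (\<lambda>a b. sw X g1 (\<lambda>c d. \<zeta> d b \<odot>\<^bsub>X\<^esub> T a c))))
    = sw X h (\<lambda>x e. sw X g (\<lambda>y f.
      sw X x (\<lambda>a b. sw X y (\<lambda>c d. \<zeta> e f \<odot>\<^bsub>X\<^esub> (\<zeta> d b \<odot>\<^bsub>X\<^esub> T a c)))))"
    by (intro sw_cong sw_scalar_left[symmetric] sw_scalar_left)
      (use assms(1-3) in \<open>auto intro!: sw_closed sw_scalar_closed X.smult_closed Tc\<close>)
  also have "\<dots> = sw X h (\<lambda>a x. sw X g (\<lambda>c y.
      sw X x (\<lambda>b e. sw X y (\<lambda>d f. \<zeta> e f \<odot>\<^bsub>X\<^esub> (\<zeta> d b \<odot>\<^bsub>X\<^esub> T a c)))))"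
    by (rule sw_coassoc2) (use assms(1-3) in \<open>auto intro!: lin form_lin T_lin Tc\<close>)
  also have "\<dots> = sw X h (\<lambda>a x. sw X g (\<lambda>c y. (counit H x \<otimes>\<^bsub>K\<^esub> counit H y) \<odot>\<^bsub>X\<^esub> T a c))"
  proof (intro sw_cong)
    fix a x c y assume xy: "a \<in> carrier H" "x \<in> carrier H" "c \<in> carrier H" "y \<in> carrier H"
    have "sw X x (\<lambda>b e. sw X y (\<lambda>d f. \<zeta> e f \<odot>\<^bsub>X\<^esub> (\<zeta> d b \<odot>\<^bsub>X\<^esub> T a c)))
        = sw X y (\<lambda>d f. sw X x (\<lambda>b e. \<zeta> e f \<odot>\<^bsub>X\<^esub> (\<zeta> d b \<odot>\<^bsub>X\<^esub> T a c)))"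
      by (intro sw_swap) (use xy X in \<open>auto intro!: X.smult_closed Tc\<close>)
    also have "\<dots> = sw KK y (\<lambda>d f. sw KK x (\<lambda>b e. \<zeta> d b \<otimes>\<^bsub>K\<^esub> \<zeta> e f)) \<odot>\<^bsub>X\<^esub> T a c"
      by (intro sw_scalar_right)
        (use xy X in \<open>auto intro!: sw_closed sw_scalar_closed Tc simp: X.smult_assoc1[symmetric] m_comm Tc\<close>)
    also have "\<dots> = (counit H x \<otimes>\<^bsub>K\<^esub> counit H y) \<odot>\<^bsub>X\<^esub> T a c"
      using xy by (simp add: symmetric m_comm)
    finally show "sw X x (\<lambda>b e. sw X y (\<lambda>d f. \<zeta> e f \<odot>\<^bsub>X\<^esub> (\<zeta> d b \<odot>\<^bsub>X\<^esub> T a c)))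
        = (counit H x \<otimes>\<^bsub>K\<^esub> counit H y) \<odot>\<^bsub>X\<^esub> T a c" .
  qed (use assms(1-3) in \<open>auto intro!: sw_closed sw_scalar_closed X.smult_closed Tc\<close>)
  also have "\<dots> = T h g"
    by (rule sw_counit2_right) (use assms in auto)
  finally show ?thesis .
qed

text \<open>\<open>F * \<zeta>\<^sup>o\<^sup>p = G\<close> implies \<open>F = G * \<zeta>\<close>.\<close>

lemma form_deconvolve:
  assumes "h \<in> carrier H" "g \<in> carrier H" and F: "bilinear_map K H H KK F"
    and conv: "\<And>h g. h \<in> carrier H \<Longrightarrow> g \<in> carrier H \<Longrightarrow>
      sw KK h (\<lambda>h1 h2. sw KK g (\<lambda>g1 g2. \<zeta> g2 h2 \<otimes>\<^bsub>K\<^esub> F h1 g1)) = G h g"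
    and G: "\<And>h g. h \<in> carrier H \<Longrightarrow> g \<in> carrier H \<Longrightarrow> G h g \<in> carrier K"
  shows "F h g = sw KK h (\<lambda>h1 h2. sw KK g (\<lambda>g1 g2. \<zeta> h2 g2 \<otimes>\<^bsub>K\<^esub> G h1 g1))"
proof -
  have "F h g = sw KK h (\<lambda>h1 h2. sw KK g (\<lambda>g1 g2. \<zeta> h2 g2 \<otimes>\<^bsub>K\<^esub>
      sw KK h1 (\<lambda>a b. sw KK g1 (\<lambda>c d. \<zeta> d b \<otimes>\<^bsub>K\<^esub> F a c))))"
    using form_cancel_right[OF assms(1,2) module_KK F] by simp
  also have "\<dots> = sw KK h (\<lambda>h1 h2. sw KK g (\<lambda>g1 g2. \<zeta> h2 g2 \<otimes>\<^bsub>K\<^esub> G h1 g1))"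
    by (intro sw_cong) (use assms in \<open>auto intro!: sw_scalar_closed\<close>)
  finally show ?thesis .
qed

text \<open>The flipped form is the convolution inverse of \<open>\<zeta>\<close>, so multiplicativity in the first argument
  passes to the second. In the convolution algebra of linear forms in \<open>h, g, l\<close>, the form
  \<open>\<zeta>(g l, h) = \<zeta>(l, h\<^sub>1) \<zeta>(g, h\<^sub>2)\<close> is the inverse of \<open>\<zeta>(h, g l)\<close>; cancelling the factor
  \<open>\<zeta>(g, h\<^sub>2)\<close> and then the factor \<open>\<zeta>(l, h\<^sub>1)\<close> leaves \<open>\<zeta>(h\<^sub>1, g) \<zeta>(h\<^sub>2, l)\<close>.\<close>

lemma mult_right_of_mult_left:
  assumes mult_left: "\<And>h g l. h \<in> carrier H \<Longrightarrow> g \<in> carrier H \<Longrightarrow> l \<in> carrier H \<Longrightarrow>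
      \<zeta> (h \<otimes>\<^bsub>H\<^esub> g) l = sw KK l (\<lambda>l1 l2. \<zeta> h l2 \<otimes>\<^bsub>K\<^esub> \<zeta> g l1)"
    and h: "h \<in> carrier H" and g: "g \<in> carrier H" and l: "l \<in> carrier H"
  shows "\<zeta> h (g \<otimes>\<^bsub>H\<^esub> l) = sw KK h (\<lambda>h1 h2. \<zeta> h1 g \<otimes>\<^bsub>K\<^esub> \<zeta> h2 l)"
proof -
  \<comment> \<open>\<open>F l h g\<close> is \<open>\<zeta>(h\<^sub>1, g l\<^sub>1) \<zeta>(l\<^sub>2, h\<^sub>2)\<close>; the first cancellation shows that it is \<open>\<zeta>(h, g) \<epsilon>(l)\<close>.\<close>
  define F where "F = (\<lambda>l h g. sw KK h (\<lambda>a b. sw KK l (\<lambda>l1 l2. \<zeta> l2 b \<otimes>\<^bsub>K\<^esub> \<zeta> a (g \<otimes>\<^bsub>H\<^esub> l1))))"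
  have F_bil: "bilinear_map K H H KK (F l)" if "l \<in> carrier H" for l
    unfolding F_def by (rule bilinear_mapI) (use that in \<open>auto intro!: lin form_lin\<close>)
  have conv: "sw KK h (\<lambda>h1 h2. sw KK g (\<lambda>g1 g2. \<zeta> g2 h2 \<otimes>\<^bsub>K\<^esub> F l h1 g1))
      = counit H h \<otimes>\<^bsub>K\<^esub> (counit H g \<otimes>\<^bsub>K\<^esub> counit H l)"
    if hgl: "h \<in> carrier H" "g \<in> carrier H" "l \<in> carrier H" for h g l
  proof -
    let ?E = "\<lambda>a b c g1 g2 l1 l2. \<zeta> g2 c \<otimes>\<^bsub>K\<^esub> (\<zeta> l2 b \<otimes>\<^bsub>K\<^esub> \<zeta> a (g1 \<otimes>\<^bsub>H\<^esub> l1))"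
    have "sw KK h (\<lambda>h1 h2. sw KK g (\<lambda>g1 g2. \<zeta> g2 h2 \<otimes>\<^bsub>K\<^esub> F l h1 g1))
        = sw KK h (\<lambda>x c. sw KK g (\<lambda>g1 g2. sw KK x (\<lambda>a b. sw KK l (\<lambda>l1 l2. ?E a b c g1 g2 l1 l2))))"
      unfolding F_def
      by (intro sw_cong sw_scalar_left[symmetric, where X = KK, simplified]
          sw_scalar_left[where X = KK, simplified])
        (use hgl in \<open>auto intro!: sw_scalar_closed\<close>)
    also have "\<dots> = sw KK h (\<lambda>x c. sw KK x (\<lambda>a b. sw KK g (\<lambda>g1 g2. sw KK l (\<lambda>l1 l2. ?E a b c g1 g2 l1 l2))))"
      by (intro sw_cong sw_swap) (use hgl in \<open>auto intro!: sw_scalar_closed\<close>)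
    also have "\<dots> = sw KK h (\<lambda>a y. sw KK y (\<lambda>b c. sw KK g (\<lambda>g1 g2. sw KK l (\<lambda>l1 l2. ?E a b c g1 g2 l1 l2))))"
      by (rule sw_coassoc) (use hgl in \<open>auto intro!: lin form_lin\<close>)
    also have "\<dots> = sw KK h (\<lambda>a y. sw KK g (\<lambda>g1 g2. sw KK y (\<lambda>b c. sw KK l (\<lambda>l1 l2. ?E a b c g1 g2 l1 l2))))"
      by (intro sw_cong sw_swap) (use hgl in \<open>auto intro!: sw_scalar_closed\<close>)
    also have "\<dots> = sw KK h (\<lambda>a y. sw KK g (\<lambda>g1 g2. sw KK l (\<lambda>l1 l2. sw KK y (\<lambda>b c. ?E a b c g1 g2 l1 l2))))"
      by (intro sw_cong sw_swap) (use hgl in \<open>auto intro!: sw_scalar_closed\<close>)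
    also have "\<dots> = sw KK h (\<lambda>a y. sw KK g (\<lambda>g1 g2. sw KK l (\<lambda>l1 l2.
        \<zeta> a (g1 \<otimes>\<^bsub>H\<^esub> l1) \<otimes>\<^bsub>K\<^esub> \<zeta> (g2 \<otimes>\<^bsub>H\<^esub> l2) y)))"
    proof (intro sw_cong)
      fix a y g1 g2 l1 l2
      assume c: "a \<in> carrier H" "y \<in> carrier H" "g1 \<in> carrier H" "g2 \<in> carrier H"
        "l1 \<in> carrier H" "l2 \<in> carrier H"
      show "sw KK y (\<lambda>b c. ?E a b c g1 g2 l1 l2)
          = \<zeta> a (g1 \<otimes>\<^bsub>H\<^esub> l1) \<otimes>\<^bsub>K\<^esub> \<zeta> (g2 \<otimes>\<^bsub>H\<^esub> l2) y"
        unfolding mult_left[OF c(4,6,2)]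
        by (intro sw_scalar_left[where X = KK, simplified]) (use c in \<open>auto simp: scalar_ac\<close>)
    qed (use hgl in \<open>auto intro!: sw_scalar_closed\<close>)
    also have "\<dots> = sw KK h (\<lambda>a y. sw KK (g \<otimes>\<^bsub>H\<^esub> l) (\<lambda>u v. \<zeta> a u \<otimes>\<^bsub>K\<^esub> \<zeta> v y))"
      by (intro sw_cong sw_mult[symmetric] bilinear_mapI)
        (use hgl in \<open>auto intro!: sw_scalar_closed lin form_lin\<close>)
    also have "\<dots> = counit H h \<otimes>\<^bsub>K\<^esub> (counit H g \<otimes>\<^bsub>K\<^esub> counit H l)"
      using hgl by (simp add: symmetric counit_mult)
    finally show ?thesis .
  qed
  have F_eq: "F l h g = \<zeta> h g \<otimes>\<^bsub>K\<^esub> counit H l"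
    if hgl: "h \<in> carrier H" "g \<in> carrier H" "l \<in> carrier H" for h g l
  proof -
    have "F l h g = sw KK h (\<lambda>h1 h2. sw KK g (\<lambda>g1 g2.
        \<zeta> h2 g2 \<otimes>\<^bsub>K\<^esub> (counit H h1 \<otimes>\<^bsub>K\<^esub> (counit H g1 \<otimes>\<^bsub>K\<^esub> counit H l))))"
      by (rule form_deconvolve) (use hgl F_bil conv in auto)
    also have "\<dots> = sw KK h (\<lambda>h1 h2. sw KK g (\<lambda>g1 g2.
        (counit H h1 \<otimes>\<^bsub>K\<^esub> counit H g1) \<odot>\<^bsub>KK\<^esub> (\<zeta> h2 g2 \<otimes>\<^bsub>K\<^esub> counit H l)))"
      by (intro sw_cong) (use hgl in \<open>auto intro!: sw_scalar_closed simp: scalar_ac\<close>)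
    also have "\<dots> = \<zeta> h g \<otimes>\<^bsub>K\<^esub> counit H l"
      by (intro sw_counit2_left bilinear_mapI) (use hgl in \<open>auto intro!: lin form_lin\<close>)
    finally show ?thesis .
  qed
  have "\<zeta> h (g \<otimes>\<^bsub>H\<^esub> l) = sw KK h (\<lambda>h1 h2. sw KK l (\<lambda>l1 l2. \<zeta> h2 l2 \<otimes>\<^bsub>K\<^esub> (\<zeta> h1 g \<otimes>\<^bsub>K\<^esub> counit H l1)))"
  proof (rule form_deconvolve[where F = "\<lambda>h l. \<zeta> h (g \<otimes>\<^bsub>H\<^esub> l)"])
    show "bilinear_map K H H KK (\<lambda>h l. \<zeta> h (g \<otimes>\<^bsub>H\<^esub> l))"
      by (rule bilinear_mapI) (use g in \<open>auto intro!: lin form_lin\<close>)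
    fix h l assume "h \<in> carrier H" "l \<in> carrier H"
    then show "sw KK h (\<lambda>h1 h2. sw KK l (\<lambda>g1 g2. \<zeta> g2 h2 \<otimes>\<^bsub>K\<^esub> \<zeta> h1 (g \<otimes>\<^bsub>H\<^esub> g1)))
        = \<zeta> h g \<otimes>\<^bsub>K\<^esub> counit H l"
      using F_eq[of h g l] g by (simp add: F_def)
  qed (use h g l in auto)
  also have "\<dots> = sw KK h (\<lambda>h1 h2. sw KK l (\<lambda>l1 l2. counit H l1 \<odot>\<^bsub>KK\<^esub> (\<zeta> h1 g \<otimes>\<^bsub>K\<^esub> \<zeta> h2 l2)))"
    by (intro sw_cong) (use h g l in \<open>auto intro!: sw_scalar_closed simp: scalar_ac\<close>)
  also have "\<dots> = sw KK h (\<lambda>h1 h2. \<zeta> h1 g \<otimes>\<^bsub>K\<^esub> \<zeta> h2 l)"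
    by (intro sw_cong sw_counit_left) (use h g l in \<open>auto intro!: lin form_lin\<close>)
  finally show ?thesis .
qed

text \<open>A symmetric form is a cotriangular structure as soon as three of the axioms of a braiding
  hold.\<close>

lemma cotriangular:
  assumes mult_left: "\<And>h g l. h \<in> carrier H \<Longrightarrow> g \<in> carrier H \<Longrightarrow> l \<in> carrier H \<Longrightarrow>
      \<zeta> (h \<otimes>\<^bsub>H\<^esub> g) l = sw KK l (\<lambda>l1 l2. \<zeta> h l2 \<otimes>\<^bsub>K\<^esub> \<zeta> g l1)"
    and one_left: "\<And>h. h \<in> carrier H \<Longrightarrow> \<zeta> \<one>\<^bsub>H\<^esub> h = counit H h"
    and commute: "\<And>h g. h \<in> carrier H \<Longrightarrow> g \<in> carrier H \<Longrightarrow>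
      sw H h (\<lambda>h1 h2. sw H g (\<lambda>g1 g2. \<zeta> h1 g1 \<odot>\<^bsub>H\<^esub> (g2 \<otimes>\<^bsub>H\<^esub> h2)))
      = sw H h (\<lambda>h1 h2. sw H g (\<lambda>g1 g2. \<zeta> h2 g2 \<odot>\<^bsub>H\<^esub> (h1 \<otimes>\<^bsub>H\<^esub> g1)))"
  shows "cotriangular_hopf_algebra K H \<zeta>"
proof
  have conv: "form_convolution K H \<zeta> (\<lambda>a b. \<zeta> b a) h g = counit H h \<otimes>\<^bsub>K\<^esub> counit H g"
    if "h \<in> carrier H" "g \<in> carrier H" for h g
    using symmetric[OF that] by (simp add: form_convolution_def)
  have conv': "form_convolution K H (\<lambda>a b. \<zeta> b a) \<zeta> h g = counit H h \<otimes>\<^bsub>K\<^esub> counit H g"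
    if "h \<in> carrier H" "g \<in> carrier H" for h g
    unfolding form_convolution_def
    by (subst sw_swap) (use that in \<open>auto simp: symmetric m_comm\<close>)
  show "\<exists>\<xi>. bilinear_map K H H KK \<xi> \<and> (\<forall>h\<in>carrier H. \<forall>g\<in>carrier H.
      form_convolution K H \<zeta> \<xi> h g = counit H h \<otimes>\<^bsub>K\<^esub> counit H g \<and>
      form_convolution K H \<xi> \<zeta> h g = counit H h \<otimes>\<^bsub>K\<^esub> counit H g)"
    by (intro exI[of _ "\<lambda>a b. \<zeta> b a"] conjI bilinear_mapI ballI conv conv')
      (auto intro!: lin form_lin)
  show "form_convolution K H \<zeta> (\<lambda>a b. \<zeta> b a) h g = counit H g \<otimes>\<^bsub>K\<^esub> counit H h"
    if "h \<in> carrier H" "g \<in> carrier H" for h g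
    using conv[OF that] that by (simp add: m_comm)
  show "\<zeta> h \<one>\<^bsub>H\<^esub> = counit H h" if h: "h \<in> carrier H" for h
  proof -
    have "counit H h = sw KK h (\<lambda>h1 h2. sw KK \<one>\<^bsub>H\<^esub> (\<lambda>g1 g2. \<zeta> h1 g1 \<otimes>\<^bsub>K\<^esub> \<zeta> g2 h2))"
      using h by (simp add: symmetric counit_one)
    also have "\<dots> = sw KK h (\<lambda>h1 h2. counit H h2 \<odot>\<^bsub>KK\<^esub> \<zeta> h1 \<one>\<^bsub>H\<^esub>)"
    proof (intro sw_cong)
      fix h1 h2 assume h12: "h1 \<in> carrier H" "h2 \<in> carrier H"
      have "sw KK \<one>\<^bsub>H\<^esub> (\<lambda>g1 g2. \<zeta> h1 g1 \<otimes>\<^bsub>K\<^esub> \<zeta> g2 h2) = \<zeta> h1 \<one>\<^bsub>H\<^esub> \<otimes>\<^bsub>K\<^esub> \<zeta> \<one>\<^bsub>H\<^esub> h2"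
        by (intro sw_one bilinear_mapI) (use h12 in \<open>auto intro!: lin form_lin\<close>)
      then show "sw KK \<one>\<^bsub>H\<^esub> (\<lambda>g1 g2. \<zeta> h1 g1 \<otimes>\<^bsub>K\<^esub> \<zeta> g2 h2) = counit H h2 \<odot>\<^bsub>KK\<^esub> \<zeta> h1 \<one>\<^bsub>H\<^esub>"
        using h12 by (simp add: one_left m_comm)
    qed (use h in auto)
    also have "\<dots> = \<zeta> h \<one>\<^bsub>H\<^esub>"
      by (rule sw_counit_right) (use h in \<open>auto intro!: lin form_lin\<close>)
    finally show ?thesis ..
  qed
qed (use form_bilinear' mult_left mult_right_of_mult_left[OF mult_left] one_left commute in auto)

text \<open>If \<open>la\<close> is \<open>h \<rightharpoonup> k = \<zeta>(h, k\<^sub>1) k\<^sub>2\<close>, the map \<open>k \<otimes> g \<mapsto> (k\<^sub>1 \<rightharpoonup> g) \<otimes> k\<^sub>2\<close> is an involution. The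
  statement is tested with an arbitrary bilinear \<open>T\<close>. The mirror image, for
  \<open>l \<leftharpoonup> h = l\<^sub>1 \<zeta>(h, l\<^sub>2)\<close> and the map \<open>l \<otimes> h \<mapsto> h\<^sub>1 \<otimes> (l \<leftharpoonup> h\<^sub>2)\<close>, follows it.\<close>

lemma involutive_left:
  assumes la: "bilinear_map K H H H la"
    and la_eq: "\<And>h k. h \<in> carrier H \<Longrightarrow> k \<in> carrier H \<Longrightarrow> la h k = sw H k (\<lambda>a b. \<zeta> h a \<odot>\<^bsub>H\<^esub> b)"
    and kg: "k \<in> carrier H" "g \<in> carrier H" and X: "module K X" and T: "bilinear_map K H H X T"
  shows "sw X k (\<lambda>k1 k2. sw X (la k1 g) (\<lambda>z1 z2. T (la z1 k2) z2)) = T k g"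
proof -
  interpret X: module K X by fact
  note la_lin = bilinear_map_compose_left[OF la] bilinear_map_compose_right[OF la]
  note T_lin = bilinear_map_compose_left[OF T] bilinear_map_compose_right[OF T]
  note la_closed [simp] = bilinear_map_closed[OF la]
  note Tc [simp] = bilinear_map_closed[OF T]
  have T_la: "T (la c k2) d = sw X k2 (\<lambda>a b. \<zeta> c a \<odot>\<^bsub>X\<^esub> T b d)"
    if "c \<in> carrier H" "k2 \<in> carrier H" "d \<in> carrier H" for c k2 d
  proof -
    have "T (la c k2) d = T (sw H k2 (\<lambda>a b. \<zeta> c a \<odot>\<^bsub>H\<^esub> b)) d"
      using la_eq that by simp
    also have "\<dots> = sw X k2 (\<lambda>a b. T (\<zeta> c a \<odot>\<^bsub>H\<^esub> b) d)"
      by (rule linear_map_sw[where \<phi> = "\<lambda>x. T x d"]) (use that X in \<open>auto intro!: T_lin lin\<close>)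
    also have "\<dots> = sw X k2 (\<lambda>a b. \<zeta> c a \<odot>\<^bsub>X\<^esub> T b d)"
      by (intro sw_cong) (use that X in \<open>auto simp: linear_map_smult[OF bilinear_map_left[OF T]]\<close>)
    finally show ?thesis .
  qed
  have step: "sw X (la k1 g) (\<lambda>z1 z2. T (la z1 k2) z2)
      = sw X g (\<lambda>g1 g2. \<zeta> k1 g1 \<odot>\<^bsub>X\<^esub> sw X k2 (\<lambda>a b. sw X g2 (\<lambda>c d. \<zeta> c a \<odot>\<^bsub>X\<^esub> T b d)))"
    if k12: "k1 \<in> carrier H" "k2 \<in> carrier H" for k1 k2
  proof -
    let ?\<phi> = "\<lambda>z. sw X z (\<lambda>z1 z2. T (la z1 k2) z2)"
    have \<phi>: "linear_map K H X ?\<phi>" using k12 X by (auto intro!: lin la_lin T_lin)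
    have "?\<phi> (la k1 g) = ?\<phi> (sw H g (\<lambda>g1 g2. \<zeta> k1 g1 \<odot>\<^bsub>H\<^esub> g2))"
      using la_eq k12 kg by simp
    also have "\<dots> = sw X g (\<lambda>g1 g2. ?\<phi> (\<zeta> k1 g1 \<odot>\<^bsub>H\<^esub> g2))"
      by (rule linear_map_sw[OF _ _ _ \<phi>]) (use k12 kg X in auto)
    also have "\<dots> = sw X g (\<lambda>g1 g2. \<zeta> k1 g1 \<odot>\<^bsub>X\<^esub> ?\<phi> g2)"
      by (intro sw_cong) (use k12 kg X in \<open>auto simp: linear_map_smult[OF \<phi>] intro!: sw_closed X.smult_closed\<close>)
    also have "\<dots> = sw X g (\<lambda>g1 g2. \<zeta> k1 g1 \<odot>\<^bsub>X\<^esub> sw X g2 (\<lambda>c d. sw X k2 (\<lambda>a b. \<zeta> c a \<odot>\<^bsub>X\<^esub> T b d)))"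
      by (intro sw_cong arg_cong2[where f = "smult X"])
        (use k12 kg X in \<open>auto simp: T_la intro!: sw_closed X.smult_closed\<close>)
    also have "\<dots> = sw X g (\<lambda>g1 g2. \<zeta> k1 g1 \<odot>\<^bsub>X\<^esub> sw X k2 (\<lambda>a b. sw X g2 (\<lambda>c d. \<zeta> c a \<odot>\<^bsub>X\<^esub> T b d)))"
      by (intro sw_cong arg_cong2[where f = "smult X"] sw_swap)
        (use k12 kg X in \<open>auto intro!: sw_closed X.smult_closed\<close>)
    finally show ?thesis .
  qed
  have "sw X k (\<lambda>k1 k2. sw X (la k1 g) (\<lambda>z1 z2. T (la z1 k2) z2))
      = sw X k (\<lambda>k1 k2. sw X g (\<lambda>g1 g2. \<zeta> k1 g1 \<odot>\<^bsub>X\<^esub>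
          sw X k2 (\<lambda>a b. sw X g2 (\<lambda>c d. \<zeta> c a \<odot>\<^bsub>X\<^esub> T b d))))"
    by (intro sw_cong step) (use kg X in \<open>auto intro!: sw_closed X.smult_closed\<close>)
  also have "\<dots> = T k g" by (rule form_cancel_left[OF kg X T])
  finally show ?thesis .
qed

lemma involutive_right:
  assumes ra: "bilinear_map K H H H ra"
    and ra_eq: "\<And>h l. h \<in> carrier H \<Longrightarrow> l \<in> carrier H \<Longrightarrow> ra l h = sw H l (\<lambda>a b. \<zeta> h b \<odot>\<^bsub>H\<^esub> a)"
    and lh: "l \<in> carrier H" "h \<in> carrier H" and X: "module K X" and T: "bilinear_map K H H X T"
  shows "sw X h (\<lambda>h1 h2. sw X (ra l h2) (\<lambda>y1 y2. T y1 (ra h1 y2))) = T l h"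
proof -
  interpret X: module K X by fact
  note ra_lin = bilinear_map_compose_left[OF ra] bilinear_map_compose_right[OF ra]
  note T_lin = bilinear_map_compose_left[OF T] bilinear_map_compose_right[OF T]
  note ra_closed [simp] = bilinear_map_closed[OF ra]
  note Tc [simp] = bilinear_map_closed[OF T]
  have T_ra: "T c (ra h1 d) = sw X h1 (\<lambda>a b. \<zeta> d b \<odot>\<^bsub>X\<^esub> T c a)"
    if "c \<in> carrier H" "h1 \<in> carrier H" "d \<in> carrier H" for c h1 d
  proof -
    have "T c (ra h1 d) = T c (sw H h1 (\<lambda>a b. \<zeta> d b \<odot>\<^bsub>H\<^esub> a))"
      using ra_eq that by simp
    also have "\<dots> = sw X h1 (\<lambda>a b. T c (\<zeta> d b \<odot>\<^bsub>H\<^esub> a))"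
      by (rule linear_map_sw[where \<phi> = "T c"]) (use that X in \<open>auto intro!: bilinear_map_right[OF T]\<close>)
    also have "\<dots> = sw X h1 (\<lambda>a b. \<zeta> d b \<odot>\<^bsub>X\<^esub> T c a)"
      by (intro sw_cong) (use that X in \<open>auto simp: linear_map_smult[OF bilinear_map_right[OF T]]\<close>)
    finally show ?thesis .
  qed
  have step: "sw X (ra l h2) (\<lambda>y1 y2. T y1 (ra h1 y2))
      = sw X l (\<lambda>l1 l2. \<zeta> h2 l2 \<odot>\<^bsub>X\<^esub> sw X h1 (\<lambda>a b. sw X l1 (\<lambda>c d. \<zeta> d b \<odot>\<^bsub>X\<^esub> T c a)))"
    if h12: "h1 \<in> carrier H" "h2 \<in> carrier H" for h1 h2
  proof -
    let ?\<phi> = "\<lambda>y. sw X y (\<lambda>y1 y2. T y1 (ra h1 y2))"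
    have \<phi>: "linear_map K H X ?\<phi>" using h12 X by (auto intro!: lin ra_lin T_lin)
    have "?\<phi> (ra l h2) = ?\<phi> (sw H l (\<lambda>l1 l2. \<zeta> h2 l2 \<odot>\<^bsub>H\<^esub> l1))"
      using ra_eq h12 lh by simp
    also have "\<dots> = sw X l (\<lambda>l1 l2. ?\<phi> (\<zeta> h2 l2 \<odot>\<^bsub>H\<^esub> l1))"
      by (rule linear_map_sw[OF _ _ _ \<phi>]) (use h12 lh X in auto)
    also have "\<dots> = sw X l (\<lambda>l1 l2. \<zeta> h2 l2 \<odot>\<^bsub>X\<^esub> ?\<phi> l1)"
      by (intro sw_cong) (use h12 lh X in \<open>auto simp: linear_map_smult[OF \<phi>] intro!: sw_closed X.smult_closed\<close>)
    also have "\<dots> = sw X l (\<lambda>l1 l2. \<zeta> h2 l2 \<odot>\<^bsub>X\<^esub> sw X l1 (\<lambda>c d. sw X h1 (\<lambda>a b. \<zeta> d b \<odot>\<^bsub>X\<^esub> T c a)))"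
      by (intro sw_cong arg_cong2[where f = "smult X"])
        (use h12 lh X in \<open>auto simp: T_ra intro!: sw_closed X.smult_closed\<close>)
    also have "\<dots> = sw X l (\<lambda>l1 l2. \<zeta> h2 l2 \<odot>\<^bsub>X\<^esub> sw X h1 (\<lambda>a b. sw X l1 (\<lambda>c d. \<zeta> d b \<odot>\<^bsub>X\<^esub> T c a)))"
      by (intro sw_cong arg_cong2[where f = "smult X"] sw_swap)
        (use h12 lh X in \<open>auto intro!: sw_closed X.smult_closed\<close>)
    finally show ?thesis .
  qed
  have "sw X h (\<lambda>h1 h2. sw X (ra l h2) (\<lambda>y1 y2. T y1 (ra h1 y2)))
      = sw X h (\<lambda>h1 h2. sw X l (\<lambda>l1 l2. \<zeta> h2 l2 \<odot>\<^bsub>X\<^esub>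
          sw X h1 (\<lambda>a b. sw X l1 (\<lambda>c d. \<zeta> d b \<odot>\<^bsub>X\<^esub> T c a))))"
    by (intro sw_cong step) (use lh X in \<open>auto intro!: sw_closed X.smult_closed\<close>)
  also have "\<dots> = T l h"
    by (rule form_cancel_right[OF lh(2,1) X, where T = "\<lambda>a c. T c a"])
      (use T in \<open>auto simp: bilinear_map_def\<close>)
  finally show ?thesis .
qed

end

section \<open>Forms from involutions\<close>

context hopf_algebra
begin

text \<open>Conversely, if \<open>k \<otimes> g \<mapsto> (k\<^sub>1 \<rightharpoonup> g) \<otimes> k\<^sub>2\<close> is an involution, then \<open>\<rightharpoonup>\<close> comes from the form
  \<open>\<epsilon>(h \<rightharpoonup> k)\<close>, and this form is symmetric. Only the coalgebra structure and the bilinearity of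
  \<open>\<rightharpoonup>\<close> enter.\<close>

lemma symmetric_form_of_involutive_left:
  assumes la: "bilinear_map K H H H la"
    and inv: "\<And>k g. k \<in> carrier H \<Longrightarrow> g \<in> carrier H \<Longrightarrow>
      sw HH k (\<lambda>k1 k2. sw HH (la k1 g) (\<lambda>z1 z2. tens K H H (la z1 k2) z2)) = tens K H H k g"
  defines "\<zeta> \<equiv> \<lambda>h k. counit H (la h k)"
  shows "symmetric_form K H \<zeta>"
    and "\<And>h k. h \<in> carrier H \<Longrightarrow> k \<in> carrier H \<Longrightarrow> la h k = sw H k (\<lambda>a b. \<zeta> h a \<odot>\<^bsub>H\<^esub> b)"
proof -
  note la_lin = bilinear_map_compose_left[OF la] bilinear_map_compose_right[OF la]
  have la_closed [simp]: "la a b \<in> carrier H" if "a \<in> carrier H" "b \<in> carrier H" for a b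
    using bilinear_map_closed[OF la that] .
  interpret hopf_form K H \<zeta>
    by unfold_locales (auto simp: \<zeta>_def intro!: bilinear_mapI lin la_lin)
  have inv_lift: "sw X k (\<lambda>k1 k2. sw X (la k1 g) (\<lambda>z1 z2. T (la z1 k2) z2)) = T k g"
    if kg: "k \<in> carrier H" "g \<in> carrier H" and X: "module K X" and T: "bilinear_map K H H X T"
    for X :: "('k, 'u, 'z) module_scheme" and T k g
  proof -
    let ?\<phi> = "\<lambda>t. tensor_lift K X t T"
    note \<phi> = tensor_lift_linear[OF module_H module_H X T]
    have "T k g = ?\<phi> (sw HH k (\<lambda>k1 k2. sw HH (la k1 g) (\<lambda>z1 z2. tens K H H (la z1 k2) z2)))"
      using inv[OF kg] tensor_lift_tens[OF module_H module_H X T kg] by simp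
    also have "\<dots> = sw X k (\<lambda>k1 k2. sw X (la k1 g) (\<lambda>z1 z2. ?\<phi> (tens K H H (la z1 k2) z2)))"
      by (rule linear_map_sw2[OF _ _ _ \<phi>]) (use kg X in auto)
    also have "\<dots> = sw X k (\<lambda>k1 k2. sw X (la k1 g) (\<lambda>z1 z2. T (la z1 k2) z2))"
      by (intro sw_cong tensor_lift_tens[OF _ _ X T])
        (use kg X in \<open>auto intro!: sw_closed bilinear_map_closed[OF T]\<close>)
    finally show ?thesis ..
  qed
  have counit_inv: "sw KK k (\<lambda>k1 k2. \<zeta> (la k1 g) k2) = counit H k \<otimes>\<^bsub>K\<^esub> counit H g"
    if kg: "k \<in> carrier H" "g \<in> carrier H" for k g
  proof -
    have "sw KK k (\<lambda>k1 k2. \<zeta> (la k1 g) k2)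
        = sw KK k (\<lambda>k1 k2. sw KK (la k1 g) (\<lambda>z1 z2. counit H z2 \<odot>\<^bsub>KK\<^esub> \<zeta> z1 k2))"
      by (intro sw_cong sw_counit_right[symmetric]) (use kg in \<open>auto intro!: form_lin lin sw_scalar_closed\<close>)
    also have "\<dots> = sw KK k (\<lambda>k1 k2. sw KK (la k1 g) (\<lambda>z1 z2. counit H (la z1 k2) \<otimes>\<^bsub>K\<^esub> counit H z2))"
      by (intro sw_cong) (use kg in \<open>auto simp: \<zeta>_def m_comm intro!: sw_scalar_closed\<close>)
    also have "\<dots> = counit H k \<otimes>\<^bsub>K\<^esub> counit H g"
      by (intro inv_lift bilinear_mapI) (use kg in \<open>auto intro!: lin\<close>)
    finally show ?thesis .
  qed
  show la_eq: "la h k = sw H k (\<lambda>a b. \<zeta> h a \<odot>\<^bsub>H\<^esub> b)" if hk: "h \<in> carrier H" "k \<in> carrier H" for h k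
  proof -
    \<comment> \<open>The involution is applied to \<open>h \<otimes> k\<close> and tested with \<open>x \<otimes> y \<mapsto> \<zeta>(x, y\<^sub>1) y\<^sub>2\<close>. By coassociativity
      the first two of the three legs of \<open>h\<^sub>1 \<rightharpoonup> k\<close> then meet in \<open>counit_inv\<close>.\<close>
    have "sw H k (\<lambda>a b. \<zeta> h a \<odot>\<^bsub>H\<^esub> b)
        = sw H h (\<lambda>h1 h2. sw H (la h1 k) (\<lambda>z1 z2. sw H z2 (\<lambda>a b. \<zeta> (la z1 h2) a \<odot>\<^bsub>H\<^esub> b)))"
      by (intro inv_lift[symmetric] bilinear_mapI) (use hk in \<open>auto intro!: lin form_lin\<close>)
    also have "\<dots> = sw H h (\<lambda>h1 h2. sw H (la h1 k) (\<lambda>y z2. sw H y (\<lambda>z1 a. \<zeta> (la z1 h2) a \<odot>\<^bsub>H\<^esub> z2)))"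
      by (intro sw_cong sw_coassoc[symmetric]) (use hk in \<open>auto intro!: lin form_lin la_lin sw_closed\<close>)
    also have "\<dots> = sw H h (\<lambda>h1 h2. sw H (la h1 k) (\<lambda>y z2. sw KK y (\<lambda>z1 a. \<zeta> (la z1 h2) a) \<odot>\<^bsub>H\<^esub> z2))"
      by (intro sw_cong sw_scalar_right) (use hk in \<open>auto intro!: sw_closed sw_scalar_closed\<close>)
    also have "\<dots> = sw H h (\<lambda>h1 h2. sw H (la h1 k) (\<lambda>y z2. counit H y \<odot>\<^bsub>H\<^esub> (counit H h2 \<odot>\<^bsub>H\<^esub> z2)))"
      by (intro sw_cong) (use hk in \<open>auto simp: counit_inv smult_assoc1 intro!: sw_closed\<close>)
    also have "\<dots> = sw H h (\<lambda>h1 h2. counit H h2 \<odot>\<^bsub>H\<^esub> la h1 k)"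
      by (intro sw_cong sw_counit_left) (use hk in \<open>auto intro!: lin\<close>)
    also have "\<dots> = la h k"
      by (rule sw_counit_right) (use hk in \<open>auto intro!: lin la_lin\<close>)
    finally show ?thesis ..
  qed
  show "symmetric_form K H \<zeta>"
  proof
    fix h g assume hg: "h \<in> carrier H" "g \<in> carrier H"
    have "sw KK h (\<lambda>h1 h2. sw KK g (\<lambda>g1 g2. \<zeta> h1 g1 \<otimes>\<^bsub>K\<^esub> \<zeta> g2 h2)) = sw KK h (\<lambda>h1 h2. \<zeta> (la h1 g) h2)"
    proof (intro sw_cong)
      fix h1 h2 assume h12: "h1 \<in> carrier H" "h2 \<in> carrier H"
      have "\<zeta> (la h1 g) h2 = \<zeta> (sw H g (\<lambda>a b. \<zeta> h1 a \<odot>\<^bsub>H\<^esub> b)) h2"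
        using la_eq h12 hg by simp
      also have "\<dots> = sw KK g (\<lambda>a b. \<zeta> (\<zeta> h1 a \<odot>\<^bsub>H\<^esub> b) h2)"
        by (rule linear_map_sw[where \<phi> = "\<lambda>x. \<zeta> x h2"]) (use h12 hg in \<open>auto intro!: form_lin lin\<close>)
      also have "\<dots> = sw KK g (\<lambda>g1 g2. \<zeta> h1 g1 \<otimes>\<^bsub>K\<^esub> \<zeta> g2 h2)"
        by (intro sw_cong)
          (use h12 hg in \<open>auto simp: linear_map_smult[OF bilinear_map_left[OF form_bilinear']]\<close>)
      finally show "sw KK g (\<lambda>g1 g2. \<zeta> h1 g1 \<otimes>\<^bsub>K\<^esub> \<zeta> g2 h2) = \<zeta> (la h1 g) h2" ..
    qed (use hg in auto)
    also have "\<dots> = counit H h \<otimes>\<^bsub>K\<^esub> counit H g" by (rule counit_inv[OF hg])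
    finally show "sw KK h (\<lambda>h1 h2. sw KK g (\<lambda>g1 g2. \<zeta> h1 g1 \<otimes>\<^bsub>K\<^esub> \<zeta> g2 h2)) = counit H h \<otimes>\<^bsub>K\<^esub> counit H g" .
  qed
qed

text \<open>The mirror image for \<open>\<leftharpoonup>\<close> and the map \<open>l \<otimes> h \<mapsto> h\<^sub>1 \<otimes> (l \<leftharpoonup> h\<^sub>2)\<close>.\<close>

lemma symmetric_form_of_involutive_right:
  assumes ra: "bilinear_map K H H H ra"
    and inv: "\<And>l h. l \<in> carrier H \<Longrightarrow> h \<in> carrier H \<Longrightarrow>
      sw HH h (\<lambda>h1 h2. sw HH (ra l h2) (\<lambda>y1 y2. tens K H H y1 (ra h1 y2))) = tens K H H l h"
  defines "\<xi> \<equiv> \<lambda>h l. counit H (ra l h)"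
  shows "symmetric_form K H \<xi>"
    and "\<And>h l. h \<in> carrier H \<Longrightarrow> l \<in> carrier H \<Longrightarrow> ra l h = sw H l (\<lambda>a b. \<xi> h b \<odot>\<^bsub>H\<^esub> a)"
proof -
  note ra_lin = bilinear_map_compose_left[OF ra] bilinear_map_compose_right[OF ra]
  have ra_closed [simp]: "ra a b \<in> carrier H" if "a \<in> carrier H" "b \<in> carrier H" for a b
    using bilinear_map_closed[OF ra that] .
  interpret hopf_form K H \<xi>
    by unfold_locales (auto simp: \<xi>_def intro!: bilinear_mapI lin ra_lin)
  have inv_lift: "sw X h (\<lambda>h1 h2. sw X (ra l h2) (\<lambda>y1 y2. T y1 (ra h1 y2))) = T l h"
    if lh: "l \<in> carrier H" "h \<in> carrier H" and X: "module K X" and T: "bilinear_map K H H X T"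
    for X :: "('k, 'u, 'z) module_scheme" and T l h
  proof -
    let ?\<phi> = "\<lambda>t. tensor_lift K X t T"
    note \<phi> = tensor_lift_linear[OF module_H module_H X T]
    have "T l h = ?\<phi> (sw HH h (\<lambda>h1 h2. sw HH (ra l h2) (\<lambda>y1 y2. tens K H H y1 (ra h1 y2))))"
      using inv[OF lh] tensor_lift_tens[OF module_H module_H X T lh] by simp
    also have "\<dots> = sw X h (\<lambda>h1 h2. sw X (ra l h2) (\<lambda>y1 y2. ?\<phi> (tens K H H y1 (ra h1 y2))))"
      by (rule linear_map_sw2[OF _ _ _ \<phi>]) (use lh X in auto)
    also have "\<dots> = sw X h (\<lambda>h1 h2. sw X (ra l h2) (\<lambda>y1 y2. T y1 (ra h1 y2)))"
      by (intro sw_cong tensor_lift_tens[OF _ _ X T])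
        (use lh X in \<open>auto intro!: sw_closed bilinear_map_closed[OF T]\<close>)
    finally show ?thesis ..
  qed
  have counit_inv: "sw KK h (\<lambda>h1 h2. \<xi> (ra l h2) h1) = counit H l \<otimes>\<^bsub>K\<^esub> counit H h"
    if lh: "l \<in> carrier H" "h \<in> carrier H" for l h
  proof -
    have "sw KK h (\<lambda>h1 h2. \<xi> (ra l h2) h1)
        = sw KK h (\<lambda>h1 h2. sw KK (ra l h2) (\<lambda>y1 y2. counit H y1 \<odot>\<^bsub>KK\<^esub> \<xi> y2 h1))"
      by (intro sw_cong sw_counit_left[symmetric]) (use lh in \<open>auto intro!: form_lin lin sw_scalar_closed\<close>)
    also have "\<dots> = sw KK h (\<lambda>h1 h2. sw KK (ra l h2) (\<lambda>y1 y2. counit H y1 \<otimes>\<^bsub>K\<^esub> counit H (ra h1 y2)))"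
      by (simp add: \<xi>_def)
    also have "\<dots> = counit H l \<otimes>\<^bsub>K\<^esub> counit H h"
      by (intro inv_lift bilinear_mapI) (use lh in \<open>auto intro!: lin\<close>)
    finally show ?thesis .
  qed
  show ra_eq: "ra l h = sw H l (\<lambda>a b. \<xi> h b \<odot>\<^bsub>H\<^esub> a)" if hl: "h \<in> carrier H" "l \<in> carrier H" for h l
  proof -
    have "sw H l (\<lambda>a b. \<xi> h b \<odot>\<^bsub>H\<^esub> a)
        = sw H h (\<lambda>h1 h2. sw H (ra l h2) (\<lambda>y1 y2. sw H y1 (\<lambda>a b. \<xi> (ra h1 y2) b \<odot>\<^bsub>H\<^esub> a)))"
      by (intro inv_lift[symmetric] bilinear_mapI) (use hl in \<open>auto intro!: lin form_lin\<close>)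
    also have "\<dots> = sw H h (\<lambda>h1 h2. sw H (ra l h2) (\<lambda>a y. sw H y (\<lambda>b y2. \<xi> (ra h1 y2) b \<odot>\<^bsub>H\<^esub> a)))"
      by (intro sw_cong sw_coassoc) (use hl in \<open>auto intro!: lin form_lin ra_lin sw_closed\<close>)
    also have "\<dots> = sw H h (\<lambda>h1 h2. sw H (ra l h2) (\<lambda>a y. sw KK y (\<lambda>b y2. \<xi> (ra h1 y2) b) \<odot>\<^bsub>H\<^esub> a))"
      by (intro sw_cong sw_scalar_right) (use hl in \<open>auto intro!: sw_closed sw_scalar_closed\<close>)
    also have "\<dots> = sw H h (\<lambda>h1 h2. sw H (ra l h2) (\<lambda>a y. counit H y \<odot>\<^bsub>H\<^esub> (counit H h1 \<odot>\<^bsub>H\<^esub> a)))"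
      by (intro sw_cong)
        (use hl in \<open>auto simp: counit_inv smult_assoc1[symmetric] m_comm intro!: sw_closed\<close>)
    also have "\<dots> = sw H h (\<lambda>h1 h2. counit H h1 \<odot>\<^bsub>H\<^esub> ra l h2)"
      by (intro sw_cong sw_counit_right) (use hl in \<open>auto intro!: lin\<close>)
    also have "\<dots> = ra l h"
      by (rule sw_counit_left) (use hl in \<open>auto intro!: lin ra_lin\<close>)
    finally show ?thesis ..
  qed
  show "symmetric_form K H \<xi>"
  proof
    fix l h assume lh: "l \<in> carrier H" "h \<in> carrier H"
    have "sw KK l (\<lambda>l1 l2. sw KK h (\<lambda>h1 h2. \<xi> l1 h1 \<otimes>\<^bsub>K\<^esub> \<xi> h2 l2))
        = sw KK h (\<lambda>h1 h2. sw KK l (\<lambda>l1 l2. \<xi> l1 h1 \<otimes>\<^bsub>K\<^esub> \<xi> h2 l2))"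
      by (rule sw_swap) (use lh in auto)
    also have "\<dots> = sw KK h (\<lambda>h1 h2. \<xi> (ra l h2) h1)"
    proof (intro sw_cong)
      fix h1 h2 assume h12: "h1 \<in> carrier H" "h2 \<in> carrier H"
      have "\<xi> (ra l h2) h1 = \<xi> (sw H l (\<lambda>a b. \<xi> h2 b \<odot>\<^bsub>H\<^esub> a)) h1"
        using ra_eq h12 lh by simp
      also have "\<dots> = sw KK l (\<lambda>a b. \<xi> (\<xi> h2 b \<odot>\<^bsub>H\<^esub> a) h1)"
        by (rule linear_map_sw[where \<phi> = "\<lambda>x. \<xi> x h1"]) (use h12 lh in \<open>auto intro!: form_lin lin\<close>)
      also have "\<dots> = sw KK l (\<lambda>l1 l2. \<xi> l1 h1 \<otimes>\<^bsub>K\<^esub> \<xi> h2 l2)"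
        by (intro sw_cong)
          (use h12 lh in \<open>auto simp: linear_map_smult[OF bilinear_map_left[OF form_bilinear']] m_comm\<close>)
      finally show "sw KK l (\<lambda>l1 l2. \<xi> l1 h1 \<otimes>\<^bsub>K\<^esub> \<xi> h2 l2) = \<xi> (ra l h2) h1" ..
    qed (use lh in auto)
    also have "\<dots> = counit H l \<otimes>\<^bsub>K\<^esub> counit H h" by (rule counit_inv[OF lh])
    finally show "sw KK l (\<lambda>l1 l2. sw KK h (\<lambda>h1 h2. \<xi> l1 h1 \<otimes>\<^bsub>K\<^esub> \<xi> h2 l2)) = counit H l \<otimes>\<^bsub>K\<^esub> counit H h" .
  qed
qed

end

section \<open>The structure maps of the tensor square\<close>

lemma square_ydl_simps [simp]:
  "carrier (square_ydl K H la ra) = carrier (tensor_space K H H)"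
  "add (square_ydl K H la ra) = add (tensor_space K H H)"
  "smult (square_ydl K H la ra) = smult (tensor_space K H H)"
  "lact (square_ydl K H la ra) = (\<lambda>h t. tensor_lift K (tensor_space K H H) t (\<lambda>k l. tens K H H (la h k) l))"
  "ract (square_ydl K H la ra) = (\<lambda>t h. tensor_lift K (tensor_space K H H) t (\<lambda>k l. tens K H H k (ra l h)))"
  "lcoact (square_ydl K H la ra) = (\<lambda>t. tensor_lift K (tensor_space K H (tensor_space K H H)) t (\<lambda>k l.
      tensor_lift K (tensor_space K H (tensor_space K H H)) (comult H k) (\<lambda>k1 k2.
        tens K H (tensor_space K H H) k1 (tens K H H k2 l))))"
  "rcoact (square_ydl K H la ra) = (\<lambda>t. tensor_lift K (tensor_space K (tensor_space K H H) H) t (\<lambda>k l.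
      tensor_lift K (tensor_space K (tensor_space K H H) H) (comult H l) (\<lambda>l1 l2.
        tens K (tensor_space K H H) H (tens K H H k l1) l2)))"
  by (simp_all add: square_ydl_def module.extend_def ydl.fields_def)

text \<open>A tensor product depends only on the vector space part of its factors. So the record
  \<^const>\<open>square_ydl\<close> can be replaced by the plain vector space \<open>H \<otimes> H\<close>.\<close>

lemma tensor_space_cong:
  assumes "carrier V = carrier V'" "add V = add V'" "smult V = smult V'"
    and "carrier W = carrier W'" "add W = add W'" "smult W = smult W'"
  shows "tensor_space K V W = tensor_space K V' W'" and "tens K V W = tens K V' W'"
proof -
  have "tensor_null K V W = tensor_null K V' W'"
    unfolding tensor_null_def tensor_relations_def using assms by simp
  then show "tensor_space K V W = tensor_space K V' W'" "tens K V W = tens K V' W'"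
    using assms by (simp_all add: tensor_space_def tens_def fun_eq_iff)
qed

lemma tensor_space_square_ydl:
  "tensor_space K (square_ydl K H la ra) W = tensor_space K (tensor_space K H H) W"
  "tensor_space K V (square_ydl K H la ra) = tensor_space K V (tensor_space K H H)"
  "tens K (square_ydl K H la ra) W = tens K (tensor_space K H H) W"
  "tens K V (square_ydl K H la ra) = tens K V (tensor_space K H H)"
  by (rule tensor_space_cong; simp)+

lemma tensor_lift_linear_arg:
  assumes "module K V" "module K W" "module K X"
    and "\<And>v. v \<in> carrier V \<Longrightarrow> linear_map K W X (\<beta> v)"
    and "\<And>w. w \<in> carrier W \<Longrightarrow> linear_map K V X (\<lambda>v. \<beta> v w)"
    and "linear_map K U (tensor_space K V W) E"
  shows "linear_map K U X (\<lambda>u. tensor_lift K X (E u) \<beta>)"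
  by (rule linear_map_compose[OF tensor_lift_linear assms(6)]) (use assms in \<open>auto intro: bilinear_mapI\<close>)

text \<open>A left action \<open>\<rightharpoonup>\<close> (\<open>la\<close>) and a right action \<open>\<leftharpoonup>\<close> (\<open>ra\<close>) of \<open>H\<close> on itself. The
  compatibility with the coactions is assumed only where it is used.\<close>

locale hopf_actions = hopf_algebra K H
  for K :: "('k, 'r) ring_scheme" and H :: "('k, 'h, 'm) hopf_scheme" +
  fixes la ra :: "'h \<Rightarrow> 'h \<Rightarrow> 'h"
  assumes la_action: "left_action K H H la" and ra_action: "right_action K H H ra"
begin

abbreviation M where "M \<equiv> square_ydl K H la ra"
abbreviation HHH where "HHH \<equiv> tensor_space K H HH"
abbreviation HHH' where "HHH' \<equiv> tensor_space K HH H"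
abbreviation H4 where "H4 \<equiv> tensor_space K HH HH"
abbreviation "\<psi> \<equiv> ydl_braiding K M M"

lemma la_bilinear: "bilinear_map K H H H la"
  and la_one: "k \<in> carrier H \<Longrightarrow> la \<one>\<^bsub>H\<^esub> k = k"
  and la_mult: "\<lbrakk>h \<in> carrier H; g \<in> carrier H; k \<in> carrier H\<rbrakk> \<Longrightarrow> la (h \<otimes>\<^bsub>H\<^esub> g) k = la h (la g k)"
  using la_action unfolding left_action_def by auto

lemma ra_bilinear: "bilinear_map K H H H ra"
  and ra_one: "k \<in> carrier H \<Longrightarrow> ra k \<one>\<^bsub>H\<^esub> = k"
  and ra_mult: "\<lbrakk>h \<in> carrier H; g \<in> carrier H; k \<in> carrier H\<rbrakk> \<Longrightarrow> ra k (h \<otimes>\<^bsub>H\<^esub> g) = ra (ra k h) g"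
  using ra_action unfolding right_action_def by auto

lemma la_closed [simp, intro]: "a \<in> carrier H \<Longrightarrow> b \<in> carrier H \<Longrightarrow> la a b \<in> carrier H"
  by (rule bilinear_map_closed[OF la_bilinear])

lemma ra_closed [simp, intro]: "a \<in> carrier H \<Longrightarrow> b \<in> carrier H \<Longrightarrow> ra a b \<in> carrier H"
  by (rule bilinear_map_closed[OF ra_bilinear])

lemmas act_lin =
  bilinear_map_compose_left[OF la_bilinear] bilinear_map_compose_right[OF la_bilinear]
  bilinear_map_compose_left[OF ra_bilinear] bilinear_map_compose_right[OF ra_bilinear]

lemma lact_bilinear: "bilinear_map K H HH HH (lact M)"
  by (intro bilinear_mapI)
    (auto intro!: tensor_lift_linear_arg[of _ H H] linear_map_lift_integrand[of _ H H] lin act_lin)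

lemma ract_bilinear: "bilinear_map K HH H HH (ract M)"
  by (intro bilinear_mapI)
    (auto intro!: tensor_lift_linear_arg[of _ H H] linear_map_lift_integrand[of _ H H] lin act_lin)

lemma lcoact_linear: "linear_map K HH HHH (lcoact M)"
  by (auto intro!: tensor_lift_linear_arg[of _ H H] lin)

lemma rcoact_linear: "linear_map K HH HHH' (rcoact M)"
  by (auto intro!: tensor_lift_linear_arg[of _ H H] lin)

lemma lact_tens: "\<lbrakk>h \<in> carrier H; k \<in> carrier H; l \<in> carrier H\<rbrakk> \<Longrightarrow>
    lact M h (tens K H H k l) = tens K H H (la h k) l"
  by (simp, subst tensor_lift_tens[of _ H H]) (auto intro!: bilinear_mapI lin act_lin)

lemma ract_tens: "\<lbrakk>h \<in> carrier H; k \<in> carrier H; l \<in> carrier H\<rbrakk> \<Longrightarrow>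
    ract M (tens K H H k l) h = tens K H H k (ra l h)"
  by (simp, subst tensor_lift_tens[of _ H H]) (auto intro!: bilinear_mapI lin act_lin)

lemma lcoact_tens: "\<lbrakk>k \<in> carrier H; l \<in> carrier H\<rbrakk> \<Longrightarrow>
    lcoact M (tens K H H k l) = sw HHH k (\<lambda>k1 k2. tens K H HH k1 (tens K H H k2 l))"
  by (simp, subst tensor_lift_tens[of _ H H]) (auto intro!: bilinear_mapI lin)

lemma rcoact_tens: "\<lbrakk>k \<in> carrier H; l \<in> carrier H\<rbrakk> \<Longrightarrow>
    rcoact M (tens K H H k l) = sw HHH' l (\<lambda>l1 l2. tens K HH H (tens K H H k l1) l2)"
  by (simp, subst tensor_lift_tens[of _ H H]) (auto intro!: bilinear_mapI lin)

lemma tensor_lift_lcoact_tens: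
  assumes kl: "k \<in> carrier H" "l \<in> carrier H" and X: "module K X" and \<beta>: "bilinear_map K H HH X \<beta>"
  shows "tensor_lift K X (lcoact M (tens K H H k l)) \<beta> = sw X k (\<lambda>k1 k2. \<beta> k1 (tens K H H k2 l))"
proof -
  note lift = tensor_lift_linear[OF module_H _ X \<beta>]
  have "tensor_lift K X (lcoact M (tens K H H k l)) \<beta>
      = sw X k (\<lambda>k1 k2. tensor_lift K X (tens K H HH k1 (tens K H H k2 l)) \<beta>)"
    unfolding lcoact_tens[OF kl] by (rule linear_map_sw[OF _ _ _ lift]) (use kl X in auto)
  also have "\<dots> = sw X k (\<lambda>k1 k2. \<beta> k1 (tens K H H k2 l))"
    by (intro sw_cong tensor_lift_tens[OF _ _ X \<beta>])
      (use kl X in \<open>auto intro: bilinear_map_closed[OF \<beta>]\<close>)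
  finally show ?thesis .
qed

lemma tensor_lift_rcoact_tens:
  assumes kl: "k \<in> carrier H" "l \<in> carrier H" and X: "module K X" and \<beta>: "bilinear_map K HH H X \<beta>"
  shows "tensor_lift K X (rcoact M (tens K H H k l)) \<beta> = sw X l (\<lambda>l1 l2. \<beta> (tens K H H k l1) l2)"
proof -
  note lift = tensor_lift_linear[OF _ module_H X \<beta>]
  have "tensor_lift K X (rcoact M (tens K H H k l)) \<beta>
      = sw X l (\<lambda>l1 l2. tensor_lift K X (tens K HH H (tens K H H k l1) l2) \<beta>)"
    unfolding rcoact_tens[OF kl] by (rule linear_map_sw[OF _ _ _ lift]) (use kl X in auto)
  also have "\<dots> = sw X l (\<lambda>l1 l2. \<beta> (tens K H H k l1) l2)"
    by (intro sw_cong tensor_lift_tens[OF _ _ X \<beta>])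
      (use kl X in \<open>auto intro: bilinear_map_closed[OF \<beta>]\<close>)
  finally show ?thesis .
qed

lemmas M_lin =
  bilinear_map_compose_left[OF lact_bilinear] bilinear_map_compose_right[OF lact_bilinear]
  bilinear_map_compose_left[OF ract_bilinear] bilinear_map_compose_right[OF ract_bilinear]
  linear_map_compose[OF lcoact_linear] linear_map_compose[OF rcoact_linear]

lemmas M_closed [simp] = bilinear_map_closed[OF lact_bilinear] bilinear_map_closed[OF ract_bilinear]
  linear_map_closed[OF lcoact_linear] linear_map_closed[OF rcoact_linear]

\<comment> \<open>From here on the structure maps are used only through the rules above.\<close>
declare square_ydl_simps(4-7) [simp del]

lemma braiding_integrand_bilinear:
  "bilinear_map K HH HH H4 (\<lambda>m n. tensor_lift K H4 (lcoact M m) (\<lambda>a m0.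
     tensor_lift K H4 (rcoact M n) (\<lambda>n0 b. tens K HH HH (lact M a n0) (ract M m0 b))))"
  by (intro bilinear_mapI)
    (auto intro!: tensor_lift_linear_arg[of _ H HH] linear_map_lift_integrand[of _ H HH]
      tensor_lift_linear_arg[of _ HH H] linear_map_lift_integrand[of _ HH H] lin M_lin)

text \<open>Here and below, \<open>M \<otimes> M\<close> is written as the tensor square \<open>H4\<close> of the plain vector space
  \<open>H \<otimes> H\<close>.\<close>

lemma braiding_eq:
  "\<psi> t = tensor_lift K H4 t (\<lambda>m n. tensor_lift K H4 (lcoact M m) (\<lambda>a m0.
     tensor_lift K H4 (rcoact M n) (\<lambda>n0 b. tens K HH HH (lact M a n0) (ract M m0 b))))"
  by (simp add: ydl_braiding_def tensor_space_square_ydl)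

lemma braiding_linear: "linear_map K H4 H4 \<psi>"
  unfolding braiding_eq
  by (rule tensor_lift_linear) (auto intro: braiding_integrand_bilinear)

lemma braiding_tens:
  assumes klgh: "k \<in> carrier H" "l \<in> carrier H" "g \<in> carrier H" "h \<in> carrier H"
  shows "\<psi> (tens K HH HH (tens K H H k l) (tens K H H g h))
    = sw H4 k (\<lambda>k1 k2. sw H4 h (\<lambda>h1 h2.
        tens K HH HH (tens K H H (la k1 g) h1) (tens K H H k2 (ra l h2))))"
proof -
  have "\<psi> (tens K HH HH (tens K H H k l) (tens K H H g h))
      = tensor_lift K H4 (lcoact M (tens K H H k l)) (\<lambda>a m0.
          tensor_lift K H4 (rcoact M (tens K H H g h)) (\<lambda>n0 b. tens K HH HH (lact M a n0) (ract M m0 b)))"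
    unfolding braiding_eq
    by (rule tensor_lift_tens[OF _ _ _ braiding_integrand_bilinear]) (use klgh in auto)
  also have "\<dots> = sw H4 k (\<lambda>k1 k2. tensor_lift K H4 (rcoact M (tens K H H g h)) (\<lambda>n0 b.
      tens K HH HH (lact M k1 n0) (ract M (tens K H H k2 l) b)))"
    by (rule tensor_lift_lcoact_tens)
      (use klgh in \<open>auto intro!: bilinear_mapI linear_map_lift_integrand[of _ HH H] lin M_lin\<close>)
  also have "\<dots> = sw H4 k (\<lambda>k1 k2. sw H4 h (\<lambda>h1 h2.
      tens K HH HH (lact M k1 (tens K H H g h1)) (ract M (tens K H H k2 l) h2)))"
    by (intro sw_cong tensor_lift_rcoact_tens bilinear_mapI)
      (use klgh in \<open>auto intro!: sw_closed lin M_lin\<close>)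
  also have "\<dots> = sw H4 k (\<lambda>k1 k2. sw H4 h (\<lambda>h1 h2.
        tens K HH HH (tens K H H (la k1 g) h1) (tens K H H k2 (ra l h2))))"
    by (intro sw_cong) (use klgh in \<open>auto intro!: sw_closed simp: lact_tens ract_tens\<close>)
  finally show ?thesis .
qed

text \<open>The square of the braiding acts on the first and third factor through \<open>\<rightharpoonup>\<close>, by the square of
  \<open>k \<otimes> g \<mapsto> (k\<^sub>1 \<rightharpoonup> g) \<otimes> k\<^sub>2\<close>, and on the second and fourth through \<open>\<leftharpoonup>\<close>, by the square of
  \<open>l \<otimes> h \<mapsto> h\<^sub>1 \<otimes> (l \<leftharpoonup> h\<^sub>2)\<close>.\<close>

lemma braiding_squared_tens:
  assumes klgh: "k \<in> carrier H" "l \<in> carrier H" "g \<in> carrier H" "h \<in> carrier H"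
  shows "\<psi> (\<psi> (tens K HH HH (tens K H H k l) (tens K H H g h)))
    = sw H4 k (\<lambda>k1 k2. sw H4 h (\<lambda>h1 h2. sw H4 (la k1 g) (\<lambda>z1 z2. sw H4 (ra l h2) (\<lambda>y1 y2.
        tens K HH HH (tens K H H (la z1 k2) y1) (tens K H H z2 (ra h1 y2))))))"
proof -
  have "\<psi> (\<psi> (tens K HH HH (tens K H H k l) (tens K H H g h)))
      = sw H4 k (\<lambda>k1 k2. \<psi> (sw H4 h (\<lambda>h1 h2.
          tens K HH HH (tens K H H (la k1 g) h1) (tens K H H k2 (ra l h2)))))"
    unfolding braiding_tens[OF klgh]
    by (rule linear_map_sw[OF _ _ _ braiding_linear]) (use klgh in \<open>auto intro!: sw_closed\<close>)
  also have "\<dots> = sw H4 k (\<lambda>k1 k2. sw H4 h (\<lambda>h1 h2.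
      \<psi> (tens K HH HH (tens K H H (la k1 g) h1) (tens K H H k2 (ra l h2)))))"
    by (intro sw_cong linear_map_sw[OF _ _ _ braiding_linear])
      (use klgh in \<open>auto intro!: sw_closed linear_map_closed[OF braiding_linear]\<close>)
  also have "\<dots> = sw H4 k (\<lambda>k1 k2. sw H4 h (\<lambda>h1 h2. sw H4 (la k1 g) (\<lambda>z1 z2. sw H4 (ra l h2) (\<lambda>y1 y2.
        tens K HH HH (tens K H H (la z1 k2) y1) (tens K H H z2 (ra h1 y2))))))"
    by (intro sw_cong) (use klgh in \<open>auto intro!: sw_closed simp: braiding_tens\<close>)
  finally show ?thesis .
qed

section \<open>Symmetry of the braiding\<close>

text \<open>The maps \<open>\<epsilon> \<otimes> id\<close> and \<open>id \<otimes> \<epsilon>\<close> from \<open>H \<otimes> H\<close> to \<open>H\<close>.\<close>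

lemma counit_left_leg_linear: "linear_map K HH H (\<lambda>t. tensor_lift K H t (\<lambda>a c. counit H a \<odot>\<^bsub>H\<^esub> c))"
  and counit_right_leg_linear: "linear_map K HH H (\<lambda>t. tensor_lift K H t (\<lambda>a c. counit H c \<odot>\<^bsub>H\<^esub> a))"
  by (auto intro!: tensor_lift_linear bilinear_mapI lin)

lemma counit_leg_tens:
  assumes "a \<in> carrier H" "c \<in> carrier H"
  shows "tensor_lift K H (tens K H H a c) (\<lambda>a c. counit H a \<odot>\<^bsub>H\<^esub> c) = counit H a \<odot>\<^bsub>H\<^esub> c"
    and "tensor_lift K H (tens K H H a c) (\<lambda>a c. counit H c \<odot>\<^bsub>H\<^esub> a) = counit H c \<odot>\<^bsub>H\<^esub> a"
  by (subst tensor_lift_tens[of _ H H]; use assms in \<open>auto intro!: bilinear_mapI lin\<close>)+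

text \<open>The map \<open>r \<otimes> r\<close>, for a linear map \<open>r\<close> from \<open>H \<otimes> H\<close> to \<open>H\<close>.\<close>

lemma tensor_square_lift:
  assumes r: "linear_map K HH H r"
  shows "linear_map K H4 HH (\<lambda>t. tensor_lift K HH t (\<lambda>m n. tens K H H (r m) (r n)))"
    and "\<lbrakk>m \<in> carrier HH; n \<in> carrier HH\<rbrakk> \<Longrightarrow>
      tensor_lift K HH (tens K HH HH m n) (\<lambda>m n. tens K H H (r m) (r n)) = tens K H H (r m) (r n)"
proof -
  have bil: "bilinear_map K HH HH HH (\<lambda>m n. tens K H H (r m) (r n))"
    by (intro bilinear_mapI) (auto intro!: lin r linear_map_closed[OF r])
  show "linear_map K H4 HH (\<lambda>t. tensor_lift K HH t (\<lambda>m n. tens K H H (r m) (r n)))"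
    by (rule tensor_lift_linear) (use bil in auto)
  show "\<lbrakk>m \<in> carrier HH; n \<in> carrier HH\<rbrakk> \<Longrightarrow>
      tensor_lift K HH (tens K HH HH m n) (\<lambda>m n. tens K H H (r m) (r n)) = tens K H H (r m) (r n)"
    by (rule tensor_lift_tens) (use bil in auto)
qed

lemma counit2_linear: "linear_map K HH KK (counit2 K H)"
  unfolding counit2_def by (rule tensor_lift_linear) (auto intro!: bilinear_mapI lin)

lemma counit2_tens:
  "\<lbrakk>a \<in> carrier H; b \<in> carrier H\<rbrakk> \<Longrightarrow> counit2 K H (tens K H H a b) = counit H a \<otimes>\<^bsub>K\<^esub> counit H b"
  unfolding counit2_def by (subst tensor_lift_tens[of _ H H]) (auto intro!: bilinear_mapI lin)

lemma counit2_closed [simp, intro]: "t \<in> carrier HH \<Longrightarrow> counit2 K H t \<in> carrier K"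
  using linear_map_closed[OF counit2_linear] by simp

lemma counit4_bilinear: "bilinear_map K HH HH KK (\<lambda>x y. counit2 K H x \<otimes>\<^bsub>K\<^esub> counit2 K H y)"
  by (intro bilinear_mapI) (auto intro!: lin counit2_linear)

lemma counit4_linear: "linear_map K H4 KK (counit4 K H)"
  unfolding counit4_def by (rule tensor_lift_linear) (use counit4_bilinear in auto)

lemma counit4_tens:
  "\<lbrakk>a \<in> carrier H; b \<in> carrier H; c \<in> carrier H; d \<in> carrier H\<rbrakk> \<Longrightarrow>
    counit4 K H (tens K HH HH (tens K H H a b) (tens K H H c d))
      = (counit H a \<otimes>\<^bsub>K\<^esub> counit H b) \<otimes>\<^bsub>K\<^esub> (counit H c \<otimes>\<^bsub>K\<^esub> counit H d)"
  unfolding counit4_def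
  by (subst tensor_lift_tens[OF _ _ _ counit4_bilinear]) (auto simp: counit2_tens)

lemma counit4_braiding:
  assumes klgh: "k \<in> carrier H" "l \<in> carrier H" "g \<in> carrier H" "h \<in> carrier H"
  shows "counit4 K H (\<psi> (tens K HH HH (tens K H H k l) (tens K H H g h)))
    = counit H (la k g) \<otimes>\<^bsub>K\<^esub> counit H (ra l h)"
proof -
  have "counit4 K H (\<psi> (tens K HH HH (tens K H H k l) (tens K H H g h)))
      = sw KK k (\<lambda>k1 k2. sw KK h (\<lambda>h1 h2.
          counit4 K H (tens K HH HH (tens K H H (la k1 g) h1) (tens K H H k2 (ra l h2)))))"
    unfolding braiding_tens[OF klgh]
    by (rule linear_map_sw2[OF _ _ _ counit4_linear]) (use klgh in auto)
  also have "\<dots> = sw KK k (\<lambda>k1 k2. sw KK h (\<lambda>h1 h2.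
      counit H h1 \<odot>\<^bsub>KK\<^esub> (counit H k2 \<otimes>\<^bsub>K\<^esub> (counit H (la k1 g) \<otimes>\<^bsub>K\<^esub> counit H (ra l h2)))))"
    by (intro sw_cong) (use klgh in \<open>auto intro!: sw_scalar_closed simp: counit4_tens scalar_ac\<close>)
  also have "\<dots> = sw KK k (\<lambda>k1 k2. counit H k2 \<odot>\<^bsub>KK\<^esub> (counit H (la k1 g) \<otimes>\<^bsub>K\<^esub> counit H (ra l h)))"
    unfolding regular_module_simps(4)
    by (intro sw_cong sw_counit_left[where X = KK, unfolded regular_module_simps(4)])
      (use klgh in \<open>auto intro!: lin act_lin\<close>)
  also have "\<dots> = counit H (la k g) \<otimes>\<^bsub>K\<^esub> counit H (ra l h)"
    by (rule sw_counit_right) (use klgh in \<open>auto intro!: lin act_lin\<close>)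
  finally show ?thesis .
qed

text \<open>Inserting units in the second and fourth tensor factor, and applying the counit there,
  isolates the part of the squared braiding that comes from \<open>\<rightharpoonup>\<close>. The same in the first and third
  factor isolates the part that comes from \<open>\<leftharpoonup>\<close>.\<close>

lemma involutive_left_of_symmetry:
  assumes sym: "\<And>t. t \<in> carrier H4 \<Longrightarrow> \<psi> (\<psi> t) = t" and kg: "k \<in> carrier H" "g \<in> carrier H"
  shows "sw HH k (\<lambda>k1 k2. sw HH (la k1 g) (\<lambda>z1 z2. tens K H H (la z1 k2) z2)) = tens K H H k g"
proof -
  let ?one = "\<one>\<^bsub>H\<^esub>"
  let ?r = "\<lambda>t. tensor_lift K H t (\<lambda>a c. counit H c \<odot>\<^bsub>H\<^esub> a)"
  let ?R = "\<lambda>t. tensor_lift K HH t (\<lambda>m n. tens K H H (?r m) (?r n))"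
  note R = tensor_square_lift[OF counit_right_leg_linear]
  have R_tens: "?R (tens K HH HH (tens K H H a ?one) (tens K H H b ?one)) = tens K H H a b"
    if "a \<in> carrier H" "b \<in> carrier H" for a b
    using that by (simp add: R(2) counit_leg_tens counit_one)
  have "tens K HH HH (tens K H H k ?one) (tens K H H g ?one)
      = sw H4 k (\<lambda>k1 k2. sw H4 ?one (\<lambda>h1 h2. sw H4 (la k1 g) (\<lambda>z1 z2. sw H4 (ra ?one h2) (\<lambda>y1 y2.
          tens K HH HH (tens K H H (la z1 k2) y1) (tens K H H z2 (ra h1 y2))))))"
    using kg by (subst braiding_squared_tens[symmetric]) (auto simp: sym)
  also have "\<dots> = sw H4 k (\<lambda>k1 k2. sw H4 (la k1 g) (\<lambda>z1 z2. sw H4 (ra ?one ?one) (\<lambda>y1 y2.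
          tens K HH HH (tens K H H (la z1 k2) y1) (tens K H H z2 (ra ?one y2)))))"
    by (intro sw_cong sw_one bilinear_mapI) (use kg in \<open>auto intro!: sw_closed lin act_lin\<close>)
  also have "\<dots> = sw H4 k (\<lambda>k1 k2. sw H4 (la k1 g) (\<lambda>z1 z2. sw H4 ?one (\<lambda>y1 y2.
          tens K HH HH (tens K H H (la z1 k2) y1) (tens K H H z2 (ra ?one y2)))))"
    by (simp add: ra_one)
  also have "\<dots> = sw H4 k (\<lambda>k1 k2. sw H4 (la k1 g) (\<lambda>z1 z2.
          tens K HH HH (tens K H H (la z1 k2) ?one) (tens K H H z2 (ra ?one ?one))))"
    by (intro sw_cong sw_one bilinear_mapI) (use kg in \<open>auto intro!: sw_closed lin act_lin\<close>)
  also have "\<dots> = sw H4 k (\<lambda>k1 k2. sw H4 (la k1 g) (\<lambda>z1 z2.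
          tens K HH HH (tens K H H (la z1 k2) ?one) (tens K H H z2 ?one)))"
    by (simp add: ra_one)
  finally have "?R (tens K HH HH (tens K H H k ?one) (tens K H H g ?one)) = ?R \<dots>"
    by simp
  also have "\<dots> = sw HH k (\<lambda>k1 k2. sw HH (la k1 g) (\<lambda>z1 z2.
          ?R (tens K HH HH (tens K H H (la z1 k2) ?one) (tens K H H z2 ?one))))"
    by (rule linear_map_sw2[OF _ _ _ R(1)]) (use kg in auto)
  also have "\<dots> = sw HH k (\<lambda>k1 k2. sw HH (la k1 g) (\<lambda>z1 z2. tens K H H (la z1 k2) z2))"
    by (intro sw_cong) (use kg in \<open>auto intro!: sw_closed simp: R_tens\<close>)
  finally show ?thesis using kg by (simp add: R_tens)
qed

lemma involutive_right_of_symmetry: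
  assumes sym: "\<And>t. t \<in> carrier H4 \<Longrightarrow> \<psi> (\<psi> t) = t" and lh: "l \<in> carrier H" "h \<in> carrier H"
  shows "sw HH h (\<lambda>h1 h2. sw HH (ra l h2) (\<lambda>y1 y2. tens K H H y1 (ra h1 y2))) = tens K H H l h"
proof -
  let ?one = "\<one>\<^bsub>H\<^esub>"
  let ?r = "\<lambda>t. tensor_lift K H t (\<lambda>a c. counit H a \<odot>\<^bsub>H\<^esub> c)"
  let ?R = "\<lambda>t. tensor_lift K HH t (\<lambda>m n. tens K H H (?r m) (?r n))"
  note R = tensor_square_lift[OF counit_left_leg_linear]
  have R_tens: "?R (tens K HH HH (tens K H H ?one a) (tens K H H ?one b)) = tens K H H a b"
    if "a \<in> carrier H" "b \<in> carrier H" for a b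
    using that by (simp add: R(2) counit_leg_tens counit_one)
  have "tens K HH HH (tens K H H ?one l) (tens K H H ?one h)
      = sw H4 ?one (\<lambda>k1 k2. sw H4 h (\<lambda>h1 h2. sw H4 (la k1 ?one) (\<lambda>z1 z2. sw H4 (ra l h2) (\<lambda>y1 y2.
          tens K HH HH (tens K H H (la z1 k2) y1) (tens K H H z2 (ra h1 y2))))))"
    using lh by (subst braiding_squared_tens[symmetric]) (auto simp: sym)
  also have "\<dots> = sw H4 h (\<lambda>h1 h2. sw H4 (la ?one ?one) (\<lambda>z1 z2. sw H4 (ra l h2) (\<lambda>y1 y2.
          tens K HH HH (tens K H H (la z1 ?one) y1) (tens K H H z2 (ra h1 y2)))))"
    by (intro sw_one bilinear_mapI) (use lh in \<open>auto intro!: sw_closed lin act_lin\<close>)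
  also have "\<dots> = sw H4 h (\<lambda>h1 h2. sw H4 ?one (\<lambda>z1 z2. sw H4 (ra l h2) (\<lambda>y1 y2.
          tens K HH HH (tens K H H (la z1 ?one) y1) (tens K H H z2 (ra h1 y2)))))"
    by (simp add: la_one)
  also have "\<dots> = sw H4 h (\<lambda>h1 h2. sw H4 (ra l h2) (\<lambda>y1 y2.
          tens K HH HH (tens K H H (la ?one ?one) y1) (tens K H H ?one (ra h1 y2))))"
    by (intro sw_cong sw_one bilinear_mapI) (use lh in \<open>auto intro!: sw_closed lin act_lin\<close>)
  also have "\<dots> = sw H4 h (\<lambda>h1 h2. sw H4 (ra l h2) (\<lambda>y1 y2.
          tens K HH HH (tens K H H ?one y1) (tens K H H ?one (ra h1 y2))))"
    by (simp add: la_one)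
  finally have "?R (tens K HH HH (tens K H H ?one l) (tens K H H ?one h)) = ?R \<dots>"
    by simp
  also have "\<dots> = sw HH h (\<lambda>h1 h2. sw HH (ra l h2) (\<lambda>y1 y2.
          ?R (tens K HH HH (tens K H H ?one y1) (tens K H H ?one (ra h1 y2)))))"
    by (rule linear_map_sw2[OF _ _ _ R(1)]) (use lh in auto)
  also have "\<dots> = sw HH h (\<lambda>h1 h2. sw HH (ra l h2) (\<lambda>y1 y2. tens K H H y1 (ra h1 y2)))"
    by (intro sw_cong) (use lh in \<open>auto intro!: sw_closed simp: R_tens\<close>)
  finally show ?thesis using lh by (simp add: R_tens)
qed

lemma mult_left_of_la_eq:
  assumes bil: "bilinear_map K H H KK (\<lambda>h k. counit H (la h k))"
    and la_eq: "\<And>h k. h \<in> carrier H \<Longrightarrow> k \<in> carrier H \<Longrightarrow>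
      la h k = sw H k (\<lambda>a b. counit H (la h a) \<odot>\<^bsub>H\<^esub> b)"
    and hgl: "h \<in> carrier H" "g \<in> carrier H" "l \<in> carrier H"
  shows "counit H (la (h \<otimes>\<^bsub>H\<^esub> g) l) = sw KK l (\<lambda>l1 l2. counit H (la h l2) \<otimes>\<^bsub>K\<^esub> counit H (la g l1))"
proof -
  let ?\<phi> = "\<lambda>x. counit H (la h x)"
  have \<phi>: "linear_map K H KK ?\<phi>" by (rule bilinear_map_right[OF bil hgl(1)])
  have "counit H (la (h \<otimes>\<^bsub>H\<^esub> g) l) = ?\<phi> (sw H l (\<lambda>a b. counit H (la g a) \<odot>\<^bsub>H\<^esub> b))"
    using hgl by (simp add: la_mult flip: la_eq)
  also have "\<dots> = sw KK l (\<lambda>a b. ?\<phi> (counit H (la g a) \<odot>\<^bsub>H\<^esub> b))"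
    by (rule linear_map_sw[OF _ _ _ \<phi>]) (use hgl in auto)
  also have "\<dots> = sw KK l (\<lambda>l1 l2. ?\<phi> l2 \<otimes>\<^bsub>K\<^esub> counit H (la g l1))"
    by (intro sw_cong) (use hgl in \<open>auto simp: linear_map_smult[OF \<phi>] m_comm\<close>)
  finally show ?thesis .
qed

lemma mult_left_of_ra_eq:
  assumes bil: "bilinear_map K H H KK (\<lambda>h l. counit H (ra l h))"
    and ra_eq: "\<And>h l. h \<in> carrier H \<Longrightarrow> l \<in> carrier H \<Longrightarrow>
      ra l h = sw H l (\<lambda>a b. counit H (ra b h) \<odot>\<^bsub>H\<^esub> a)"
    and hgl: "h \<in> carrier H" "g \<in> carrier H" "l \<in> carrier H"
  shows "counit H (ra l (h \<otimes>\<^bsub>H\<^esub> g)) = sw KK l (\<lambda>l1 l2. counit H (ra l2 h) \<otimes>\<^bsub>K\<^esub> counit H (ra l1 g))"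
proof -
  let ?\<phi> = "\<lambda>x. counit H (ra x g)"
  have \<phi>: "linear_map K H KK ?\<phi>" by (rule bilinear_map_right[OF bil hgl(2)])
  have "counit H (ra l (h \<otimes>\<^bsub>H\<^esub> g)) = ?\<phi> (sw H l (\<lambda>a b. counit H (ra b h) \<odot>\<^bsub>H\<^esub> a))"
    using hgl by (simp add: ra_mult flip: ra_eq)
  also have "\<dots> = sw KK l (\<lambda>a b. ?\<phi> (counit H (ra b h) \<odot>\<^bsub>H\<^esub> a))"
    by (rule linear_map_sw[OF _ _ _ \<phi>]) (use hgl in auto)
  also have "\<dots> = sw KK l (\<lambda>l1 l2. counit H (ra l2 h) \<otimes>\<^bsub>K\<^esub> ?\<phi> l1)"
    by (intro sw_cong) (use hgl in \<open>auto simp: linear_map_smult[OF \<phi>]\<close>)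
  finally show ?thesis .
qed

text \<open>The compatibility of \<open>\<triangleright>\<close> with the left coaction at \<open>k \<otimes> 1\<close>, after the counit of \<open>H \<otimes> H\<close> is
  applied to the bimodule component: \<open>(h\<^sub>1 \<rightharpoonup> k) h\<^sub>2 = h\<^sub>1 k\<^sub>1 \<epsilon>(h\<^sub>2 \<rightharpoonup> k\<^sub>2)\<close>.\<close>

lemma la_compatible:
  assumes ydl: "ydl_bimodule K H M" and hk: "h \<in> carrier H" "k \<in> carrier H"
  shows "sw H h (\<lambda>h1 h2. la h1 k \<otimes>\<^bsub>H\<^esub> h2)
    = sw H h (\<lambda>h1 h2. sw H k (\<lambda>k1 k2. counit H (la h2 k2) \<odot>\<^bsub>H\<^esub> (h1 \<otimes>\<^bsub>H\<^esub> k1)))"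
proof -
  let ?m = "tens K H H k \<one>\<^bsub>H\<^esub>"
  let ?\<phi> = "\<lambda>t. tensor_lift K H t (\<lambda>a m. counit2 K H m \<odot>\<^bsub>H\<^esub> a)"
  have bil: "bilinear_map K H HH H (\<lambda>a m. counit2 K H m \<odot>\<^bsub>H\<^esub> a)"
    by (intro bilinear_mapI) (auto intro!: lin counit2_linear)
  have \<phi>: "linear_map K HHH H ?\<phi>" by (rule tensor_lift_linear) (use bil in auto)
  have \<phi>_tens: "?\<phi> (tens K H HH a (tens K H H b \<one>\<^bsub>H\<^esub>)) = counit H b \<odot>\<^bsub>H\<^esub> a"
    if "a \<in> carrier H" "b \<in> carrier H" for a b
    using that by (subst tensor_lift_tens[OF _ _ _ bil]) (auto simp: counit2_tens counit_one)
  have m: "?m \<in> carrier HH" using hk by auto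
  have "sw HHH h (\<lambda>h1 h2. sw HHH (la h1 k) (\<lambda>x1 x2. tens K H HH (x1 \<otimes>\<^bsub>H\<^esub> h2) (tens K H H x2 \<one>\<^bsub>H\<^esub>)))
      = sw HHH h (\<lambda>h1 h2. tensor_lift K HHH (lcoact M (lact M h1 ?m)) (\<lambda>a m0. tens K H HH (a \<otimes>\<^bsub>H\<^esub> h2) m0))"
  proof (rule sw_cong)
    fix h1 h2 assume h12: "h1 \<in> carrier H" "h2 \<in> carrier H"
    show "sw HHH (la h1 k) (\<lambda>x1 x2. tens K H HH (x1 \<otimes>\<^bsub>H\<^esub> h2) (tens K H H x2 \<one>\<^bsub>H\<^esub>))
        = tensor_lift K HHH (lcoact M (lact M h1 ?m)) (\<lambda>a m0. tens K H HH (a \<otimes>\<^bsub>H\<^esub> h2) m0)"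
      unfolding lact_tens[OF h12(1) hk(2) H.one_closed]
      by (rule tensor_lift_lcoact_tens[symmetric]) (use h12 hk in \<open>auto intro!: bilinear_mapI lin\<close>)
    show "tensor_lift K HHH (lcoact M (lact M h1 ?m)) (\<lambda>a m0. tens K H HH (a \<otimes>\<^bsub>H\<^esub> h2) m0) \<in> carrier HHH"
      by (rule tensor_lift_closed[of _ H HH]) (use h12 m in auto)
  qed (use hk in auto)
  also have "\<dots> = sw HHH h (\<lambda>h1 h2. tensor_lift K HHH (lcoact M ?m) (\<lambda>a m0. tens K H HH (h1 \<otimes>\<^bsub>H\<^esub> a) (lact M h2 m0)))"
    using ydl_bimodule.lact_lcoact[OF ydl, of h ?m] hk m by (simp add: tensor_space_square_ydl)
  also have "\<dots> = sw HHH h (\<lambda>h1 h2. sw HHH k (\<lambda>k1 k2. tens K H HH (h1 \<otimes>\<^bsub>H\<^esub> k1) (tens K H H (la h2 k2) \<one>\<^bsub>H\<^esub>)))"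
  proof (rule sw_cong)
    fix h1 h2 assume h12: "h1 \<in> carrier H" "h2 \<in> carrier H"
    have "tensor_lift K HHH (lcoact M ?m) (\<lambda>a m0. tens K H HH (h1 \<otimes>\<^bsub>H\<^esub> a) (lact M h2 m0))
        = sw HHH k (\<lambda>k1 k2. tens K H HH (h1 \<otimes>\<^bsub>H\<^esub> k1) (lact M h2 (tens K H H k2 \<one>\<^bsub>H\<^esub>)))"
      by (rule tensor_lift_lcoact_tens) (use h12 hk in \<open>auto intro!: bilinear_mapI lin M_lin\<close>)
    also have "\<dots> = sw HHH k (\<lambda>k1 k2. tens K H HH (h1 \<otimes>\<^bsub>H\<^esub> k1) (tens K H H (la h2 k2) \<one>\<^bsub>H\<^esub>))"
      by (intro sw_cong) (use h12 hk in \<open>auto simp: lact_tens\<close>)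
    finally show "tensor_lift K HHH (lcoact M ?m) (\<lambda>a m0. tens K H HH (h1 \<otimes>\<^bsub>H\<^esub> a) (lact M h2 m0)) = \<dots>" .
  qed (use hk in \<open>auto intro!: sw_closed\<close>)
  finally have "?\<phi> (sw HHH h (\<lambda>h1 h2. sw HHH (la h1 k) (\<lambda>x1 x2. tens K H HH (x1 \<otimes>\<^bsub>H\<^esub> h2) (tens K H H x2 \<one>\<^bsub>H\<^esub>))))
      = ?\<phi> \<dots>" by simp
  moreover have "?\<phi> (sw HHH h (\<lambda>h1 h2. sw HHH (la h1 k) (\<lambda>x1 x2. tens K H HH (x1 \<otimes>\<^bsub>H\<^esub> h2) (tens K H H x2 \<one>\<^bsub>H\<^esub>))))
      = sw H h (\<lambda>h1 h2. la h1 k \<otimes>\<^bsub>H\<^esub> h2)"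
  proof -
    have "?\<phi> (sw HHH h (\<lambda>h1 h2. sw HHH (la h1 k) (\<lambda>x1 x2. tens K H HH (x1 \<otimes>\<^bsub>H\<^esub> h2) (tens K H H x2 \<one>\<^bsub>H\<^esub>))))
        = sw H h (\<lambda>h1 h2. sw H (la h1 k) (\<lambda>x1 x2. ?\<phi> (tens K H HH (x1 \<otimes>\<^bsub>H\<^esub> h2) (tens K H H x2 \<one>\<^bsub>H\<^esub>))))"
      by (rule linear_map_sw2[OF _ _ _ \<phi>]) (use hk in auto)
    also have "\<dots> = sw H h (\<lambda>h1 h2. sw H (la h1 k) (\<lambda>x1 x2. counit H x2 \<odot>\<^bsub>H\<^esub> (x1 \<otimes>\<^bsub>H\<^esub> h2)))"
      by (intro sw_cong) (use hk in \<open>auto simp: \<phi>_tens intro!: sw_closed\<close>)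
    also have "\<dots> = sw H h (\<lambda>h1 h2. la h1 k \<otimes>\<^bsub>H\<^esub> h2)"
      by (intro sw_cong sw_counit_right[where \<phi> = "\<lambda>x. x \<otimes>\<^bsub>H\<^esub> _"]) (use hk in \<open>auto intro!: lin\<close>)
    finally show ?thesis .
  qed
  moreover have "?\<phi> (sw HHH h (\<lambda>h1 h2. sw HHH k (\<lambda>k1 k2. tens K H HH (h1 \<otimes>\<^bsub>H\<^esub> k1) (tens K H H (la h2 k2) \<one>\<^bsub>H\<^esub>))))
      = sw H h (\<lambda>h1 h2. sw H k (\<lambda>k1 k2. counit H (la h2 k2) \<odot>\<^bsub>H\<^esub> (h1 \<otimes>\<^bsub>H\<^esub> k1)))"
  proof -
    have "?\<phi> (sw HHH h (\<lambda>h1 h2. sw HHH k (\<lambda>k1 k2. tens K H HH (h1 \<otimes>\<^bsub>H\<^esub> k1) (tens K H H (la h2 k2) \<one>\<^bsub>H\<^esub>))))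
        = sw H h (\<lambda>h1 h2. sw H k (\<lambda>k1 k2. ?\<phi> (tens K H HH (h1 \<otimes>\<^bsub>H\<^esub> k1) (tens K H H (la h2 k2) \<one>\<^bsub>H\<^esub>))))"
      by (rule linear_map_sw2[OF _ _ _ \<phi>]) (use hk in auto)
    also have "\<dots> = sw H h (\<lambda>h1 h2. sw H k (\<lambda>k1 k2. counit H (la h2 k2) \<odot>\<^bsub>H\<^esub> (h1 \<otimes>\<^bsub>H\<^esub> k1)))"
      by (intro sw_cong) (use hk in \<open>auto simp: \<phi>_tens intro!: sw_closed\<close>)
    finally show ?thesis .
  qed
  ultimately show ?thesis by simp
qed

text \<open>Likewise for \<open>\<triangleleft>\<close> and the right coaction at \<open>1 \<otimes> l\<close>:
  \<open>h\<^sub>1 (l \<leftharpoonup> h\<^sub>2) = \<epsilon>(l\<^sub>1 \<leftharpoonup> h\<^sub>1) l\<^sub>2 h\<^sub>2\<close>.\<close>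

lemma ra_compatible:
  assumes ydl: "ydl_bimodule K H M" and hl: "h \<in> carrier H" "l \<in> carrier H"
  shows "sw H h (\<lambda>h1 h2. h1 \<otimes>\<^bsub>H\<^esub> ra l h2)
    = sw H h (\<lambda>h1 h2. sw H l (\<lambda>l1 l2. counit H (ra l1 h1) \<odot>\<^bsub>H\<^esub> (l2 \<otimes>\<^bsub>H\<^esub> h2)))"
proof -
  let ?m = "tens K H H \<one>\<^bsub>H\<^esub> l"
  let ?\<phi> = "\<lambda>t. tensor_lift K H t (\<lambda>m a. counit2 K H m \<odot>\<^bsub>H\<^esub> a)"
  have bil: "bilinear_map K HH H H (\<lambda>m a. counit2 K H m \<odot>\<^bsub>H\<^esub> a)"
    by (intro bilinear_mapI) (auto intro!: lin counit2_linear)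
  have \<phi>: "linear_map K HHH' H ?\<phi>" by (rule tensor_lift_linear) (use bil in auto)
  have \<phi>_tens: "?\<phi> (tens K HH H (tens K H H \<one>\<^bsub>H\<^esub> b) a) = counit H b \<odot>\<^bsub>H\<^esub> a"
    if "a \<in> carrier H" "b \<in> carrier H" for a b
    using that by (subst tensor_lift_tens[OF _ _ _ bil]) (auto simp: counit2_tens counit_one)
  have m: "?m \<in> carrier HH" using hl by auto
  have "sw HHH' h (\<lambda>h1 h2. sw HHH' (ra l h2) (\<lambda>y1 y2. tens K HH H (tens K H H \<one>\<^bsub>H\<^esub> y1) (h1 \<otimes>\<^bsub>H\<^esub> y2)))
      = sw HHH' h (\<lambda>h1 h2. tensor_lift K HHH' (rcoact M (ract M ?m h2)) (\<lambda>m0 a. tens K HH H m0 (h1 \<otimes>\<^bsub>H\<^esub> a)))"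
  proof (rule sw_cong)
    fix h1 h2 assume h12: "h1 \<in> carrier H" "h2 \<in> carrier H"
    show "sw HHH' (ra l h2) (\<lambda>y1 y2. tens K HH H (tens K H H \<one>\<^bsub>H\<^esub> y1) (h1 \<otimes>\<^bsub>H\<^esub> y2))
        = tensor_lift K HHH' (rcoact M (ract M ?m h2)) (\<lambda>m0 a. tens K HH H m0 (h1 \<otimes>\<^bsub>H\<^esub> a))"
      unfolding ract_tens[OF h12(2) H.one_closed hl(2)]
      by (rule tensor_lift_rcoact_tens[symmetric]) (use h12 hl in \<open>auto intro!: bilinear_mapI lin\<close>)
    show "tensor_lift K HHH' (rcoact M (ract M ?m h2)) (\<lambda>m0 a. tens K HH H m0 (h1 \<otimes>\<^bsub>H\<^esub> a)) \<in> carrier HHH'"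
      by (rule tensor_lift_closed[of _ HH H]) (use h12 m in auto)
  qed (use hl in auto)
  also have "\<dots> = sw HHH' h (\<lambda>h1 h2. tensor_lift K HHH' (rcoact M ?m) (\<lambda>m0 a. tens K HH H (ract M m0 h1) (a \<otimes>\<^bsub>H\<^esub> h2)))"
    using ydl_bimodule.ract_rcoact[OF ydl, of h ?m] hl m by (simp add: tensor_space_square_ydl)
  also have "\<dots> = sw HHH' h (\<lambda>h1 h2. sw HHH' l (\<lambda>l1 l2. tens K HH H (tens K H H \<one>\<^bsub>H\<^esub> (ra l1 h1)) (l2 \<otimes>\<^bsub>H\<^esub> h2)))"
  proof (rule sw_cong)
    fix h1 h2 assume h12: "h1 \<in> carrier H" "h2 \<in> carrier H"
    have "tensor_lift K HHH' (rcoact M ?m) (\<lambda>m0 a. tens K HH H (ract M m0 h1) (a \<otimes>\<^bsub>H\<^esub> h2))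
        = sw HHH' l (\<lambda>l1 l2. tens K HH H (ract M (tens K H H \<one>\<^bsub>H\<^esub> l1) h1) (l2 \<otimes>\<^bsub>H\<^esub> h2))"
      by (rule tensor_lift_rcoact_tens) (use h12 hl in \<open>auto intro!: bilinear_mapI lin M_lin\<close>)
    also have "\<dots> = sw HHH' l (\<lambda>l1 l2. tens K HH H (tens K H H \<one>\<^bsub>H\<^esub> (ra l1 h1)) (l2 \<otimes>\<^bsub>H\<^esub> h2))"
      by (intro sw_cong) (use h12 hl in \<open>auto simp: ract_tens\<close>)
    finally show "tensor_lift K HHH' (rcoact M ?m) (\<lambda>m0 a. tens K HH H (ract M m0 h1) (a \<otimes>\<^bsub>H\<^esub> h2)) = \<dots>" .
  qed (use hl in \<open>auto intro!: sw_closed\<close>)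
  finally have "?\<phi> (sw HHH' h (\<lambda>h1 h2. sw HHH' (ra l h2) (\<lambda>y1 y2. tens K HH H (tens K H H \<one>\<^bsub>H\<^esub> y1) (h1 \<otimes>\<^bsub>H\<^esub> y2))))
      = ?\<phi> \<dots>" by simp
  moreover have "?\<phi> (sw HHH' h (\<lambda>h1 h2. sw HHH' (ra l h2) (\<lambda>y1 y2. tens K HH H (tens K H H \<one>\<^bsub>H\<^esub> y1) (h1 \<otimes>\<^bsub>H\<^esub> y2))))
      = sw H h (\<lambda>h1 h2. h1 \<otimes>\<^bsub>H\<^esub> ra l h2)"
  proof -
    have "?\<phi> (sw HHH' h (\<lambda>h1 h2. sw HHH' (ra l h2) (\<lambda>y1 y2. tens K HH H (tens K H H \<one>\<^bsub>H\<^esub> y1) (h1 \<otimes>\<^bsub>H\<^esub> y2))))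
        = sw H h (\<lambda>h1 h2. sw H (ra l h2) (\<lambda>y1 y2. ?\<phi> (tens K HH H (tens K H H \<one>\<^bsub>H\<^esub> y1) (h1 \<otimes>\<^bsub>H\<^esub> y2))))"
      by (rule linear_map_sw2[OF _ _ _ \<phi>]) (use hl in auto)
    also have "\<dots> = sw H h (\<lambda>h1 h2. sw H (ra l h2) (\<lambda>y1 y2. counit H y1 \<odot>\<^bsub>H\<^esub> (h1 \<otimes>\<^bsub>H\<^esub> y2)))"
      by (intro sw_cong) (use hl in \<open>auto simp: \<phi>_tens intro!: sw_closed\<close>)
    also have "\<dots> = sw H h (\<lambda>h1 h2. h1 \<otimes>\<^bsub>H\<^esub> ra l h2)"
      by (intro sw_cong sw_counit_left[where \<phi> = "\<lambda>x. _ \<otimes>\<^bsub>H\<^esub> x"]) (use hl in \<open>auto intro!: lin\<close>)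
    finally show ?thesis .
  qed
  moreover have "?\<phi> (sw HHH' h (\<lambda>h1 h2. sw HHH' l (\<lambda>l1 l2. tens K HH H (tens K H H \<one>\<^bsub>H\<^esub> (ra l1 h1)) (l2 \<otimes>\<^bsub>H\<^esub> h2))))
      = sw H h (\<lambda>h1 h2. sw H l (\<lambda>l1 l2. counit H (ra l1 h1) \<odot>\<^bsub>H\<^esub> (l2 \<otimes>\<^bsub>H\<^esub> h2)))"
  proof -
    have "?\<phi> (sw HHH' h (\<lambda>h1 h2. sw HHH' l (\<lambda>l1 l2. tens K HH H (tens K H H \<one>\<^bsub>H\<^esub> (ra l1 h1)) (l2 \<otimes>\<^bsub>H\<^esub> h2))))
        = sw H h (\<lambda>h1 h2. sw H l (\<lambda>l1 l2. ?\<phi> (tens K HH H (tens K H H \<one>\<^bsub>H\<^esub> (ra l1 h1)) (l2 \<otimes>\<^bsub>H\<^esub> h2))))"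
      by (rule linear_map_sw2[OF _ _ _ \<phi>]) (use hl in auto)
    also have "\<dots> = sw H h (\<lambda>h1 h2. sw H l (\<lambda>l1 l2. counit H (ra l1 h1) \<odot>\<^bsub>H\<^esub> (l2 \<otimes>\<^bsub>H\<^esub> h2)))"
      by (intro sw_cong) (use hl in \<open>auto simp: \<phi>_tens intro!: sw_closed\<close>)
    finally show ?thesis .
  qed
  ultimately show ?thesis by simp
qed

lemma cotriangular_of_symmetry:
  assumes sym: "\<And>t. t \<in> carrier H4 \<Longrightarrow> \<psi> (\<psi> t) = t" and ydl: "ydl_bimodule K H M"
  defines "\<zeta> \<equiv> \<lambda>h k. counit H (la h k)" and "\<xi> \<equiv> \<lambda>h l. counit H (ra l h)"
  shows "cotriangular_hopf_algebra K H \<zeta>" and "cotriangular_hopf_algebra K H \<xi>"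
    and "\<And>h k. h \<in> carrier H \<Longrightarrow> k \<in> carrier H \<Longrightarrow> la h k = sw H k (\<lambda>a b. \<zeta> h a \<odot>\<^bsub>H\<^esub> b)"
    and "\<And>h l. h \<in> carrier H \<Longrightarrow> l \<in> carrier H \<Longrightarrow> ra l h = sw H l (\<lambda>a b. \<xi> h b \<odot>\<^bsub>H\<^esub> a)"
proof -
  note left = symmetric_form_of_involutive_left[OF la_bilinear involutive_left_of_symmetry[OF sym]]
  note right = symmetric_form_of_involutive_right[OF ra_bilinear involutive_right_of_symmetry[OF sym]]
  show la_eq: "la h k = sw H k (\<lambda>a b. \<zeta> h a \<odot>\<^bsub>H\<^esub> b)" if "h \<in> carrier H" "k \<in> carrier H" for h k
    using left(2) that unfolding \<zeta>_def by blast
  show ra_eq: "ra l h = sw H l (\<lambda>a b. \<xi> h b \<odot>\<^bsub>H\<^esub> a)" if "h \<in> carrier H" "l \<in> carrier H" for h l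
    using right(2) that unfolding \<xi>_def by blast
  interpret L: symmetric_form K H \<zeta> unfolding \<zeta>_def by (rule left(1))
  interpret R: symmetric_form K H \<xi> unfolding \<xi>_def by (rule right(1))
  show "cotriangular_hopf_algebra K H \<zeta>"
  proof (rule L.cotriangular)
    show "\<zeta> (h \<otimes>\<^bsub>H\<^esub> g) l = sw KK l (\<lambda>l1 l2. \<zeta> h l2 \<otimes>\<^bsub>K\<^esub> \<zeta> g l1)"
      if "h \<in> carrier H" "g \<in> carrier H" "l \<in> carrier H" for h g l
      using mult_left_of_la_eq[OF L.form_bilinear'[unfolded \<zeta>_def] la_eq[unfolded \<zeta>_def] that]
      unfolding \<zeta>_def .
    show "\<zeta> \<one>\<^bsub>H\<^esub> h = counit H h" if "h \<in> carrier H" for h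
      using that by (simp add: \<zeta>_def la_one)
    fix h g assume hg: "h \<in> carrier H" "g \<in> carrier H"
    have "sw H h (\<lambda>h1 h2. sw H g (\<lambda>g1 g2. \<zeta> h1 g1 \<odot>\<^bsub>H\<^esub> (g2 \<otimes>\<^bsub>H\<^esub> h2)))
        = sw H h (\<lambda>h1 h2. la h1 g \<otimes>\<^bsub>H\<^esub> h2)"
    proof (rule sw_cong)
      fix h1 h2 assume h12: "h1 \<in> carrier H" "h2 \<in> carrier H"
      have "la h1 g \<otimes>\<^bsub>H\<^esub> h2 = sw H g (\<lambda>a b. \<zeta> h1 a \<odot>\<^bsub>H\<^esub> b) \<otimes>\<^bsub>H\<^esub> h2"
        using la_eq h12 hg by simp
      also have "\<dots> = sw H g (\<lambda>a b. (\<zeta> h1 a \<odot>\<^bsub>H\<^esub> b) \<otimes>\<^bsub>H\<^esub> h2)"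
        by (rule linear_map_sw[where \<phi> = "\<lambda>x. x \<otimes>\<^bsub>H\<^esub> h2"]) (use h12 hg in \<open>auto intro!: lin\<close>)
      also have "\<dots> = sw H g (\<lambda>g1 g2. \<zeta> h1 g1 \<odot>\<^bsub>H\<^esub> (g2 \<otimes>\<^bsub>H\<^esub> h2))"
        by (intro sw_cong) (use h12 hg in \<open>auto simp: smult_mult_left\<close>)
      finally show "sw H g (\<lambda>g1 g2. \<zeta> h1 g1 \<odot>\<^bsub>H\<^esub> (g2 \<otimes>\<^bsub>H\<^esub> h2)) = la h1 g \<otimes>\<^bsub>H\<^esub> h2" ..
    qed (use hg in auto)
    also have "\<dots> = sw H h (\<lambda>h1 h2. sw H g (\<lambda>g1 g2. \<zeta> h2 g2 \<odot>\<^bsub>H\<^esub> (h1 \<otimes>\<^bsub>H\<^esub> g1)))"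
      unfolding \<zeta>_def by (rule la_compatible[OF ydl hg])
    finally show "sw H h (\<lambda>h1 h2. sw H g (\<lambda>g1 g2. \<zeta> h1 g1 \<odot>\<^bsub>H\<^esub> (g2 \<otimes>\<^bsub>H\<^esub> h2)))
        = sw H h (\<lambda>h1 h2. sw H g (\<lambda>g1 g2. \<zeta> h2 g2 \<odot>\<^bsub>H\<^esub> (h1 \<otimes>\<^bsub>H\<^esub> g1)))" .
  qed
  show "cotriangular_hopf_algebra K H \<xi>"
  proof (rule R.cotriangular)
    show "\<xi> (h \<otimes>\<^bsub>H\<^esub> g) l = sw KK l (\<lambda>l1 l2. \<xi> h l2 \<otimes>\<^bsub>K\<^esub> \<xi> g l1)"
      if "h \<in> carrier H" "g \<in> carrier H" "l \<in> carrier H" for h g l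
      using mult_left_of_ra_eq[OF R.form_bilinear'[unfolded \<xi>_def] ra_eq[unfolded \<xi>_def] that]
      unfolding \<xi>_def .
    show "\<xi> \<one>\<^bsub>H\<^esub> h = counit H h" if "h \<in> carrier H" for h
      using that by (simp add: \<xi>_def ra_one)
    fix h g assume hg: "h \<in> carrier H" "g \<in> carrier H"
    have "sw H h (\<lambda>h1 h2. sw H g (\<lambda>g1 g2. \<xi> h2 g2 \<odot>\<^bsub>H\<^esub> (h1 \<otimes>\<^bsub>H\<^esub> g1)))
        = sw H h (\<lambda>h1 h2. h1 \<otimes>\<^bsub>H\<^esub> ra g h2)"
    proof (rule sw_cong)
      fix h1 h2 assume h12: "h1 \<in> carrier H" "h2 \<in> carrier H"
      have "h1 \<otimes>\<^bsub>H\<^esub> ra g h2 = h1 \<otimes>\<^bsub>H\<^esub> sw H g (\<lambda>a b. \<xi> h2 b \<odot>\<^bsub>H\<^esub> a)"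
        using ra_eq h12 hg by simp
      also have "\<dots> = sw H g (\<lambda>a b. h1 \<otimes>\<^bsub>H\<^esub> (\<xi> h2 b \<odot>\<^bsub>H\<^esub> a))"
        by (rule linear_map_sw[where \<phi> = "\<lambda>x. h1 \<otimes>\<^bsub>H\<^esub> x"]) (use h12 hg in \<open>auto intro!: lin\<close>)
      also have "\<dots> = sw H g (\<lambda>g1 g2. \<xi> h2 g2 \<odot>\<^bsub>H\<^esub> (h1 \<otimes>\<^bsub>H\<^esub> g1))"
        by (intro sw_cong) (use h12 hg in \<open>auto simp: smult_mult_right\<close>)
      finally show "sw H g (\<lambda>g1 g2. \<xi> h2 g2 \<odot>\<^bsub>H\<^esub> (h1 \<otimes>\<^bsub>H\<^esub> g1)) = h1 \<otimes>\<^bsub>H\<^esub> ra g h2" ..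
    qed (use hg in auto)
    also have "\<dots> = sw H h (\<lambda>h1 h2. sw H g (\<lambda>g1 g2. \<xi> h1 g1 \<odot>\<^bsub>H\<^esub> (g2 \<otimes>\<^bsub>H\<^esub> h2)))"
      unfolding \<xi>_def by (rule ra_compatible[OF ydl hg])
    finally show "sw H h (\<lambda>h1 h2. sw H g (\<lambda>g1 g2. \<xi> h1 g1 \<odot>\<^bsub>H\<^esub> (g2 \<otimes>\<^bsub>H\<^esub> h2)))
        = sw H h (\<lambda>h1 h2. sw H g (\<lambda>g1 g2. \<xi> h2 g2 \<odot>\<^bsub>H\<^esub> (h1 \<otimes>\<^bsub>H\<^esub> g1)))" ..
  qed
qed

lemma symmetry_of_symmetric_forms:
  assumes "symmetric_form K H \<zeta>" and "symmetric_form K H \<xi>"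
    and la_eq: "\<And>h k. h \<in> carrier H \<Longrightarrow> k \<in> carrier H \<Longrightarrow> la h k = sw H k (\<lambda>a b. \<zeta> h a \<odot>\<^bsub>H\<^esub> b)"
    and ra_eq: "\<And>h l. h \<in> carrier H \<Longrightarrow> l \<in> carrier H \<Longrightarrow> ra l h = sw H l (\<lambda>a b. \<xi> h b \<odot>\<^bsub>H\<^esub> a)"
    and t: "t \<in> carrier H4"
  shows "\<psi> (\<psi> t) = t"
proof -
  interpret L: symmetric_form K H \<zeta> by fact
  interpret R: symmetric_form K H \<xi> by fact
  have pure: "\<psi> (\<psi> (tens K HH HH (tens K H H k l) (tens K H H g h)))
      = tens K HH HH (tens K H H k l) (tens K H H g h)"
    if klgh: "k \<in> carrier H" "l \<in> carrier H" "g \<in> carrier H" "h \<in> carrier H" for k l g h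
  proof -
    let ?e = "\<lambda>a b c d. tens K HH HH (tens K H H a b) (tens K H H c d)"
    let ?T = "\<lambda>a c. sw H4 h (\<lambda>h1 h2. sw H4 (ra l h2) (\<lambda>y1 y2. ?e a y1 c (ra h1 y2)))"
    have "\<psi> (\<psi> (?e k l g h)) = sw H4 k (\<lambda>k1 k2. sw H4 (la k1 g) (\<lambda>z1 z2. ?T (la z1 k2) z2))"
      unfolding braiding_squared_tens[OF klgh]
      by (intro sw_cong sw_swap) (use klgh in \<open>auto intro!: sw_closed\<close>)
    also have "\<dots> = ?T k g"
      by (rule L.involutive_left[OF la_bilinear la_eq])
        (use klgh in \<open>auto intro!: bilinear_mapI lin\<close>)
    also have "\<dots> = ?e k l g h"
      by (rule R.involutive_right[OF ra_bilinear ra_eq])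
        (use klgh in \<open>auto intro!: bilinear_mapI lin\<close>)
    finally show ?thesis .
  qed
  note \<psi>2 = linear_map_compose[OF braiding_linear braiding_linear]
  have half: "\<psi> (\<psi> (tens K HH HH (tens K H H k l) n)) = tens K HH HH (tens K H H k l) n"
    if kl: "k \<in> carrier H" "l \<in> carrier H" and n: "n \<in> carrier HH" for k l n
    by (rule tensor_ext[where \<phi> = "\<lambda>n. \<psi> (\<psi> (tens K HH HH (tens K H H k l) n))", OF _ _ _ _ _ _ n])
      (use kl pure in \<open>auto intro!: linear_map_compose[OF \<psi>2] lin\<close>)
  have "\<psi> (\<psi> (tens K HH HH m n)) = tens K HH HH m n" if m: "m \<in> carrier HH" and n: "n \<in> carrier HH" for m n
    by (rule tensor_ext[where \<phi> = "\<lambda>m. \<psi> (\<psi> (tens K HH HH m n))", OF _ _ _ _ _ _ m])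
      (use n half in \<open>auto intro!: linear_map_compose[OF \<psi>2] lin\<close>)
  then show ?thesis
    by (intro tensor_ext[where \<phi> = "\<lambda>t. \<psi> (\<psi> t)", OF _ _ _ \<psi>2 linear_map_id _ t]) auto
qed

text \<open>The tensor factors that \<^const>\<open>actions_from_forms\<close> carries along are removed by taking them
  to be \<open>1\<close> and applying the counit.\<close>

lemma actions_from_forms_iff:
  assumes \<zeta>: "bilinear_map K H H KK \<zeta>" and \<xi>: "bilinear_map K H H KK \<xi>"
  shows "actions_from_forms K H la ra \<zeta> \<xi> \<longleftrightarrow>
    (\<forall>h\<in>carrier H. \<forall>k\<in>carrier H.
      la h k = sw H k (\<lambda>a b. \<zeta> h a \<odot>\<^bsub>H\<^esub> b) \<and> ra k h = sw H k (\<lambda>a b. \<xi> h b \<odot>\<^bsub>H\<^esub> a))"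
proof -
  interpret L: hopf_form K H \<zeta> by unfold_locales (rule \<zeta>)
  interpret R: hopf_form K H \<xi> by unfold_locales (rule \<xi>)
  have cancel_right: "x = y"
    if "tens K H H x \<one>\<^bsub>H\<^esub> = tens K H H y \<one>\<^bsub>H\<^esub>" "x \<in> carrier H" "y \<in> carrier H" for x y
    using arg_cong[OF that(1), of "\<lambda>t. tensor_lift K H t (\<lambda>a c. counit H c \<odot>\<^bsub>H\<^esub> a)"] that(2,3)
    by (simp add: counit_leg_tens counit_one)
  have cancel_left: "x = y"
    if "tens K H H \<one>\<^bsub>H\<^esub> x = tens K H H \<one>\<^bsub>H\<^esub> y" "x \<in> carrier H" "y \<in> carrier H" for x y
    using arg_cong[OF that(1), of "\<lambda>t. tensor_lift K H t (\<lambda>a c. counit H a \<odot>\<^bsub>H\<^esub> c)"] that(2,3)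
    by (simp add: counit_leg_tens counit_one)
  show ?thesis
  proof
    assume act: "actions_from_forms K H la ra \<zeta> \<xi>"
    show "\<forall>h\<in>carrier H. \<forall>k\<in>carrier H.
      la h k = sw H k (\<lambda>a b. \<zeta> h a \<odot>\<^bsub>H\<^esub> b) \<and> ra k h = sw H k (\<lambda>a b. \<xi> h b \<odot>\<^bsub>H\<^esub> a)"
    proof (intro ballI conjI)
      fix h k assume hk: "h \<in> carrier H" "k \<in> carrier H"
      have "tens K H H (la h k) \<one>\<^bsub>H\<^esub> = tens K H H (sw H k (\<lambda>a b. \<zeta> h a \<odot>\<^bsub>H\<^esub> b)) \<one>\<^bsub>H\<^esub>"
        and "tens K H H \<one>\<^bsub>H\<^esub> (ra k h) = tens K H H \<one>\<^bsub>H\<^esub> (sw H k (\<lambda>a b. \<xi> h b \<odot>\<^bsub>H\<^esub> a))"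
        using act hk H.one_closed unfolding actions_from_forms_def by blast+
      moreover have "sw H k (\<lambda>a b. \<zeta> h a \<odot>\<^bsub>H\<^esub> b) \<in> carrier H" "sw H k (\<lambda>a b. \<xi> h b \<odot>\<^bsub>H\<^esub> a) \<in> carrier H"
        using hk by (auto intro!: sw_closed)
      ultimately show "la h k = sw H k (\<lambda>a b. \<zeta> h a \<odot>\<^bsub>H\<^esub> b)" "ra k h = sw H k (\<lambda>a b. \<xi> h b \<odot>\<^bsub>H\<^esub> a)"
        using hk cancel_left cancel_right by auto
    qed
  next
    assume "\<forall>h\<in>carrier H. \<forall>k\<in>carrier H.
      la h k = sw H k (\<lambda>a b. \<zeta> h a \<odot>\<^bsub>H\<^esub> b) \<and> ra k h = sw H k (\<lambda>a b. \<xi> h b \<odot>\<^bsub>H\<^esub> a)"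
    then show "actions_from_forms K H la ra \<zeta> \<xi>"
      unfolding actions_from_forms_def by (auto simp only: lact_tens ract_tens)
  qed
qed

lemma counit_action_eq_form:
  assumes \<zeta>: "bilinear_map K H H KK \<zeta>" and hk: "h \<in> carrier H" "k \<in> carrier H"
  shows "counit H (sw H k (\<lambda>a b. \<zeta> h a \<odot>\<^bsub>H\<^esub> b)) = \<zeta> h k"
    and "counit H (sw H k (\<lambda>a b. \<zeta> h b \<odot>\<^bsub>H\<^esub> a)) = \<zeta> h k"
proof -
  interpret L: hopf_form K H \<zeta> by unfold_locales (rule \<zeta>)
  have "counit H (sw H k (\<lambda>a b. \<zeta> h a \<odot>\<^bsub>H\<^esub> b)) = sw KK k (\<lambda>a b. counit H (\<zeta> h a \<odot>\<^bsub>H\<^esub> b))"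
    by (rule linear_map_sw[OF _ _ _ counit_linear]) (use hk in auto)
  also have "\<dots> = sw KK k (\<lambda>a b. counit H b \<odot>\<^bsub>KK\<^esub> \<zeta> h a)"
    by (intro sw_cong) (use hk in \<open>auto simp: linear_map_smult[OF counit_linear] m_comm\<close>)
  also have "\<dots> = \<zeta> h k"
    by (rule sw_counit_right) (use hk in \<open>auto intro: bilinear_map_right[OF \<zeta>]\<close>)
  finally show "counit H (sw H k (\<lambda>a b. \<zeta> h a \<odot>\<^bsub>H\<^esub> b)) = \<zeta> h k" .
  have "counit H (sw H k (\<lambda>a b. \<zeta> h b \<odot>\<^bsub>H\<^esub> a)) = sw KK k (\<lambda>a b. counit H (\<zeta> h b \<odot>\<^bsub>H\<^esub> a))"
    by (rule linear_map_sw[OF _ _ _ counit_linear]) (use hk in auto)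
  also have "\<dots> = sw KK k (\<lambda>a b. counit H a \<odot>\<^bsub>KK\<^esub> \<zeta> h b)"
    by (intro sw_cong) (use hk in \<open>auto simp: linear_map_smult[OF counit_linear] m_comm\<close>)
  also have "\<dots> = \<zeta> h k"
    by (rule sw_counit_left) (use hk in \<open>auto intro: bilinear_map_right[OF \<zeta>]\<close>)
  finally show "counit H (sw H k (\<lambda>a b. \<zeta> h b \<odot>\<^bsub>H\<^esub> a)) = \<zeta> h k" .
qed

lemma forms_from_braiding_counit:
  "forms_from_braiding K H la ra (\<lambda>h k. counit H (la h k)) (\<lambda>h l. counit H (ra l h))"
  unfolding forms_from_braiding_def by (simp add: counit4_braiding)

end

lemma (in cotriangular_hopf_algebra) symmetric_form: "symmetric_form K H \<zeta>"
proof
  show "bilinear_map K H H KK \<zeta>" by (rule form_bilinear)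
  show "sw KK h (\<lambda>h1 h2. sw KK g (\<lambda>g1 g2. \<zeta> h1 g1 \<otimes>\<^bsub>K\<^esub> \<zeta> g2 h2)) = counit H h \<otimes>\<^bsub>K\<^esub> counit H g"
    if "h \<in> carrier H" "g \<in> carrier H" for h g
    using form_symmetric[OF that] that by (simp add: form_convolution_def m_comm)
qed

theorem theorem6p3:
  fixes K :: "('k, 'r) ring_scheme" and H :: "('k, 'h, 'm) hopf_scheme"
    and la ra :: "'h \<Rightarrow> 'h \<Rightarrow> 'h"
  defines "M \<equiv> square_ydl K H la ra"
  defines "\<psi> \<equiv> ydl_braiding K M M"
  defines "\<psi>_symmetry \<equiv> (\<forall>t\<in>carrier (tensor_space K M M). \<psi> (\<psi> t) = t)"
  assumes "hopf_algebra K H"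
    and "bij_betw (antipode H) (carrier H) (carrier H)"
    and "left_action K H H la"
    and "right_action K H H ra"
    and "ydl_bimodule K H M"
  shows "(\<psi>_symmetry \<and>
        (\<forall>h\<in>carrier H. \<forall>k\<in>carrier H. counit H (la h k) = counit H (ra k h))
      \<longleftrightarrow> (\<exists>\<zeta>. cotriangular_hopf_algebra K H \<zeta> \<and>
            forms_from_braiding K H la ra \<zeta> \<zeta> \<and> actions_from_forms K H la ra \<zeta> \<zeta>)) \<and>
    (\<psi>_symmetry
      \<longleftrightarrow> (\<exists>\<zeta> \<xi>. cotriangular_hopf_algebra K H \<zeta> \<and> cotriangular_hopf_algebra K H \<xi> \<and>
            forms_from_braiding K H la ra \<zeta> \<xi> \<and> actions_from_forms K H la ra \<zeta> \<xi>))"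
proof -
  interpret hopf_algebra K H by fact
  interpret hopf_actions K H la ra
    by unfold_locales fact+
  let ?\<zeta> = "\<lambda>h k. counit H (la h k)" and ?\<xi> = "\<lambda>h l. counit H (ra l h)"
  let ?H4 = "tensor_space K (tensor_space K H H) (tensor_space K H H)"
  have sym_iff: "\<psi>_symmetry \<longleftrightarrow> (\<forall>t\<in>carrier ?H4. ydl_braiding K (square_ydl K H la ra) (square_ydl K H la ra)
      (ydl_braiding K (square_ydl K H la ra) (square_ydl K H la ra) t) = t)"
    unfolding \<psi>_symmetry_def \<psi>_def M_def by (simp add: tensor_space_square_ydl)
  note ydl = assms(8)[unfolded M_def]
  have forward: "cotriangular_hopf_algebra K H ?\<zeta> \<and> cotriangular_hopf_algebra K H ?\<xi> \<and>
      actions_from_forms K H la ra ?\<zeta> ?\<xi>" if sym: \<psi>_symmetry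
  proof -
    note * = cotriangular_of_symmetry[OF sym[unfolded sym_iff, rule_format] ydl]
    interpret L: cotriangular_hopf_algebra K H ?\<zeta> by (rule *(1))
    interpret R: cotriangular_hopf_algebra K H ?\<xi> by (rule *(2))
    show ?thesis
      using *(1,2) actions_from_forms_iff[OF L.form_bilinear R.form_bilinear] *(3,4) by blast
  qed
  have backward: \<psi>_symmetry
    if \<zeta>: "cotriangular_hopf_algebra K H \<zeta>" and \<xi>: "cotriangular_hopf_algebra K H \<xi>"
      and act: "actions_from_forms K H la ra \<zeta> \<xi>" for \<zeta> \<xi>
  proof -
    interpret L: cotriangular_hopf_algebra K H \<zeta> by fact
    interpret R: cotriangular_hopf_algebra K H \<xi> by fact
    show ?thesis
      unfolding sym_iff
      using symmetry_of_symmetric_forms[OF L.symmetric_form R.symmetric_form]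
        act[unfolded actions_from_forms_iff[OF L.form_bilinear R.form_bilinear]] by blast
  qed
  have agree: "counit H (la h k) = counit H (ra k h)"
    if \<zeta>: "cotriangular_hopf_algebra K H \<zeta>" and act: "actions_from_forms K H la ra \<zeta> \<zeta>"
      and hk: "h \<in> carrier H" "k \<in> carrier H" for \<zeta> h k
  proof -
    interpret L: cotriangular_hopf_algebra K H \<zeta> by fact
    show ?thesis
      using act[unfolded actions_from_forms_iff[OF L.form_bilinear L.form_bilinear]] hk
        counit_action_eq_form[OF L.form_bilinear hk] by metis
  qed
  have same_form: "forms_from_braiding K H la ra ?\<zeta> ?\<zeta> \<and> actions_from_forms K H la ra ?\<zeta> ?\<zeta>"
    if sym: \<psi>_symmetry and eq: "\<forall>h\<in>carrier H. \<forall>k\<in>carrier H. counit H (la h k) = counit H (ra k h)"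
  proof
    show "forms_from_braiding K H la ra ?\<zeta> ?\<zeta>"
      using forms_from_braiding_counit eq unfolding forms_from_braiding_def by auto
    interpret L: cotriangular_hopf_algebra K H ?\<zeta> using forward[OF sym] by blast
    interpret R: cotriangular_hopf_algebra K H ?\<xi> using forward[OF sym] by blast
    have act: "la h k = sw H k (\<lambda>a b. ?\<zeta> h a \<odot>\<^bsub>H\<^esub> b)" "ra k h = sw H k (\<lambda>a b. ?\<xi> h b \<odot>\<^bsub>H\<^esub> a)"
      if "h \<in> carrier H" "k \<in> carrier H" for h k
      using forward[OF sym] that actions_from_forms_iff[OF L.form_bilinear R.form_bilinear] by blast+
    moreover have "sw H k (\<lambda>a b. ?\<xi> h b \<odot>\<^bsub>H\<^esub> a) = sw H k (\<lambda>a b. ?\<zeta> h b \<odot>\<^bsub>H\<^esub> a)"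
      if "h \<in> carrier H" "k \<in> carrier H" for h k
      by (intro sw_cong) (use eq that in auto)
    ultimately show "actions_from_forms K H la ra ?\<zeta> ?\<zeta>"
      unfolding actions_from_forms_iff[OF L.form_bilinear L.form_bilinear] by metis
  qed
  show ?thesis
    using forward backward agree same_form forms_from_braiding_counit by blast
qed

end
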